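(* For an integer $n$ let $\overline{n}$ denote the least positive residue of $n$ modulo $3$. Let $n$ be a nonnegative integer. (1) If $n\not\equiv 0 \pmod 3$, then $$\sum_{k=0}^{\infty} \Bigl( \sum_{d \mid 3k+\overline{2n}} d^{2n-1} \Bigr) q^{(3k+\overline{2n})/3}$$ is a homogeneous polynomial in $c(q)$ and $b(q)$ over $\mathbb{Q}$. (2) If $n\not\equiv 1 \pmod 3$, then $$\sum_{k=0}^{\infty} \Bigl( \sum_{d \mid 3k+\overline{2n+1}} \left(\frac{d}{3}\right) d^{2n} \Bigr) q^{(3k+\overline{2n+1})/3}$$ is a homogeneous polynomial in $c(q)$ and $b(q)$ over $\mathbb{Q}$. Here the inner sums run over positive divisors.
   Context: $\left(\frac{\cdot}{3}\right)$ is the Jacobi (Legendre) symbol modulo $3$. Let $q=e^{2\pi i\tau}$ with $\operatorname{Im}\tau>0$, and for rational $s$ let $q^{s}=e^{2\pi i s\tau}$. The functions $b$ and $c$ are the Borweins' cubic theta functions $$b(q)=\sum_{m,n=-\infty}^{\infty}\omega^{n-m}q^{n^2+nm+m^2},\qquad c(q)=\sum_{m,n=-\infty}^{\infty} q^{(n+\frac13)^2+(n+\frac13)(m+\frac13)+(m+\frac13)^2},\qquad \omega=e^{2\pi i/3}.$$ *)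

theory Defs
  imports
    "HOL-Analysis.Analysis"
    "HOL-Computational_Algebra.Polynomial"
    "HOL-Number_Theory.Residues"
begin

text \<open>Fractional powers of \<open>q = exp (2\<pi>i\<tau>)\<close> depend on \<open>\<tau>\<close> and not only on \<open>q\<close>, so all
  functions of \<open>q\<close> are written as functions of \<open>\<tau>\<close>.\<close>

definition qpow :: "complex \<Rightarrow> rat \<Rightarrow> complex" where
  "qpow \<tau> s = exp (2 * of_real pi * \<i> * of_rat s * \<tau>)"

definition omega :: complex where
  "omega = exp (2 * of_real pi * \<i> / 3)"

text \<open>The Borweins' cubic theta functions. For \<open>Im \<tau> > 0\<close> both double series converge
  absolutely, hence as unordered sums over pairs of integers.\<close>

definition borwein_b :: "complex \<Rightarrow> complex" where
  "borwein_b \<tau> = (\<Sum>\<^sub>\<infinity>(m, n) \<in> (UNIV :: (int \<times> int) set).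
     omega powi (n - m) * qpow \<tau> (of_int (n^2 + n * m + m^2)))"

definition borwein_c :: "complex \<Rightarrow> complex" where
  "borwein_c \<tau> = (\<Sum>\<^sub>\<infinity>(m, n) \<in> (UNIV :: (int \<times> int) set).
     qpow \<tau> ((of_int n + 1/3)^2 + (of_int n + 1/3) * (of_int m + 1/3) + (of_int m + 1/3)^2))"

definition least_pos_residue3 :: "int \<Rightarrow> nat" where
  "least_pos_residue3 n = (LEAST r. 0 < r \<and> [int r = n] (mod 3))"

text \<open>A polynomial in \<open>X, Y\<close> over the rationals is an element of \<open>rat poly poly\<close>:
  the coefficient of \<open>X\<^sup>i Y\<^sup>j\<close> in \<open>P\<close> is \<open>coeff (coeff P j) i\<close>.\<close>

definition homogeneous2 :: "nat \<Rightarrow> rat poly poly \<Rightarrow> bool" where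
  "homogeneous2 N P \<longleftrightarrow> (\<forall>i j. Polynomial.coeff (Polynomial.coeff P j) i \<noteq> 0 \<longrightarrow> i + j = N)"

definition eval2 :: "rat poly poly \<Rightarrow> complex \<Rightarrow> complex \<Rightarrow> complex" where
  "eval2 P x y = poly (map_poly (\<lambda>p. poly (map_poly of_rat p) x) P) y"

end

theory Submission
  imports Defs "HOL-Computational_Algebra.Formal_Laurent_Series"
begin

text \<open>Put \<open>x = q\<^sup>1\<^sup>/\<^sup>3\<close> and let \<open>k\<close> be the weight, that is \<open>2n\<close> in part (1) and \<open>2n + 1\<close> in part (2).
Let \<open>E\<^sub>j(x) = \<Sum>\<^sub>N (\<Sum>\<^sub>d\<^sub>|\<^sub>N \<chi>\<^sub>j(N/d) d\<^sup>j) x\<^sup>N\<close>, where \<open>\<chi>\<^sub>j\<close> is the trivial character modulo 3 for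
odd \<open>j\<close> and the quadratic one for even \<open>j\<close>, with the constant \<open>1/6\<close> added to \<open>E\<^sub>0\<close>. Up to a
sign, the series of the theorem consists of the terms of \<open>E\<^sub>k\<^sub>-\<^sub>1\<close> whose exponent is congruent
to \<open>k\<close> modulo 3. So it suffices to write \<open>E\<^sub>k\<^sub>-\<^sub>1\<close> as a rational form of degree \<open>k\<close> in
\<open>A = a(q)\<close> and \<open>c = c(q)\<close>, where \<open>a(q)\<close> is the theta series of the Eisenstein integers:
replacing \<open>x\<close> by \<open>\<omega>x\<close> fixes \<open>A\<close> and multiplies \<open>c\<close> by \<open>\<omega>\<close>, so the selected terms are the
monomials \<open>A\<^sup>i c\<^sup>j\<close> with \<open>j \<equiv> k\<close>, hence \<open>3 | i\<close>, and \<open>A\<^sup>3 = b\<^sup>3 + c\<^sup>3\<close> finishes the argument.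

The functions \<open>E\<^sub>j\<close> are the Taylor coefficients of \<open>Z(\<alpha>) = \<Sum>\<^sub>n c\<^sub>n exp(n\<alpha>)\<close> with
\<open>c\<^sub>n = x\<^sup>n / (1 - x\<^sup>3\<^sup>n)\<close> and \<open>c\<^sub>0 = 1/6\<close>. Up to a linear function, this is the Weierstrass zeta function
of the elliptic curve of nome \<open>x\<^sup>3\<close>, expanded at a point \<open>P\<close> of order 3. Because \<open>3P = 0\<close>,
the addition theorem takes the form \<open>(Z(\<alpha>) + Z(\<beta>) + Z(\<gamma>))\<^sup>2 = Z'(\<alpha>) + Z'(\<beta>) + Z'(\<gamma>) + const\<close>
for \<open>\<alpha> + \<beta> + \<gamma> = 0\<close>. On Laurent coefficients it amounts to the relation
\<open>laurent_coeff_three_term\<close> together with the convolution formula \<open>laurent_conv\<close>. It yields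
\<open>eisenstein_recurrence\<close>, which gives every \<open>E\<^sub>j\<close> with \<open>j \<ge> 3\<close> as a polynomial in \<open>E\<^sub>0\<close> and \<open>E\<^sub>2\<close>,
and \<open>eisenstein_weight_2\<close>, which gives \<open>E\<^sub>1\<close> as \<open>3 E\<^sub>0\<^sup>2\<close> up to a function of \<open>x\<^sup>3\<close>; the
latter has no term with exponent congruent to 2 modulo 3.

What remains is \<open>6 E\<^sub>0 = A + 2c\<close> and \<open>3 E\<^sub>2 = A\<^sup>2c + Ac\<^sup>2 + c\<^sup>3\<close>. On the lattice side, a unitary map
of \<open>\<int>[\<omega>]\<^sup>3\<close> proves \<open>a\<^sup>3 = b\<^sup>3 + c\<^sup>3\<close> (\<open>theta_a_cubes\<close>); with \<open>a(x) = A + 2c\<close> and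
\<open>b(x) = A - c\<close> this expresses \<open>c(x)\<^sup>3\<close> by \<open>A = a(x\<^sup>3)\<close> and \<open>c = c(x\<^sup>3)\<close>. On the divisor side,
the coefficient of \<open>E\<^sub>j\<close> at \<open>3N\<close> is \<open>3\<^sup>j\<close> times the one at \<open>N\<close>; comparing this with the
recurrence for \<open>j = 3, 4, 5\<close> forces the same functional equation on the series obtained from \<open>E\<^sub>0\<close>
(\<open>cubic_hecke_relations\<close>). The equation determines a power series recursively
(\<open>cubic_system_unique\<close>), so both sides agree (\<open>lambert_series_eq_theta\<close>).\<close>

section \<open>Unordered sums and power series on the unit disc\<close>

lemma has_sum_product_complex:
  fixes f :: "'i \<Rightarrow> complex" and g :: "'j \<Rightarrow> complex"
  assumes f: "(f has_sum a) A" and g: "(g has_sum b) B"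
  shows "((\<lambda>(i, j). f i * g j) has_sum a * b) (A \<times> B)"
proof -
  have fs: "(\<lambda>i. norm (f i)) summable_on A" and gs: "(\<lambda>j. norm (g j)) summable_on B"
    using f g has_sum_imp_summable summable_on_iff_abs_summable_on_complex by blast+
  have "(\<lambda>p. norm ((\<lambda>(i, j). f i * g j) p)) summable_on A \<times> B"
    unfolding Infinite_Sum.abs_summable_on_Sigma_iff
    using fs gs
    by (auto simp: norm_mult abs_mult infsum_cmult_right intro!: summable_on_cmult_right summable_on_cmult_left)
  then have "(\<lambda>(i, j). f i * g j) summable_on A \<times> B"
    by (simp add: summable_on_iff_abs_summable_on_complex)
  then show ?thesis
    by (intro has_sum_SigmaI[where g = "\<lambda>i. f i * b"])
       (auto intro!: has_sum_cmult_right g has_sum_cmult_left f)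
qed

lemma has_sum_product_UNIV:
  fixes f :: "'i \<Rightarrow> complex" and g :: "'j \<Rightarrow> complex"
  assumes "(f has_sum a) UNIV" and "(g has_sum b) UNIV"
  shows "((\<lambda>(i, j). f i * g j) has_sum a * b) UNIV"
  using has_sum_product_complex[OF assms] by simp

lemma has_sum_reindex_inverse:
  assumes "\<And>u. r (s u) = u" "\<And>v. s (r v) = v" and "(f has_sum a) UNIV"
  shows "((\<lambda>u. f (s u)) has_sum a) UNIV"
proof -
  have "bij s" using assms(1,2) by (metis bijI')
  then show ?thesis using assms(3) has_sum_reindex_bij_betw[of s UNIV UNIV f a] by auto
qed

lemma summable_nat_power_times_geometric:
  fixes r :: real
  assumes "0 \<le> r" "r < 1"
  shows "summable (\<lambda>n. real n ^ k * r ^ n)"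
  using assms
proof (induction k arbitrary: r)
  case 0
  then show ?case by (simp add: summable_geometric)
next
  case (Suc k)
  have s: "0 \<le> sqrt r" "sqrt r < 1" using Suc.prems by auto
  have "(\<lambda>n. of_nat n * sqrt r ^ n) \<longlonglongrightarrow> 0"
    using s by (intro powser_times_n_limit_0) auto
  then obtain B where B: "\<And>n. norm (of_nat n * sqrt r ^ n) \<le> B"
    using convergentI convergent_imp_Bseq by (metis BseqD)
  have eq: "real n ^ Suc k * r ^ n = (real n * sqrt r ^ n) * (real n ^ k * sqrt r ^ n)" for n
    using Suc.prems by (simp flip: power_mult_distrib)
  have "summable (\<lambda>n. B * (real n ^ k * sqrt r ^ n))"
    by (intro summable_mult Suc.IH s)
  then show ?case
  proof (rule summable_comparison_test'[where N = 0])
    fix n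
    show "norm (real n ^ Suc k * r ^ n) \<le> B * (real n ^ k * sqrt r ^ n)"
      unfolding eq norm_mult[of "real n * sqrt r ^ n"]
      using B[of n] B[of 0] s by (intro mult_mono) auto
  qed
qed

text \<open>Summing the weights \<open>w\<close> along the fibres of an exponent function \<open>h\<close> turns an unordered sum over
any index set, such as a lattice or pairs of divisors, into a power series.\<close>

definition graded_series :: "('i \<Rightarrow> nat) \<Rightarrow> ('i \<Rightarrow> complex) \<Rightarrow> 'i set \<Rightarrow> complex fps" where
  "graded_series h w I = Abs_fps (\<lambda>N. \<Sum>i \<in> {i \<in> I. h i = N}. w i)"

lemma fps_conv_radius_ge_1_if_summable:
  fixes F :: "complex fps"
  assumes "\<And>x. norm x < 1 \<Longrightarrow> summable (\<lambda>N. fps_nth F N * x ^ N)"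
  shows "fps_conv_radius F \<ge> 1"
  unfolding fps_conv_radius_def
proof (rule conv_radius_geI_ex')
  fix r :: real assume "0 < r" "ereal r < 1"
  then show "summable (\<lambda>n. fps_nth F n * of_real r ^ n)" using assms[of "of_real r"] by simp
qed

lemma graded_series:
  fixes w :: "'i \<Rightarrow> complex"
  assumes fin: "\<And>N. finite {i \<in> I. h i = N}"
    and summ: "\<And>x. norm x < 1 \<Longrightarrow> (\<lambda>i. w i * x ^ h i) summable_on I"
  shows "fps_conv_radius (graded_series h w I) \<ge> 1"
    and "norm x < 1 \<Longrightarrow> ((\<lambda>i. w i * x ^ h i) has_sum eval_fps (graded_series h w I) x) I"
proof -
  have main: "(\<lambda>N. fps_nth (graded_series h w I) N * x ^ N) sums infsum (\<lambda>i. w i * x ^ h i) I"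
    if x: "norm x < 1" for x
  proof -
    have "((\<lambda>i. w i * x ^ h i) has_sum infsum (\<lambda>i. w i * x ^ h i) I) I"
      using summ[OF x] by simp
    also have "?this \<longleftrightarrow> ((\<lambda>(N, i). w i * x ^ h i) has_sum infsum (\<lambda>i. w i * x ^ h i) I)
        (Sigma UNIV (\<lambda>N. {i \<in> I. h i = N}))"
      by (rule has_sum_reindex_bij_witness[of _ snd "\<lambda>i. (h i, i)"]) auto
    finally have "((\<lambda>N. fps_nth (graded_series h w I) N * x ^ N) has_sum infsum (\<lambda>i. w i * x ^ h i) I) UNIV"
      by (rule has_sum_SigmaD)
         (auto simp: graded_series_def sum_distrib_right intro!: has_sum_finiteI fin)
    then show ?thesis by (rule has_sum_imp_sums)
  qed
  show rad: "fps_conv_radius (graded_series h w I) \<ge> 1"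
    using main by (intro fps_conv_radius_ge_1_if_summable) (auto simp: sums_iff)
  assume x: "norm x < 1"
  then have "eval_fps (graded_series h w I) x = infsum (\<lambda>i. w i * x ^ h i) I"
    using main[OF x] by (simp add: eval_fps_def sums_iff)
  with summ[OF x] show "((\<lambda>i. w i * x ^ h i) has_sum eval_fps (graded_series h w I) x) I"
    by simp
qed

section \<open>Theta series of the Eisenstein lattice\<close>

lemma summable_on_int_if_summable:
  fixes g :: "int \<Rightarrow> real"
  assumes "\<And>n. g n \<ge> 0" "summable (\<lambda>n. g (int n))" "summable (\<lambda>n. g (- int n))"
  shows "g summable_on UNIV"
proof -
  have 1: "g summable_on range int"
    using assms by (subst summable_on_reindex) (auto simp: o_def summable_on_UNIV_nonneg_real_iff)
  have 2: "g summable_on range (\<lambda>n. - int n)"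
    using assms by (subst summable_on_reindex) (auto simp: o_def summable_on_UNIV_nonneg_real_iff inj_on_def)
  have "UNIV = range int \<union> range (\<lambda>n. - int n)"
  proof (intro equalityI subsetI)
    fix n :: int
    show "n \<in> range int \<union> range (\<lambda>n. - int n)" by (cases n rule: int_cases2) auto
  qed auto
  then show ?thesis using summable_on_union[OF 1 2] by simp
qed

text \<open>The remaining coordinates \<open>w\<close> are carried along so that the same lemma splits sums over a lattice of
any rank by the residue of one integer coordinate.\<close>

lemma has_sum_split_mod_3:
  fixes f :: "int \<times> 'w \<Rightarrow> complex"
  assumes f: "(f has_sum S) UNIV"
  assumes "((\<lambda>(k, w). f (3 * k, w)) has_sum S0) UNIV"
      and "((\<lambda>(k, w). f (3 * k + 1, w)) has_sum S1) UNIV"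
      and "((\<lambda>(k, w). f (3 * k + 2, w)) has_sum S2) UNIV"
  shows "S = S0 + S1 + S2"
proof -
  define K where "K r = {p :: int \<times> 'w. fst p mod 3 = r}" for r
  have *: "(f has_sum T) (K r)" if "((\<lambda>(k, w). f (3 * k + r, w)) has_sum T) UNIV" "r \<in> {0, 1, 2}" for r T
    using that(1)
    by (subst has_sum_reindex_bij_witness[where j = "\<lambda>(k, w). (k div 3, w)"
          and i = "\<lambda>(k, w). (3 * k + r, w)" and T = UNIV and h = "\<lambda>(k, w). f (3 * k + r, w)" and s' = T])
       (use that(2) in \<open>auto simp: K_def algebra_simps minus_mod_eq_mult_div[symmetric]\<close>)
  have "(f has_sum S0 + S1) (K 0 \<union> K 1)"
    using assms by (intro has_sum_Un_disjoint *) (auto simp: K_def)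
  then have "(f has_sum S0 + S1 + S2) ((K 0 \<union> K 1) \<union> K 2)"
    using assms by (intro has_sum_Un_disjoint *) (auto simp: K_def)
  moreover have "(K 0 \<union> K 1) \<union> K 2 = UNIV" by (auto simp: K_def)
  ultimately show ?thesis using f has_sum_unique by metis
qed

lemma summable_on_comp_inj:
  fixes f :: "'u \<Rightarrow> complex"
  assumes "f summable_on UNIV" "inj s"
  shows "(\<lambda>v. f (s v)) summable_on UNIV"
  using summable_on_reindex[of s UNIV f] assms summable_on_subset[of f UNIV "range s"]
  by (simp add: o_def)

text \<open>The norm \<open>|m - n\<omega>|\<^sup>2\<close> on the Eisenstein integers, and its shift to the coset of
\<open>(1 - \<omega>)/3\<close>, normalised to take the value 0: \<open>|m + 1/3 - (n + 1/3)\<omega>|\<^sup>2 = shifted_norm_form m n + 1/3\<close>.\<close>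

definition norm_form :: "int \<Rightarrow> int \<Rightarrow> int" where "norm_form m n = m^2 + m * n + n^2"
definition shifted_norm_form :: "int \<Rightarrow> int \<Rightarrow> int" where "shifted_norm_form m n = m^2 + m * n + n^2 + m + n"

lemma abs_le_square_int: "\<bar>m\<bar> \<le> m^2" for m :: int
  by (metis abs_ge_zero int_one_le_iff_zero_less linorder_not_less mult.right_neutral mult_left_mono
      order_antisym_conv order_refl power2_abs power2_eq_square self_le_power zero_less_numeral zero_power2)

lemma norm_form_bound: "\<bar>m\<bar> + \<bar>n\<bar> \<le> 2 * norm_form m n + 4"
proof -
  have "2 * norm_form m n = (m + n)^2 + m^2 + n^2" by (simp add: norm_form_def power2_eq_square algebra_simps)
  moreover have "(m + n)^2 \<ge> 0" by simp
  ultimately show ?thesis using abs_le_square_int[of m] abs_le_square_int[of n] by linarith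
qed

lemma shifted_norm_form_bound: "\<bar>m\<bar> + \<bar>n\<bar> \<le> 2 * shifted_norm_form m n + 4"
proof -
  have "2 * shifted_norm_form m n = (m + n)^2 + (m + 1)^2 + (n + 1)^2 - 2"
    by (simp add: shifted_norm_form_def power2_eq_square algebra_simps)
  moreover have "(m + n)^2 \<ge> 0" by simp
  ultimately show ?thesis using abs_le_square_int[of "m + 1"] abs_le_square_int[of "n + 1"] by linarith
qed

lemma norm_form_nonneg: "norm_form m n \<ge> 0"
proof -
  have "2 * norm_form m n = (m + n)^2 + m^2 + n^2" by (simp add: norm_form_def power2_eq_square algebra_simps)
  moreover have "(m + n)^2 + m^2 + n^2 \<ge> 0" by simp
  ultimately show ?thesis by linarith
qed

lemma consecutive_product_nonneg: "k * (k + 1) \<ge> 0" for k :: int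
  by (cases "k \<ge> 0") (auto intro: mult_nonpos_nonpos)

lemma shifted_norm_form_nonneg: "shifted_norm_form m n \<ge> 0"
proof -
  have "2 * shifted_norm_form m n = (m + n) * (m + n + 1) + m * (m + 1) + n * (n + 1)"
    by (simp add: shifted_norm_form_def power2_eq_square algebra_simps)
  then show ?thesis
    using consecutive_product_nonneg[of "m + n"] consecutive_product_nonneg[of m] consecutive_product_nonneg[of n]
    by linarith
qed

text \<open>A quadratic form grows at least linearly, so the sum is dominated by a product of two geometric series.
The additive constant 4 makes one bound serve both forms.\<close>

lemma lattice_power_summable:
  fixes h :: "int \<times> int \<Rightarrow> nat"
  assumes h: "\<And>m n. \<bar>m\<bar> + \<bar>n\<bar> \<le> 2 * int (h (m, n)) + 4"
  shows "finite {p \<in> UNIV. h p = N}"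
    and "norm x < 1 \<Longrightarrow> (\<lambda>p. 1 * x ^ h p :: complex) summable_on UNIV"
proof -
  have "{p \<in> UNIV. h p = N} \<subseteq> {- (2 * int N + 4)..2 * int N + 4} \<times> {- (2 * int N + 4)..2 * int N + 4}"
    (is "_ \<subseteq> ?B")
  proof
    fix p assume "p \<in> {p \<in> UNIV. h p = N}"
    then have "\<bar>fst p\<bar> + \<bar>snd p\<bar> \<le> 2 * int N + 4" using h[of "fst p" "snd p"] by simp
    then show "p \<in> ?B" by (cases p) auto
  qed
  then show "finite {p \<in> UNIV. h p = N}" by (rule finite_subset) auto
  assume x: "norm x < 1"
  \<comment> \<open>The maximum keeps \<open>s\<close> positive when \<open>x = 0\<close>.\<close>
  define s where "s = max (sqrt (norm x)) (1 / 2)"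
  have s: "0 < s" "s < 1" "norm x \<le> s\<^sup>2"
  proof -
    show "0 < s" "s < 1" using x by (auto simp: s_def)
    have "norm x = sqrt (norm x) ^ 2" by simp
    also have "\<dots> \<le> s\<^sup>2" by (intro power_mono) (auto simp: s_def)
    finally show "norm x \<le> s\<^sup>2" .
  qed
  have "(\<lambda>m::int. s ^ nat \<bar>m\<bar>) summable_on UNIV"
    using s by (intro summable_on_int_if_summable) auto
  then have "((\<lambda>m::int. of_real (s ^ nat \<bar>m\<bar>) :: complex) has_sum
               of_real (infsum (\<lambda>m::int. s ^ nat \<bar>m\<bar>) UNIV)) UNIV"
    by (intro has_sum_of_real) auto
  from has_sum_imp_summable[OF has_sum_product_UNIV[OF this this]]
  have "(\<lambda>p::int \<times> int. norm ((\<lambda>(m, n). of_real (s ^ nat \<bar>m\<bar>) * of_real (s ^ nat \<bar>n\<bar>) :: complex) p)) summable_on UNIV"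
    by (simp add: summable_on_iff_abs_summable_on_complex)
  then have "(\<lambda>(m, n). s ^ nat \<bar>m\<bar> * s ^ nat \<bar>n\<bar>) summable_on (UNIV :: (int \<times> int) set)"
    using s by (simp add: case_prod_unfold norm_mult norm_power)
  then have "(\<lambda>p. inverse (s ^ 4) * (case p of (m, n) \<Rightarrow> s ^ nat \<bar>m\<bar> * s ^ nat \<bar>n\<bar>)) summable_on (UNIV :: (int \<times> int) set)"
    by (rule summable_on_cmult_right)
  then have "(\<lambda>p. norm (1 * x ^ h p)) summable_on UNIV"
  proof (rule Infinite_Sum.abs_summable_on_comparison_test')
    fix p :: "int \<times> int"
    obtain m n where p: "p = (m, n)" by fastforce
    have "norm (1 * x ^ h p) * s ^ 4 \<le> (s\<^sup>2) ^ h p * s ^ 4"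
      using s by (simp add: norm_power power_mono)
    also have "\<dots> = s ^ (2 * h p + 4)" by (simp add: power_add power_mult)
    also have "\<dots> \<le> s ^ (nat \<bar>m\<bar> + nat \<bar>n\<bar>)"
      using s h[of m n] by (intro power_decreasing) (auto simp: p)
    finally show "norm (1 * x ^ h p) \<le> inverse (s ^ 4) * (case p of (m, n) \<Rightarrow> s ^ nat \<bar>m\<bar> * s ^ nat \<bar>n\<bar>)"
      using s by (simp add: p field_simps power_add)
  qed
  then show "(\<lambda>p. 1 * x ^ h p :: complex) summable_on UNIV"
    by (simp add: summable_on_iff_abs_summable_on_complex)
qed

text \<open>In terms of \<open>q\<close>, these are \<open>a(q)\<close> and \<open>q\<^sup>-\<^sup>1\<^sup>/\<^sup>3 c(q)\<close>.\<close>

definition theta_a :: "complex fps" where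
  "theta_a = graded_series (\<lambda>(m, n). nat (norm_form m n)) (\<lambda>_. 1) UNIV"
definition theta_c :: "complex fps" where
  "theta_c = graded_series (\<lambda>(m, n). nat (shifted_norm_form m n)) (\<lambda>_. 1) UNIV"

lemma theta_a_radius: "fps_conv_radius theta_a \<ge> 1"
  and has_sum_theta_a: "norm x < 1 \<Longrightarrow> ((\<lambda>(m, n). x ^ nat (norm_form m n)) has_sum eval_fps theta_a x) UNIV"
proof -
  have b: "\<bar>m\<bar> + \<bar>n\<bar> \<le> 2 * int (case (m, n) of (m, n) \<Rightarrow> nat (norm_form m n)) + 4" for m n
    using norm_form_bound[of m n] by simp
  show "fps_conv_radius theta_a \<ge> 1"
    unfolding theta_a_def by (intro graded_series lattice_power_summable b)
  assume x: "norm x < 1"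
  show "((\<lambda>(m, n). x ^ nat (norm_form m n)) has_sum eval_fps theta_a x) UNIV"
    using graded_series(2)[OF lattice_power_summable[OF b] x]
    by (simp add: theta_a_def case_prod_unfold)
qed

lemma theta_c_radius: "fps_conv_radius theta_c \<ge> 1"
  and has_sum_theta_c: "norm x < 1 \<Longrightarrow> ((\<lambda>(m, n). x ^ nat (shifted_norm_form m n)) has_sum eval_fps theta_c x) UNIV"
proof -
  have b: "\<bar>m\<bar> + \<bar>n\<bar> \<le> 2 * int (case (m, n) of (m, n) \<Rightarrow> nat (shifted_norm_form m n)) + 4" for m n
    using shifted_norm_form_bound[of m n] by simp
  show "fps_conv_radius theta_c \<ge> 1"
    unfolding theta_c_def by (intro graded_series lattice_power_summable b)
  assume x: "norm x < 1"
  show "((\<lambda>(m, n). x ^ nat (shifted_norm_form m n)) has_sum eval_fps theta_c x) UNIV"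
    using graded_series(2)[OF lattice_power_summable[OF b] x]
    by (simp add: theta_c_def case_prod_unfold)
qed

section \<open>Trisection of the theta series\<close>

text \<open>\<open>m - n\<close> is the residue of \<open>m - n\<omega>\<close> modulo the prime \<open>1 - \<omega>\<close> of norm 3. Multiples of \<open>1 - \<omega>\<close>
reproduce the lattice with norms scaled by 3, and each of the other two classes is, after division by
\<open>1 - \<omega>\<close>, a copy of the shifted lattice.\<close>

lemma theta_a_trisection:
  assumes x: "norm x < 1"
  defines "a \<equiv> eval_fps theta_a" and "c \<equiv> \<lambda>x. x * eval_fps theta_c (x ^ 3)"
  shows "((\<lambda>(k, n). x ^ nat (norm_form (n + 3 * k) n)) has_sum a (x ^ 3)) UNIV"
   and "((\<lambda>(k, n). x ^ nat (norm_form (n + (3 * k + 1)) n)) has_sum c x) UNIV"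
   and "((\<lambda>(k, n). x ^ nat (norm_form (n + (3 * k + 2)) n)) has_sum c x) UNIV"
proof -
  have x3: "norm (x ^ 3) < 1" using x by (simp add: norm_power power_less_one_iff)
  have 1: "x ^ nat (norm_form (n + 3 * k) n) = (x ^ 3) ^ nat (norm_form (n + k) k)" for k n
  proof -
    have "norm_form (n + 3 * k) n = 3 * norm_form (n + k) k" by (simp add: norm_form_def power2_eq_square algebra_simps)
    then show ?thesis using norm_form_nonneg[of "n + k" k] by (simp add: nat_mult_distrib power_mult)
  qed
  have 2: "x ^ nat (norm_form (n + (3 * k + 1)) n) = x * (x ^ 3) ^ nat (shifted_norm_form (n + k) k)" for k n
  proof -
    have "norm_form (n + (3 * k + 1)) n = 3 * shifted_norm_form (n + k) k + 1"
      by (simp add: norm_form_def shifted_norm_form_def power2_eq_square algebra_simps)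
    then show ?thesis using shifted_norm_form_nonneg[of "n + k" k] by (simp add: nat_mult_distrib power_mult nat_add_distrib)
  qed
  have 3: "x ^ nat (norm_form (n + (3 * k + 2)) n) = x * (x ^ 3) ^ nat (shifted_norm_form (n + 2 * k + 1) (- k - 1))" for k n
  proof -
    have "norm_form (n + (3 * k + 2)) n = 3 * shifted_norm_form (n + 2 * k + 1) (- k - 1) + 1"
      by (simp add: norm_form_def shifted_norm_form_def power2_eq_square algebra_simps)
    then show ?thesis using shifted_norm_form_nonneg[of "n + 2 * k + 1" "- k - 1"]
      by (simp add: nat_mult_distrib power_mult nat_add_distrib)
  qed
  show "((\<lambda>(k, n). x ^ nat (norm_form (n + 3 * k) n)) has_sum a (x ^ 3)) UNIV"
    unfolding 1 a_def
    using has_sum_reindex_inverse[OF _ _ has_sum_theta_a[OF x3],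
        of "\<lambda>(p, k). (k, p - k)" "\<lambda>(k, n). (n + k, k)"] by (auto simp: case_prod_unfold)
  show "((\<lambda>(k, n). x ^ nat (norm_form (n + (3 * k + 1)) n)) has_sum c x) UNIV"
    unfolding 2 c_def
    using has_sum_cmult_right[OF has_sum_reindex_inverse[OF _ _ has_sum_theta_c[OF x3],
        of "\<lambda>(p, k). (k, p - k)" "\<lambda>(k, n). (n + k, k)"], of x] by (auto simp: case_prod_unfold)
  show "((\<lambda>(k, n). x ^ nat (norm_form (n + (3 * k + 2)) n)) has_sum c x) UNIV"
    unfolding 3 c_def
    using has_sum_cmult_right[OF has_sum_reindex_inverse[OF _ _ has_sum_theta_c[OF x3],
        of "\<lambda>(p, j). (- j - 1, p + 2 * j + 1)" "\<lambda>(k, n). (n + 2 * k + 1, - k - 1)"], of x]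
    by (auto simp: case_prod_unfold algebra_simps)
qed

lemma omega_cube: "omega ^ 3 = 1"
proof -
  have "omega ^ 3 = exp (of_nat 3 * (2 * of_real pi * \<i> / 3))" by (simp only: omega_def exp_of_nat_mult)
  also have "\<dots> = 1" using exp_two_pi_i' by (simp add: mult_ac)
  finally show ?thesis .
qed

lemma omega_neq_1: "omega \<noteq> 1"
proof
  assume "omega = 1"
  then obtain n :: int where "2 * pi / 3 = of_int (2 * n) * pi"
    unfolding omega_def exp_eq_1 by auto
  then have "of_int (3 * n) = (1 :: real)" by simp
  then have "3 * n = 1" by (metis of_int_eq_1_iff)
  then show False by presburger
qed

lemma omega_sum: "1 + omega + omega\<^sup>2 = 0"
proof -
  have "(omega - 1) * (1 + omega + omega\<^sup>2) = 0"
    using omega_cube by (simp add: algebra_simps power2_eq_square power3_eq_cube)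
  then show ?thesis using omega_neq_1 by simp
qed

lemma omega_neq_0: "omega \<noteq> 0" by (simp add: omega_def)

lemma norm_omega: "norm omega = 1"
  by (simp add: omega_def norm_exp_eq_Re)

lemma cube_root_powi:
  assumes "w ^ 3 = (1::complex)"
  shows "w powi (3 * k + r) = w powi r"
proof -
  have "w \<noteq> 0" using assms by auto
  moreover have "w powi 3 = 1" using assms by (simp add: power_int_def)
  ultimately show ?thesis by (simp add: power_int_add power_int_mult)
qed

text \<open>For \<open>w = 1\<close> this is the trisection \<open>a(x) = a(x\<^sup>3) + 2c(x\<^sup>3)\<close>, and for a primitive cube root of unity it is
\<open>b(x) = a(x\<^sup>3) - c(x\<^sup>3)\<close>, since then \<open>w + w\<^sup>2 = -1\<close>.\<close>

lemma has_sum_theta_twisted: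
  fixes w :: complex
  assumes x: "norm x < 1" and w: "w ^ 3 = 1"
  defines "a \<equiv> eval_fps theta_a" and "c \<equiv> \<lambda>x. x * eval_fps theta_c (x ^ 3)"
  shows "((\<lambda>(m, n). w powi (m - n) * x ^ nat (norm_form m n)) has_sum a (x ^ 3) + (w + w\<^sup>2) * c x) UNIV"
proof -
  note trisect = theta_a_trisection[OF x, folded a_def c_def]
  have "w \<noteq> 0" using w by auto
  have nw: "norm w = 1" using w power_eq_imp_eq_base[of "norm w" 3 1] by (simp flip: norm_power)
  have "(\<lambda>(m, n). x ^ nat (norm_form m n)) summable_on (UNIV :: (int \<times> int) set)"
    using has_sum_theta_a[OF x] by (rule has_sum_imp_summable)
  then have "(\<lambda>p :: int \<times> int. norm ((\<lambda>(m, n). w powi (m - n) * x ^ nat (norm_form m n)) p)) summable_on UNIV"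
    unfolding summable_on_iff_abs_summable_on_complex
    by (simp add: case_prod_unfold norm_mult norm_power_int nw)
  then have "(\<lambda>(m, n). w powi (m - n) * x ^ nat (norm_form m n)) summable_on (UNIV :: (int \<times> int) set)"
    unfolding summable_on_iff_abs_summable_on_complex by simp
  then obtain S where S: "((\<lambda>(m, n). w powi (m - n) * x ^ nat (norm_form m n)) has_sum S) (UNIV :: (int \<times> int) set)"
    using has_sum_infsum by blast
  have "((\<lambda>(k, n). w powi k * x ^ nat (norm_form (n + k) n)) has_sum S) UNIV"
    using has_sum_reindex_inverse[OF _ _ S, of "\<lambda>(m, n). (m - n, n)" "\<lambda>(k, n). (n + k, n)"]
    by (auto simp: case_prod_unfold)
  from has_sum_split_mod_3[OF this, of "a (x ^ 3)" "w * c x" "w\<^sup>2 * c x"]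
  have "S = a (x ^ 3) + w * c x + w\<^sup>2 * c x"
    using trisect(1) has_sum_cmult_right[OF trisect(2), of w] has_sum_cmult_right[OF trisect(3), of "w\<^sup>2"]
      cube_root_powi[OF w, of _ 0] cube_root_powi[OF w, of _ 1] cube_root_powi[OF w, of _ 2]
    by (simp add: case_prod_unfold c_def)
  then show ?thesis using S by (simp add: algebra_simps)
qed

section \<open>A unitary map and the cubic identity\<close>

lemma has_sum_cube:
  fixes f :: "int \<times> int \<Rightarrow> complex"
  assumes "(f has_sum s) UNIV"
  shows "((\<lambda>((m1, n1), (m2, n2), (m3, n3)). f (m1, n1) * (f (m2, n2) * f (m3, n3))) has_sum s ^ 3) UNIV"
  using has_sum_product_UNIV[OF assms has_sum_product_UNIV[OF assms assms]]
  by (simp add: case_prod_unfold power3_eq_cube mult_ac)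

type_synonym int6 = "int \<times> int \<times> int \<times> int \<times> int \<times> int"

text \<open>The coordinate \<open>m\<^sub>3\<close> is replaced by \<open>t\<close>, the sum of the three differences \<open>m\<^sub>i - n\<^sub>i\<close>: its residue modulo 3
is the class of \<open>v\<^sub>1 + v\<^sub>2 + v\<^sub>3\<close> modulo \<open>1 - \<omega>\<close>.\<close>

lemma has_sum_cube_by_class:
  fixes f :: "int \<times> int \<Rightarrow> complex"
  assumes "(f has_sum s) UNIV"
  shows "((\<lambda>(t, m1, n1, m2, n2, n3). f (m1, n1) * (f (m2, n2) * f (t - m1 + n1 - m2 + n2 + n3, n3)))
           has_sum s ^ 3) UNIV"
  using has_sum_reindex_inverse[OF _ _ has_sum_cube[OF assms],
     of "\<lambda>((m1, n1), (m2, n2), (m3, n3)). (m1 - n1 + m2 - n2 + m3 - n3, m1, n1, m2, n2, n3)"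
        "\<lambda>(t, m1, n1, m2, n2, n3). ((m1, n1), (m2, n2), (t - m1 + n1 - m2 + n2 + n3, n3))"]
  by (simp add: case_prod_unfold)

text \<open>The triples \<open>(v\<^sub>1, v\<^sub>2, v\<^sub>3)\<close> of class \<open>r\<close>, parametrised by \<open>\<int>\<^sup>6\<close>. In these coordinates the maps
between classes become unimodular integer maps with explicit inverses.\<close>

definition cube_class :: "(int \<Rightarrow> int \<Rightarrow> int) \<Rightarrow> int \<Rightarrow> complex \<Rightarrow> int6 \<Rightarrow> complex" where
  "cube_class Q r x = (\<lambda>(k, m1, n1, m2, n2, n3). x ^ nat (Q m1 n1 + Q m2 n2
      + Q (3 * k + r - m1 + n1 - m2 + n2 + n3) n3))"

lemma power_nat_add3:
  fixes x :: complex
  assumes "a \<ge> 0" "b \<ge> 0" "c \<ge> 0"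
  shows "x ^ nat a * (x ^ nat b * x ^ nat c) = x ^ nat (a + b + c)"
  using assms by (simp add: nat_add_distrib power_add)

text \<open>A cube of a lattice sum splits into three classes; twisting the sum by a cube root of unity \<open>w\<close> weights
class \<open>r\<close> by \<open>w\<^sup>r\<close>.\<close>

lemma
  fixes x :: complex
  assumes s: "((\<lambda>(m, n). x ^ nat (Q m n)) has_sum s) UNIV" and Q: "\<And>m n. Q m n \<ge> 0"
  shows cube_class_has_sum: "(cube_class Q r x has_sum infsum (cube_class Q r x) UNIV) UNIV"
    and cube_eq_class_sums: "w ^ 3 = 1 \<Longrightarrow>
      ((\<lambda>(m, n). w powi (m - n) * x ^ nat (Q m n)) has_sum u) UNIV \<Longrightarrow>
      u ^ 3 = infsum (cube_class Q 0 x) UNIV + w * infsum (cube_class Q 1 x) UNIV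
            + w\<^sup>2 * infsum (cube_class Q 2 x) UNIV"
proof -
  define F where "F = (\<lambda>(t, m1, n1, m2, n2, n3). x ^ nat (Q m1 n1) * (x ^ nat (Q m2 n2) *
        x ^ nat (Q (t - m1 + n1 - m2 + n2 + n3) n3)))"
  have F: "(F has_sum s ^ 3) UNIV"
    using has_sum_cube_by_class[OF s] by (simp add: F_def)
  have eq: "cube_class Q r x = (\<lambda>(k, w). F (3 * k + r, w))" for r
    by (auto simp: F_def cube_class_def fun_eq_iff power_nat_add3 Q)
  have summ: "cube_class Q r x summable_on UNIV" for r
    using summable_on_comp_inj[OF has_sum_imp_summable[OF F], of "\<lambda>(k, w). (3 * k + r, w)"]
    by (simp add: eq case_prod_unfold inj_on_def)
  define S where "S r = infsum (cube_class Q r x) UNIV" for r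
  have S: "(cube_class Q r x has_sum S r) UNIV" for r
    using summ by (simp add: S_def)
  then show "(cube_class Q r x has_sum infsum (cube_class Q r x) UNIV) UNIV" by (simp add: S_def)
  show "u ^ 3 = infsum (cube_class Q 0 x) UNIV + w * infsum (cube_class Q 1 x) UNIV
      + w\<^sup>2 * infsum (cube_class Q 2 x) UNIV"
    if w: "w ^ 3 = 1" and u: "((\<lambda>(m, n). w powi (m - n) * x ^ nat (Q m n)) has_sum u) UNIV"
  proof -
    have w0: "w \<noteq> 0" using w by auto
    have "((\<lambda>(t, v). w powi t * F (t, v)) has_sum u ^ 3) UNIV"
    proof -
      have "w powi (m1 - n1) * (w powi (m2 - n2) * w powi (t - m1 + n1 - m2 + n2 + n3 - n3)) = w powi t" 
        for m1 n1 m2 n2 n3 t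
        using w0 by (simp flip: power_int_add)
      then have *: "w powi (m1 - n1) * a * (w powi (m2 - n2) * b * (w powi (t - m1 + n1 - m2 + n2 + n3 - n3) * c))
          = w powi t * (a * (b * c))" for m1 n1 m2 n2 n3 t a b c
        by (metis (no_types, opaque_lifting) mult.assoc mult.left_commute)
      show ?thesis
        by (rule has_sum_cong[THEN iffD1, OF _ has_sum_cube_by_class[OF u]])
           (simp only: F_def split_paired_all prod.case *)
    qed
    from has_sum_split_mod_3[OF this, of "S 0" "w * S 1" "w\<^sup>2 * S 2"]
    show ?thesis unfolding S_def[symmetric]
      using S[of 0] has_sum_cmult_right[OF S[of 1], of w] has_sum_cmult_right[OF S[of 2], of "w\<^sup>2"]
        cube_root_powi[OF w, of _ 0] cube_root_powi[OF w, of _ 1] cube_root_powi[OF w, of _ 2]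
      by (simp add: case_prod_unfold eq)
  qed
qed

text \<open>Multiplication by \<open>\<omega>\<close> preserves the shifted lattice and moves the class of a point by one.\<close>

lemma shifted_norm_form_rotate: "shifted_norm_form n (- m - n - 1) = shifted_norm_form m n"
  by (simp add: shifted_norm_form_def power2_eq_square algebra_simps)

text \<open>Rotating only the first of the three lattice points shifts the class and keeps the exponent. So the three
classes of the shifted lattice contribute equally to \<open>c\<^sup>3\<close>.\<close>

lemma cube_class_rotate:
  assumes "(cube_class shifted_norm_form r x has_sum S) UNIV" "(cube_class shifted_norm_form (r + 1) x has_sum S') UNIV"
  shows "S = S'"
proof -
  have "((\<lambda>(k, m1, n1, m2, n2, n3). cube_class shifted_norm_form (r + 1) x (k + n1, n1, - m1 - n1 - 1, m2, n2, n3)) has_sum S') UNIV"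
    using has_sum_reindex_inverse[OF _ _ assms(2),
       of "\<lambda>(k, m1, n1, m2, n2, n3). (k - m1, - m1 - n1 - 1, m1, m2, n2, n3)"
          "\<lambda>(k, m1, n1, m2, n2, n3). (k + n1, n1, - m1 - n1 - 1, m2, n2, n3)"]
    by (simp add: case_prod_unfold)
  also have "(\<lambda>(k, m1, n1, m2, n2, n3). cube_class shifted_norm_form (r + 1) x (k + n1, n1, - m1 - n1 - 1, m2, n2, n3))
     = cube_class shifted_norm_form r x"
  proof
    fix u :: int6
    obtain k m1 n1 m2 n2 n3 where u: "u = (k, m1, n1, m2, n2, n3)" by (cases u) auto
    have m3: "3 * (k + n1) + (r + 1) - n1 + (- m1 - n1 - 1) - m2 + n2 + n3
        = 3 * k + r - m1 + n1 - m2 + n2 + n3" by simp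
    show "(case u of (k, m1, n1, m2, n2, n3) \<Rightarrow> cube_class shifted_norm_form (r + 1) x (k + n1, n1, - m1 - n1 - 1, m2, n2, n3))
       = cube_class shifted_norm_form r x u"
      by (simp only: u cube_class_def prod.case m3 shifted_norm_form_rotate)
  qed
  finally show ?thesis using assms(1) has_sum_unique by blast
qed

text \<open>Up to a unit, the matrix with rows \<open>(1, 1, 1)\<close>, \<open>(1, \<omega>, \<omega>\<^sup>2)\<close>, \<open>(1, \<omega>\<^sup>2, \<omega>)\<close> divided by
\<open>\<surd>-3\<close> is unitary. Since \<open>\<omega> \<equiv> 1\<close> modulo \<open>1 - \<omega>\<close>, it maps the integral triples of class 1 onto the
class 0 of the triples from the shifted lattice. The factor \<open>x\<close> accounts for the three offsets \<open>1/3\<close>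
between the norm and \<open>shifted_norm_form\<close>.\<close>

lemma cube_class_unitary:
  assumes S: "(cube_class norm_form 1 x has_sum S) UNIV" and R: "(cube_class shifted_norm_form 0 x has_sum R) UNIV"
  shows "S = x * R"
proof -
  \<comment> \<open>The images are divided by \<open>1 - \<omega>\<^sup>2\<close> and taken relative to the offset \<open>(1 - \<omega>)/3\<close>; \<open>- n1\<close> is a third of the sum of their classes.\<close>
  define U where "U = (\<lambda>(k, m1, n1, m2, n2, n3). (- n1, k, k + n1 + n2 + n3,
     m1 - n1 + m2 - n3 - 2 * k - 1, n1 - m2 + k, m1 + m2 - n2 - n3 - 2 * k - (1::int)))"
  define V where "V = (\<lambda>(k', M1, N1, M2, N2, N3).
     let k = M1; n1 = - k'; m2 = n1 + k - N2; m1 = N3 - m2 + 2 * k + 1 + N1 - k - n1;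
         n3 = m1 - (M2 + n1 - m2 + 2 * k + (1::int)); n2 = N1 - k - n1 - n3
     in (k, m1, n1, m2, n2, n3))"
  have "((\<lambda>u. cube_class shifted_norm_form 0 x (U u)) has_sum R) UNIV"
    using R by (rule has_sum_reindex_inverse[of V, rotated 2]) (auto simp: U_def V_def Let_def)
  then have "((\<lambda>u. x * cube_class shifted_norm_form 0 x (U u)) has_sum x * R) UNIV"
    by (rule has_sum_cmult_right)
  also have "(\<lambda>u. x * cube_class shifted_norm_form 0 x (U u)) = cube_class norm_form 1 x"
  proof
    fix u :: int6
    obtain k m1 n1 m2 n2 n3 where u: "u = (k, m1, n1, m2, n2, n3)" by (cases u) auto
    define e' where "e' = shifted_norm_form k (k + n1 + n2 + n3) + shifted_norm_form (m1 - n1 + m2 - n3 - 2 * k - 1) (n1 - m2 + k)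
       + shifted_norm_form (- m2 + n3 + k) (m1 + m2 - n2 - n3 - 2 * k - 1)"
    have m3: "3 * (- n1) + 0 - k + (k + n1 + n2 + n3) - (m1 - n1 + m2 - n3 - 2 * k - 1) + (n1 - m2 + k)
       + (m1 + m2 - n2 - n3 - 2 * k - 1) = - m2 + n3 + k" by simp
    have e: "norm_form m1 n1 + norm_form m2 n2 + norm_form (3 * k + 1 - m1 + n1 - m2 + n2 + n3) n3 = e' + 1"
      by (simp add: e'_def norm_form_def shifted_norm_form_def power2_eq_square algebra_simps)
    have "e' \<ge> 0" unfolding e'_def by (intro add_nonneg_nonneg shifted_norm_form_nonneg)
    then have "x * x ^ nat e' = x ^ nat (e' + 1)" by (simp add: nat_add_distrib)
    moreover have "cube_class shifted_norm_form 0 x (U u) = x ^ nat e'"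
      by (simp only: cube_class_def U_def u prod.case m3 e'_def)
    moreover have "cube_class norm_form 1 x u = x ^ nat (e' + 1)"
      by (simp only: cube_class_def u prod.case e)
    ultimately show "x * cube_class shifted_norm_form 0 x (U u) = cube_class norm_form 1 x u" by simp
  qed
  finally show ?thesis using S has_sum_unique by blast
qed

text \<open>The second equation is \<open>a\<^sup>3 = b\<^sup>3 + c\<^sup>3\<close>. The classes 1 and 2 of the integral triples contribute equally, so
\<open>a\<^sup>3 - b\<^sup>3\<close> is three times the contribution of class 1. The unitary map turns that contribution into the
one of class 0 of the shifted triples, which is a third of \<open>c\<^sup>3\<close>.\<close>

theorem theta_a_cubes:
  assumes x: "norm x < 1"
  defines "a \<equiv> eval_fps theta_a" and "c \<equiv> \<lambda>x. x * eval_fps theta_c (x ^ 3)"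
  shows "a x = a (x ^ 3) + 2 * c x"
    and "a x ^ 3 = (a (x ^ 3) - c x) ^ 3 + x * eval_fps theta_c x ^ 3"
proof -
  have tw: "((\<lambda>(m, n). w powi (m - n) * x ^ nat (norm_form m n)) has_sum a (x ^ 3) + (w + w\<^sup>2) * c x) UNIV"
    if "w ^ 3 = 1" for w
    using has_sum_theta_twisted[OF x that] by (simp add: a_def c_def)
  have ha: "((\<lambda>(m, n). x ^ nat (norm_form m n)) has_sum a x) UNIV"
    using has_sum_theta_a[OF x] by (simp add: a_def)
  have hc: "((\<lambda>(m, n). x ^ nat (shifted_norm_form m n)) has_sum eval_fps theta_c x) UNIV"
    using has_sum_theta_c[OF x] .
  show a: "a x = a (x ^ 3) + 2 * c x"
    using has_sum_unique[OF ha tw[of 1, simplified]] by simp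
  define S where "S r = infsum (cube_class norm_form r x) UNIV" for r
  define R where "R r = infsum (cube_class shifted_norm_form r x) UNIV" for r
  have S: "(cube_class norm_form r x has_sum S r) UNIV" for r
    unfolding S_def using ha norm_form_nonneg by (rule cube_class_has_sum)
  have R: "(cube_class shifted_norm_form r x has_sum R r) UNIV" for r
    unfolding R_def using hc shifted_norm_form_nonneg by (rule cube_class_has_sum)
  note S' = cube_eq_class_sums[OF ha norm_form_nonneg, folded S_def]
  note R' = cube_eq_class_sums[OF hc shifted_norm_form_nonneg, folded R_def]
  have "R 0 = R 1" "R 1 = R 2"
    using cube_class_rotate[OF R R, of 0] cube_class_rotate[OF R R, of 1] by auto
  then have c3: "eval_fps theta_c x ^ 3 = 3 * R 0"
    using R'[of 1 "eval_fps theta_c x"] hc by simp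
  have w3: "omega ^ 3 = 1" "(omega\<^sup>2) ^ 3 = 1"
    using omega_cube power_mult[of omega 3 2] power_mult[of omega 2 3] by simp_all
  have w4: "(omega\<^sup>2)\<^sup>2 = omega"
    using omega_cube by (simp add: power2_eq_square power3_eq_cube flip: mult.assoc)
  have w5: "omega + omega\<^sup>2 = -1" "omega\<^sup>2 + omega = -1"
    using omega_sum by (simp_all add: eq_neg_iff_add_eq_0 algebra_simps)
  define b where "b = a (x ^ 3) - c x"
  have a3: "a x ^ 3 = S 0 + S 1 + S 2" using S'[of 1] ha by simp
  have b3: "b ^ 3 = S 0 + omega * S 1 + omega\<^sup>2 * S 2"
    using S'[OF w3(1) tw[OF w3(1)]] by (simp add: w5 b_def)
  have b3': "b ^ 3 = S 0 + omega\<^sup>2 * S 1 + omega * S 2"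
    using S'[OF w3(2) tw[OF w3(2)], unfolded w4 w5] by (simp add: b_def)
  have "(omega - omega\<^sup>2) * (S 1 - S 2) = 0"
    using b3 b3' by (simp add: algebra_simps)
  moreover have "omega - omega\<^sup>2 \<noteq> 0" using omega_neq_1 omega_neq_0 by (simp add: power2_eq_square)
  ultimately have S12: "S 2 = S 1" by simp
  have "a x ^ 3 - b ^ 3 = (2 - (omega + omega\<^sup>2)) * S 1"
    unfolding a3 b3 S12 by (simp add: algebra_simps)
  then have "a x ^ 3 - b ^ 3 = 3 * S 1" by (simp add: w5)
  moreover have "S 1 = x * R 0" by (rule cube_class_unitary[OF S R])
  ultimately show "a x ^ 3 = (a (x ^ 3) - c x) ^ 3 + x * eval_fps theta_c x ^ 3"
    using c3 by (simp add: b_def algebra_simps)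
qed

section \<open>Laurent coefficients at a three-torsion point\<close>

definition geometric_factor :: "complex \<Rightarrow> int \<Rightarrow> complex" where
  "geometric_factor x n = 1 / (1 - x powi (3 * n))"
text \<open>The coefficient of \<open>exp(n\<alpha>)\<close> in \<open>Z(\<alpha>)\<close>. For \<open>n < 0\<close> the quotient equals
\<open>- x\<^sup>2\<^sup>|\<^sup>n\<^sup>| / (1 - x\<^sup>3\<^sup>|\<^sup>n\<^sup>|)\<close>, so the series converges on both sides. The constant \<open>1/6\<close> is the one for which
the addition theorem at a point of order 3 has no linear term.\<close>

definition laurent_coeff :: "complex \<Rightarrow> int \<Rightarrow> complex" where
  "laurent_coeff x n = (if n = 0 then 1 / 6 else x powi n * geometric_factor x n)"

locale punctured_disc =
  fixes x :: complex
  assumes x0: "x \<noteq> 0" and x1: "norm x < 1"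
begin

abbreviation "f \<equiv> geometric_factor x"
abbreviation "c \<equiv> laurent_coeff x"

lemma powi_3_neq_1: 
  assumes "n \<noteq> 0" shows "x powi (3 * n) \<noteq> 1"
proof
  assume "x powi (3 * n) = 1"
  then have "norm x powi (3 * n) = 1" by (metis norm_one norm_power_int)
  moreover have "norm x powi (3 * n) < 1" if "n > 0"
    using that x0 x1 by (simp add: power_int_def power_less_one_iff nat_mult_distrib)
  moreover have "norm x powi (3 * n) > 1" if "n < 0"
  proof -
    have "norm x powi (3 * (-n)) < 1"
      using that x0 x1 by (simp add: power_int_def power_less_one_iff nat_mult_distrib)
    then show ?thesis using x0 by (simp add: power_int_minus one_less_inverse_iff field_simps)
  qed
  ultimately show False using assms by (metis less_irrefl linorder_neqE_linordered_idom)
qed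

lemma powi_3: "x powi (3 * n) = (x powi n) ^ 3"
  by (metis mult.commute power_int_mult power_int_numeral)

lemma geometric_factor_neg: "n \<noteq> 0 \<Longrightarrow> f (- n) = 1 - f n"
  using powi_3_neq_1[of n] x0
  by (simp add: geometric_factor_def power_int_minus divide_simps) (simp add: algebra_simps)

lemma laurent_coeff_neg_square: "n \<noteq> 0 \<Longrightarrow> (c (- n))\<^sup>2 = c n * (f n - 1)"
proof -
  assume n: "n \<noteq> 0"
  define X where "X = x powi n"
  have X: "X \<noteq> 0" "X ^ 3 \<noteq> 1" using x0 powi_3_neq_1[OF n] by (auto simp: X_def powi_3)
  have "(inverse X * (1 / (1 - (inverse X) ^ 3)))\<^sup>2 = X * (1 / (1 - X ^ 3)) * (1 / (1 - X ^ 3) - 1)"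
    using X by (simp add: divide_simps power2_eq_square power3_eq_cube) (simp add: algebra_simps)
  then show ?thesis
    using n by (simp only: laurent_coeff_def geometric_factor_def powi_3 X_def power_int_minus neg_equal_0_iff_equal if_False)
qed

text \<open>The addition theorem for pairs of exponents off the axes: the summands are the coefficients at
\<open>(m, n)\<close> of the products \<open>Z(\<alpha>) Z(\<beta>)\<close>, \<open>Z(\<alpha>) Z(\<gamma>)\<close> and \<open>Z(\<beta>) Z(\<gamma>)\<close>, where \<open>\<gamma> = - \<alpha> - \<beta>\<close>.\<close>

lemma laurent_coeff_three_term:
  assumes "m \<noteq> 0" "n \<noteq> 0" "m \<noteq> n"
  shows "c m * c n + c (m - n) * c (- n) + c (n - m) * c (- m) = 0"
proof -
  define X Y where "X = x powi m" and "Y = x powi n"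
  have X: "X \<noteq> 0" "X ^ 3 \<noteq> 1" using x0 powi_3_neq_1[OF assms(1)] by (auto simp: X_def powi_3)
  have Y: "Y \<noteq> 0" "Y ^ 3 \<noteq> 1" using x0 powi_3_neq_1[OF assms(2)] by (auto simp: Y_def powi_3)
  have "x powi (3 * (m - n)) \<noteq> 1" using assms by (intro powi_3_neq_1) auto
  then have XY: "X ^ 3 \<noteq> Y ^ 3"
    using x0 Y by (auto simp: powi_3 X_def Y_def power_int_diff power_divide)
  have "X * (1 / (1 - X ^ 3)) * (Y * (1 / (1 - Y ^ 3)))
      + X / Y * (1 / (1 - (X / Y) ^ 3)) * (inverse Y * (1 / (1 - inverse Y ^ 3)))
      + Y / X * (1 / (1 - (Y / X) ^ 3)) * (inverse X * (1 / (1 - inverse X ^ 3))) = 0" (is "?l1 + ?l2 + ?l3 = 0")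
  proof -
    define D where "D = (1 - X ^ 3) * (1 - Y ^ 3) * (Y ^ 3 - X ^ 3)"
    have "D \<noteq> 0" using X Y XY by (auto simp: D_def)
    have l1: "?l1 = X * Y * (Y ^ 3 - X ^ 3) / D"
      using X Y XY by (simp add: D_def)
    have l2: "?l2 = - (X * Y ^ 4 * (1 - X ^ 3)) / D"
    proof -
      have "?l2 = X * Y ^ 4 / ((Y ^ 3 - X ^ 3) * (Y ^ 3 - 1))"
        using X Y XY by (simp add: power_divide divide_simps) (simp add: power2_eq_square power3_eq_cube eval_nat_numeral algebra_simps)
      then show ?thesis using X Y XY by (simp add: D_def divide_simps) (simp add: algebra_simps)
    qed
    have l3: "?l3 = Y * X ^ 4 * (1 - Y ^ 3) / D"
    proof -
      have "?l3 = Y * X ^ 4 / ((X ^ 3 - Y ^ 3) * (X ^ 3 - 1))"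
        using X Y XY by (simp add: power_divide divide_simps) (simp add: power2_eq_square power3_eq_cube eval_nat_numeral algebra_simps)
      then show ?thesis using X Y XY by (simp add: D_def divide_simps) (simp add: algebra_simps)
    qed
    have "?l1 + ?l2 + ?l3 = (X * Y * (Y ^ 3 - X ^ 3) - X * Y ^ 4 * (1 - X ^ 3) + Y * X ^ 4 * (1 - Y ^ 3)) / D"
      unfolding l1 l2 l3 by (simp add: add_divide_distrib diff_divide_distrib)
    also have "X * Y * (Y ^ 3 - X ^ 3) - X * Y ^ 4 * (1 - X ^ 3) + Y * X ^ 4 * (1 - Y ^ 3) = 0"
      by (simp add: eval_nat_numeral algebra_simps)
    finally show ?thesis by simp
  qed
  moreover have "x powi (m - n) = X / Y" "x powi (n - m) = Y / X" "x powi (- n) = inverse Y" "x powi (- m) = inverse X"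
    using x0 by (simp_all add: X_def Y_def power_int_diff power_int_minus)
  moreover have "m - n \<noteq> 0" "n - m \<noteq> 0" "- m \<noteq> 0" "- n \<noteq> 0" using assms by auto
  ultimately show ?thesis
    using assms(1,2) by (simp only: laurent_coeff_def geometric_factor_def powi_3 if_False flip: X_def Y_def)
qed

text \<open>The partial fraction decomposition that makes the convolution of the coefficients telescope.\<close>

lemma laurent_coeff_product:
  assumes "k \<noteq> 0" "k \<noteq> m" "m \<noteq> 0"
  shows "c k * c (m - k) = c m * (f k - f (k - m))"
proof -
  define X Y where "X = x powi m" and "Y = x powi k"
  have X: "X \<noteq> 0" "X ^ 3 \<noteq> 1" using x0 powi_3_neq_1[OF assms(3)] by (auto simp: X_def powi_3)
  have Y: "Y \<noteq> 0" "Y ^ 3 \<noteq> 1" using x0 powi_3_neq_1[OF assms(1)] by (auto simp: Y_def powi_3)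
  have "x powi (3 * (m - k)) \<noteq> 1" using assms by (intro powi_3_neq_1) auto
  then have XY: "X ^ 3 \<noteq> Y ^ 3"
    using x0 Y by (auto simp: powi_3 X_def Y_def power_int_diff power_divide)
  have "Y * (1 / (1 - Y ^ 3)) * (X / Y * (1 / (1 - (X / Y) ^ 3)))
      = X * (1 / (1 - X ^ 3)) * (1 / (1 - Y ^ 3) - 1 / (1 - (Y / X) ^ 3))"
    using X Y XY by (simp add: power_divide divide_simps) (simp add: eval_nat_numeral algebra_simps)
  moreover have "x powi (m - k) = X / Y" "x powi (k - m) = Y / X"
    using x0 by (simp_all add: X_def Y_def power_int_diff)
  moreover have "m - k \<noteq> 0" using assms by auto
  ultimately show ?thesis
    using assms(1,3) by (simp only: laurent_coeff_def geometric_factor_def powi_3 if_False flip: X_def Y_def)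
qed

lemma norm_laurent_coeff_le: "norm (c n) \<le> norm x ^ nat \<bar>n\<bar> / (1 - norm x)"
proof -
  have den: "norm (1 / (1 - x ^ (3 * k))) \<le> 1 / (1 - norm x)" if "k > 0" for k :: nat
  proof -
    have "norm x ^ (3 * k) \<le> norm x ^ 1" using that x1 by (intro power_decreasing) auto
    then have "1 - norm x \<le> 1 - norm (x ^ (3 * k))" by (simp add: norm_power)
    also have "\<dots> \<le> norm (1 - x ^ (3 * k))" using norm_triangle_ineq2[of 1 "x ^ (3 * k)"] by simp
    finally show ?thesis using x1 by (simp add: norm_divide divide_simps)
  qed
  consider "n = 0" | k where "n = int k" "k > 0" | k where "n = - int k" "k > 0"
    by (cases n rule: int_cases2) auto
  then show ?thesis
  proof cases
    case 1
    then show ?thesis using x1 order_trans[OF _ norm_ge_zero[of x], of "-5"] by (simp add: laurent_coeff_def divide_simps)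
  next
    case (2 k)
    have e: "x powi int k = x ^ k" "x powi (3 * int k) = x ^ (3 * k)"
      by (simp_all add: power_int_def nat_mult_distrib)
    have "norm (x ^ k) * norm (1 / (1 - x ^ (3 * k))) \<le> norm (x ^ k) * (1 / (1 - norm x))"
      by (intro mult_left_mono den) (use 2 in auto)
    then show ?thesis
      using 2 e by (simp add: laurent_coeff_def geometric_factor_def norm_mult norm_power norm_divide)
  next
    case (3 k)
    have k3: "x ^ (3 * k) \<noteq> 1" 
      using powi_3_neq_1[of "int k"] 3 by (simp add: power_int_def nat_mult_distrib)
    have "c n = inverse (x ^ k) * (1 / (1 - inverse (x ^ (3 * k))))"
      using 3 by (simp add: laurent_coeff_def geometric_factor_def power_int_minus power_int_def nat_mult_distrib power_inverse)
    also have "\<dots> = - (x ^ (2 * k) * (1 / (1 - x ^ (3 * k))))"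
    proof -
      define X where "X = x ^ k"
      have "X \<noteq> 0" "X ^ 3 \<noteq> 1" using x0 k3 by (auto simp: X_def mult.commute simp flip: power_mult)
      then have "inverse X * (1 / (1 - inverse (X ^ 3))) = - (X ^ 2 * (1 / (1 - X ^ 3)))"
        by (simp add: divide_simps) (simp add: eval_nat_numeral algebra_simps)
      then show ?thesis by (simp add: X_def mult.commute flip: power_mult)
    qed
    finally have "norm (c n) = norm x ^ (2 * k) * norm (1 / (1 - x ^ (3 * k)))"
      by (simp add: norm_mult norm_power norm_divide)
    also have "\<dots> \<le> norm x ^ k * (1 / (1 - norm x))"
      using x1 3 by (intro mult_mono den power_decreasing) auto
    finally show ?thesis using 3 by simp
  qed
qed

lemma laurent_coeff_summable: "(\<lambda>n. of_int n ^ j * c n) summable_on UNIV"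
proof -
  have "summable (\<lambda>n. real n ^ j * norm x ^ n)"
    using x1 by (intro summable_nat_power_times_geometric) auto
  then have s: "(\<lambda>n. \<bar>of_int n\<bar> ^ j * norm x ^ nat \<bar>n\<bar> * (1 / (1 - norm x))) summable_on UNIV"
    using x1 by (intro summable_on_cmult_left summable_on_int_if_summable) auto
  have "(\<lambda>n. norm (of_int n ^ j * c n)) summable_on UNIV"
  proof (rule Infinite_Sum.abs_summable_on_comparison_test'[OF s])
    fix n :: int
    show "norm (of_int n ^ j * c n) \<le> \<bar>of_int n\<bar> ^ j * norm x ^ nat \<bar>n\<bar> * (1 / (1 - norm x))"
      using mult_left_mono[OF norm_laurent_coeff_le[of n], of "\<bar>of_int n\<bar> ^ j"]
      by (simp add: norm_mult norm_power)
  qed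
  then show ?thesis by (simp add: summable_on_iff_abs_summable_on_complex)
qed

end

section \<open>Self-convolution of the coefficients\<close>

text \<open>The \<open>j\<close>-th Taylor coefficient of \<open>Z\<close>, times \<open>j!\<close>; it has weight \<open>j + 1\<close>. Since \<open>0\<^sup>0 = 1\<close>, the constant
\<open>1/6\<close> enters exactly for \<open>j = 0\<close>.\<close>

definition eisenstein :: "nat \<Rightarrow> complex \<Rightarrow> complex" where
  "eisenstein j x = (\<Sum>\<^sub>\<infinity>n. of_int n ^ j * laurent_coeff x n)"

lemma has_sum_sum_fun:
  fixes g :: "'j \<Rightarrow> 'i \<Rightarrow> complex"
  assumes "finite J" "\<And>j. j \<in> J \<Longrightarrow> (g j has_sum s j) A"
  shows "((\<lambda>i. \<Sum>j\<in>J. g j i) has_sum (\<Sum>j\<in>J. s j)) A"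
  using assms by (induction J rule: finite_induct) (auto intro!: has_sum_add)

lemma has_sum_minus_complex:
  fixes f :: "'i \<Rightarrow> complex"
  assumes "(f has_sum a) A" "(g has_sum b) A"
  shows "((\<lambda>i. f i - g i) has_sum a - b) A"
  using has_sum_add[OF assms(1) has_sum_uminusI[OF assms(2)]] by simp

context punctured_disc
begin

abbreviation "z \<equiv> \<lambda>j. eisenstein j x"

lemma eisenstein_has_sum: "((\<lambda>n. of_int n ^ j * c n) has_sum z j) UNIV"
  using laurent_coeff_summable by (simp add: eisenstein_def)

lemma laurent_coeff_has_sum: "(c has_sum z 0) UNIV"
  using eisenstein_has_sum[of 0] by simp

lemma eisenstein_product_has_sum:
  "((\<lambda>(p, q). of_int p ^ i * of_int q ^ j * (c p * c q)) has_sum z i * z j) UNIV"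
  using has_sum_product_UNIV[OF eisenstein_has_sum[of i] eisenstein_has_sum[of j]]
  by (simp add: mult_ac)

definition laurent_conv :: "int \<Rightarrow> complex" where
  "laurent_conv m = (\<Sum>\<^sub>\<infinity>k. c k * c (m - k))"

lemma laurent_conv_has_sum: "((\<lambda>k. c k * c (m - k)) has_sum laurent_conv m) UNIV"
proof -
  have "(\<lambda>(m, k). c k * c (m - k)) summable_on (UNIV \<times> UNIV)"
    using has_sum_imp_summable[OF has_sum_reindex_inverse[OF _ _ eisenstein_product_has_sum[of 0 0],
       of "\<lambda>(p, q). (p + q, p)" "\<lambda>(m, k). (k, m - k)"]]
    by (simp add: case_prod_unfold)
  then have "(\<lambda>k. c k * c (m - k)) summable_on UNIV"
    by (rule summable_on_SigmaD1) auto
  then show ?thesis by (simp add: laurent_conv_def)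
qed

text \<open>The coefficients of \<open>Z\<^sup>2\<close>. Up to the two indices that involve \<open>c\<^sub>0\<close>, the sum is \<open>c\<^sub>m\<close> times the sum of
\<open>G(k) - G(k - m)\<close>, where \<open>G\<close> tends to 0 at \<open>-\<infinity>\<close> and to 1 at \<open>\<infinity>\<close>; such a sum equals \<open>m\<close>.\<close>

lemma laurent_conv_closed_form:
  assumes m: "m \<noteq> 0"
  shows "((\<lambda>k. c k * c (m - k)) has_sum c m * (of_int m + 4 / 3 - 2 * f m)) UNIV"
proof -
  \<comment> \<open>\<open>f\<close> minus its limits at both ends: summable, hence its shifted differences sum to zero.\<close>
  define E where "E k = (if k = 0 then 0 else f k - of_bool (k > 0))" for k
  define G where "G k = (if k = 0 then 0 else f k)" for k
  have "(\<lambda>k. norm (E k)) summable_on UNIV"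
  proof (rule Infinite_Sum.abs_summable_on_comparison_test')
    show "(\<lambda>k. norm (c k)) summable_on UNIV"
      using laurent_coeff_summable[of 0] by (simp add: summable_on_iff_abs_summable_on_complex)
    fix k :: int
    show "norm (E k) \<le> norm (c k)"
    proof (cases "k = 0")
      case False
      have nz: "x powi k \<noteq> 0" using x0 by simp
      have n3: "x powi (3 * k) \<noteq> 1" using powi_3_neq_1[OF False] .
      have le: "norm x ^ j \<le> 1" for j using x1 by (simp add: power_le_one)
      show ?thesis
      proof (cases "k > 0")
        case True
        have "E k = (x powi k)\<^sup>2 * c k"
          using False True n3 by (simp add: E_def laurent_coeff_def geometric_factor_def powi_3 divide_simps)
            (simp add: eval_nat_numeral algebra_simps)
        then show ?thesis using True le[of "nat k * 2"]
          by (simp add: norm_mult norm_power norm_power_int power_int_def mult_left_le_one_le flip: power_mult)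
      next
        case k: False
        have "E k = x powi (- k) * c k"
          using False k x0 by (simp add: E_def laurent_coeff_def power_int_minus)
        then show ?thesis using k le[of "nat (- k)"]
          by (simp add: norm_mult norm_power norm_power_int power_int_def mult_left_le_one_le)
      qed
    qed (simp add: E_def)
  qed
  then have "E summable_on UNIV" by (simp add: summable_on_iff_abs_summable_on_complex)
  then obtain e where e: "(E has_sum e) UNIV" using has_sum_infsum by blast
  have e': "((\<lambda>k. E (k - m)) has_sum e) UNIV"
    by (rule has_sum_reindex_inverse[OF _ _ e, of "\<lambda>k. k + m"]) auto
  have "((\<lambda>k. of_bool (k > 0) - of_bool (k - m > 0) :: complex) has_sum of_int m) UNIV"
  proof (rule has_sum_finite_neutralI)
    show "finite ({0<..m} \<union> {m<..0})" by simp
    show "of_int m = (\<Sum>k \<in> {0<..m} \<union> {m<..0}. of_bool (k > 0) - of_bool (k - m > 0) :: complex)"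
    proof (cases "m > 0")
      case True
      have "(\<Sum>k \<in> {0<..m} \<union> {m<..0}. of_bool (k > 0) - of_bool (k - m > 0) :: complex) = (\<Sum>k \<in> {0<..m}. 1)"
        using True by (intro sum.cong) auto
      then show ?thesis using True by (simp add: of_nat_nat)
    next
      case False
      have "(\<Sum>k \<in> {0<..m} \<union> {m<..0}. of_bool (k > 0) - of_bool (k - m > 0) :: complex) = (\<Sum>k \<in> {m<..0}. -1)"
        using False by (intro sum.cong) auto
      then show ?thesis using False by (simp add: of_nat_nat)
    qed
  qed auto
  from has_sum_add[OF has_sum_minus_complex[OF e e'] this]
  have "((\<lambda>k. E k - E (k - m) + (of_bool (k > 0) - of_bool (k - m > 0))) has_sum of_int m) UNIV" by simp
  also have "(\<lambda>k. E k - E (k - m) + (of_bool (k > 0) - of_bool (k - m > 0))) = (\<lambda>k. G k - G (k - m))"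
    by (auto simp: E_def G_def fun_eq_iff)
  finally have "((\<lambda>k. G k - G (k - m)) has_sum of_int m) UNIV" .
  from has_sum_cmult_right[OF this, of "c m"]
  have 1: "((\<lambda>k. c m * (G k - G (k - m))) has_sum c m * of_int m) UNIV" .
  have 2: "((\<lambda>k. (if k = 0 then c m * (1 / 6 + f (- m)) else 0) + (if k = m then c m * (1 / 6 - f m) else 0))
      has_sum c m * (1 / 6 + f (- m)) + c m * (1 / 6 - f m)) UNIV"
    by (intro has_sum_add has_sum_finite_neutralI[of "{0}"] has_sum_finite_neutralI[of "{m}"]) auto
  have eq: "c m * (G k - G (k - m)) + ((if k = 0 then c m * (1 / 6 + f (- m)) else 0) + (if k = m then c m * (1 / 6 - f m) else 0))
     = c k * c (m - k)" for k
  proof -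
    consider "k = 0" | "k = m" | "k \<noteq> 0" "k \<noteq> m" by auto
    then show ?thesis
    proof cases
      case 1 
      then show ?thesis using m by (simp add: G_def laurent_coeff_def algebra_simps)
    next
      case 2
      then show ?thesis using m by (simp add: G_def laurent_coeff_def[of _ 0] algebra_simps)
    next
      case 3
      then show ?thesis using m by (simp add: G_def laurent_coeff_product)
    qed
  qed
  have "c m * of_int m + (c m * (1 / 6 + f (- m)) + c m * (1 / 6 - f m)) = c m * (of_int m + 4 / 3 - 2 * f m)"
    by (simp add: geometric_factor_neg[OF m] algebra_simps)
  then show ?thesis
    using has_sum_add[OF 1 2] by (simp add: eq)
qed

lemma laurent_conv: "m \<noteq> 0 \<Longrightarrow> laurent_conv m = c m * (of_int m + 4 / 3 - 2 * f m)"
  using laurent_conv_closed_form laurent_conv_has_sum has_sum_unique by blast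

text \<open>Collecting a double sum with respect to \<open>p + q\<close>: this is how the square of a single \<open>Z\<close> contributes.\<close>

lemma has_sum_along_sum:
  assumes "((\<lambda>(p, q). w (p + q) * (c p * c q)) has_sum S) UNIV"
  shows "((\<lambda>m. w m * laurent_conv m) has_sum S) UNIV"
proof -
  have "((\<lambda>(m, k). w m * (c k * c (m - k))) has_sum S) (UNIV \<times> UNIV)"
    using has_sum_reindex_inverse[OF _ _ assms, of "\<lambda>(p, q). (p + q, p)" "\<lambda>(m, k). (k, m - k)"]
    by (simp add: case_prod_unfold)
  then show ?thesis
  proof (rule has_sum_SigmaD)
    fix m :: int
    show "((\<lambda>k. case (m, k) of (m, k) \<Rightarrow> w m * (c k * c (m - k))) has_sum w m * laurent_conv m) UNIV"
      using laurent_conv_has_sum by (simp add: has_sum_cmult_right)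
  qed
qed

end

section \<open>The addition theorem on Laurent coefficients\<close>

context punctured_disc
begin

lemma binomial_product_has_sum:
  "((\<lambda>(p, q). of_int p * (of_int p + s * of_int q) ^ k * (c p * c q)) has_sum
     (\<Sum>j\<le>k. of_nat (k choose j) * s ^ j * (z (Suc (k - j)) * z j))) UNIV"
proof -
  have "((\<lambda>pq. \<Sum>j\<le>k. of_nat (k choose j) * s ^ j *
       ((\<lambda>(p, q). of_int p ^ Suc (k - j) * of_int q ^ j * (c p * c q)) pq)) has_sum
     (\<Sum>j\<le>k. of_nat (k choose j) * s ^ j * (z (Suc (k - j)) * z j))) UNIV"
    by (intro has_sum_sum_fun has_sum_cmult_right eisenstein_product_has_sum) auto
  moreover have "(\<Sum>j\<le>k. of_nat (k choose j) * s ^ j * (of_int p ^ Suc (k - j) * of_int q ^ j * (c p * c q)))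
       = of_int p * (of_int p + s * of_int q) ^ k * (c p * c q)" for p q
    by (subst add.commute, subst binomial_ring)
       (simp add: sum_distrib_left sum_distrib_right power_mult_distrib mult_ac)
  ultimately show ?thesis by (simp add: case_prod_unfold)
qed

text \<open>Half the coefficient at \<open>(m, n)\<close> of the mixed products in \<open>(Z(\<alpha>) + Z(\<beta>) + Z(- \<alpha> - \<beta>))\<^sup>2\<close>; it vanishes
except on the lines \<open>m = 0\<close>, \<open>n = 0\<close> and \<open>m = n\<close>.\<close>

definition three_term :: "int \<Rightarrow> int \<Rightarrow> complex" where
  "three_term m n = c m * c n + c (m - n) * c (- n) + c (n - m) * c (- m)"

lemma three_term_on_axis: "m \<noteq> 0 \<Longrightarrow> three_term m 0 = c m / 3 + (c (- m))\<^sup>2"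
  by (simp add: three_term_def laurent_coeff_def[of _ 0] power2_eq_square)

lemma three_term_eq_0: "m \<noteq> 0 \<Longrightarrow> n \<noteq> 0 \<Longrightarrow> m \<noteq> n \<Longrightarrow> three_term m n = 0"
  by (simp add: three_term_def laurent_coeff_three_term)

text \<open>The weight \<open>(m - n) m\<^sup>k\<close> stands for applying \<open>\<partial>\<^sub>\<alpha> - \<partial>\<^sub>\<beta>\<close>, then putting \<open>\<beta> = 0\<close> and
taking the \<open>k\<close>-th derivative with respect to \<open>\<alpha>\<close> at 0. The three mixed products are brought to the form \<open>c\<^sub>p c\<^sub>q\<close> by unimodular
substitutions.\<close>

lemma three_term_has_sum:
  "((\<lambda>(m, n). (of_int m - of_int n) * of_int m ^ k * three_term m n) has_sum
     (z (Suc k) * z 0 - z k * z 1) + (\<Sum>j\<le>k. of_nat (k choose j) * (- 1) ^ j * (z (Suc (k - j)) * z j))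
       + - ((- 1) ^ k) * (z 1 * z k)) UNIV"
proof -
  have 1: "((\<lambda>(m, n). (of_int m - of_int n) * of_int m ^ k * (c m * c n)) has_sum (z (Suc k) * z 0 - z k * z 1)) UNIV"
    using has_sum_minus_complex[OF eisenstein_product_has_sum[of "Suc k" 0] eisenstein_product_has_sum[of k 1]]
    by (simp add: case_prod_unfold algebra_simps)
  have 2: "((\<lambda>(m, n). (of_int m - of_int n) * of_int m ^ k * (c (m - n) * c (- n))) has_sum
      (\<Sum>j\<le>k. of_nat (k choose j) * (- 1) ^ j * (z (Suc (k - j)) * z j))) UNIV"
    using has_sum_reindex_inverse[OF _ _ binomial_product_has_sum[of "-1" k],
       of "\<lambda>(p, q). (p - q, - q)" "\<lambda>(m, n). (m - n, - n)"]
    by (simp add: case_prod_unfold)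
  have "((\<lambda>(p, q). - ((- 1) ^ k) * (of_int p ^ 1 * of_int q ^ k * (c p * c q))) has_sum - ((- 1) ^ k) * (z 1 * z k)) UNIV"
    using has_sum_cmult_right[OF eisenstein_product_has_sum[of 1 k], of "- ((- 1) ^ k)"]
    by (simp add: case_prod_unfold)
  from has_sum_reindex_inverse[OF _ _ this, of "\<lambda>(p, q). (- q, p - q)" "\<lambda>(m, n). (n - m, - m)"]
  have "((\<lambda>(m, n). - ((- 1) ^ k) * ((of_int n - of_int m) * of_int (- m) ^ k * (c (n - m) * c (- m)))) has_sum
       - ((- 1) ^ k) * (z 1 * z k)) UNIV"
    by (simp add: case_prod_unfold)
  also have "(\<lambda>(m, n). - ((- 1) ^ k) * ((of_int n - of_int m) * of_int (- m) ^ k * (c (n - m) * c (- m)))) =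
     (\<lambda>(m, n). (of_int m - of_int n) * of_int m ^ k * (c (n - m) * c (- m)))"
  proof -
    have e: "(- 1) ^ k * of_int (- m) ^ k = (of_int m ^ k :: complex)" for m :: int
      by (simp flip: power_mult_distrib)
    have key: "- ((- 1) ^ k) * (a * of_int (- m) ^ k * b) = - a * of_int m ^ k * b" for a b :: complex and m :: int
    proof -
      have "- ((- 1) ^ k) * (a * of_int (- m) ^ k * b) = - a * ((- 1) ^ k * of_int (- m) ^ k) * b"
        by (simp only: mult_ac mult_minus_left mult_minus_right)
      then show ?thesis by (simp only: e)
    qed
    show ?thesis by (simp only: fun_eq_iff split_paired_all prod.case key minus_diff_eq) simp
  qed
  finally have 3: "((\<lambda>(m, n). (of_int m - of_int n) * of_int m ^ k * (c (n - m) * c (- m))) has_sum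
       - ((- 1) ^ k) * (z 1 * z k)) UNIV" .
  show ?thesis
    using has_sum_add[OF has_sum_add[OF 1 2] 3]
    by (simp add: case_prod_unfold three_term_def algebra_simps)
qed

text \<open>The weight \<open>(m - n) m\<^sup>k\<close> kills the lines \<open>m = 0\<close> and \<open>m = n\<close>, so only \<open>n = 0\<close> survives. There the mixed
products and the square of \<open>Z(\<alpha>)\<close> add up to \<open>m c\<^sub>m\<close>, the coefficient of \<open>Z'(\<alpha>)\<close>.\<close>

lemma eisenstein_recurrence_binomial:
  assumes k: "k \<ge> 1"
  shows "z (k + 2) = 2 * (\<Sum>j\<le>k. of_nat (k choose j) * (z (Suc (k - j)) * z j))
      + 2 * ((z (Suc k) * z 0 - z k * z 1) + (\<Sum>j\<le>k. of_nat (k choose j) * (- 1) ^ j * (z (Suc (k - j)) * z j))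
       - (- 1) ^ k * (z 1 * z k))" (is "_ = 2 * ?W + 2 * ?Y")
proof -
  have W: "((\<lambda>(p, q). of_int p * (of_int p + of_int q) ^ k * (c p * c q)) has_sum ?W) UNIV"
    using binomial_product_has_sum[of 1 k] by simp
  have "((\<lambda>(p, q). of_int q * (of_int q + of_int p) ^ k * (c q * c p)) has_sum ?W) UNIV"
    using has_sum_reindex_inverse[OF _ _ W, of "\<lambda>(p, q). (q, p)" "\<lambda>(p, q). (q, p)"] by (simp add: case_prod_unfold)
  from has_sum_add[OF W this]
  have "((\<lambda>(p, q). of_int (p + q) ^ Suc k * (c p * c q)) has_sum 2 * ?W) UNIV"
    by (simp add: case_prod_unfold algebra_simps)
  then have X: "((\<lambda>m. of_int m ^ Suc k * laurent_conv m) has_sum 2 * ?W) UNIV"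
    by (rule has_sum_along_sum)
  have Y0: "((\<lambda>(m, n). (of_int m - of_int n) * of_int m ^ k * three_term m n) has_sum ?Y) UNIV"
    using three_term_has_sum[of k] by simp
  have "((\<lambda>(m, n). (of_int m - of_int n) * of_int m ^ k * three_term m n) has_sum ?Y) (range (\<lambda>m. (m, 0)))"
  proof (rule has_sum_cong_neutral[THEN iffD1, OF _ _ _ Y0])
    fix p :: "int \<times> int" assume p: "p \<in> UNIV - range (\<lambda>m. (m, 0))"
    obtain m n where mn: "p = (m, n)" by fastforce
    have "n \<noteq> 0" using p mn by auto
    then show "(case p of (m, n) \<Rightarrow> (of_int m - of_int n) * of_int m ^ k * three_term m n) = 0"
      using k three_term_eq_0[of m n] by (cases "m = 0 \<or> m = n") (auto simp: mn)
  qed auto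
  then have "((\<lambda>m. of_int m ^ Suc k * three_term m 0) has_sum ?Y) UNIV"
    by (subst (asm) has_sum_reindex) (auto simp: inj_on_def o_def)
  from has_sum_add[OF X has_sum_cmult_right[OF this, of 2]]
  have "((\<lambda>m. of_int m ^ Suc k * laurent_conv m + 2 * (of_int m ^ Suc k * three_term m 0)) has_sum 2 * ?W + 2 * ?Y) UNIV" .
  also have "(\<lambda>m. of_int m ^ Suc k * laurent_conv m + 2 * (of_int m ^ Suc k * three_term m 0)) = (\<lambda>m. of_int m ^ (k + 2) * c m)"
  proof
    fix m :: int
    show "of_int m ^ Suc k * laurent_conv m + 2 * (of_int m ^ Suc k * three_term m 0) = of_int m ^ (k + 2) * c m"
    proof (cases "m = 0")
      case False
      have "laurent_conv m + 2 * three_term m 0 = of_int m * c m"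
        using False by (simp add: laurent_conv three_term_on_axis laurent_coeff_neg_square algebra_simps)
      then show ?thesis
        by (metis (no_types, lifting) add_2_eq_Suc' distrib_left mult.assoc mult.left_commute power_Suc2)
    qed simp
  qed
  finally show ?thesis using eisenstein_has_sum[of "k + 2"] has_sum_unique by blast
qed

text \<open>\<open>E\<^sub>1\<close> does not occur on the right: in the sum, the odd \<open>j\<close> cancel, so \<open>j \<noteq> 1\<close>, and \<open>k + 1 - j \<ge> 2\<close>. The two
terms with \<open>j = k\<close> that would contain \<open>E\<^sub>1\<close> cancel against those of \<open>three_term_has_sum\<close>.\<close>

theorem eisenstein_recurrence:
  assumes "k \<ge> 1"
  shows "z (k + 2) = 6 * z 0 * z (k + 1)
     + (\<Sum>j = 1..<k. 2 * (1 + (- 1) ^ j) * of_nat (k choose j) * z j * z (k + 1 - j))"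
proof -
  define g where "g j = (1 + (- 1) ^ j) * of_nat (k choose j) * z j * z (k + 1 - j)" for j
  have "(\<Sum>j\<le>k. of_nat (k choose j) * (z (Suc (k - j)) * z j))
      + (\<Sum>j\<le>k. of_nat (k choose j) * (- 1) ^ j * (z (Suc (k - j)) * z j)) = (\<Sum>j\<le>k. g j)"
    unfolding sum.distrib[symmetric]
    by (intro sum.cong) (auto simp: g_def algebra_simps Suc_diff_le)
  also have "(\<Sum>j\<le>k. g j) = (\<Sum>j\<in>insert 0 (insert k {1..<k}). g j)"
    using assms by (intro sum.cong) auto
  also have "(\<Sum>j\<in>insert 0 (insert k {1..<k}). g j) = g 0 + (g k + (\<Sum>j=1..<k. g j))"
    using assms by simp
  finally have *: "(\<Sum>j\<le>k. of_nat (k choose j) * (z (Suc (k - j)) * z j))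
      + (\<Sum>j\<le>k. of_nat (k choose j) * (- 1) ^ j * (z (Suc (k - j)) * z j)) = g 0 + (g k + (\<Sum>j=1..<k. g j))" .
  have **: "(\<Sum>j = 1..<k. 2 * (1 + (- 1) ^ j) * of_nat (k choose j) * z j * z (k + 1 - j)) = 2 * (\<Sum>j=1..<k. g j)"
    by (simp add: g_def sum_distrib_left algebra_simps)
  have "g 0 = 2 * z 0 * z (k + 1)" "g k = (1 + (- 1) ^ k) * z 1 * z k"
    by (simp_all add: g_def)
  then show ?thesis
    unfolding eisenstein_recurrence_binomial[OF assms] **
    using arg_cong[OF *, of "\<lambda>s. 2 * s"] by (simp add: algebra_simps)
qed

text \<open>The addition theorem at \<open>\<alpha> = \<beta> = \<gamma> = 0\<close>. What matters about the last sum is that it is a function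
of \<open>x\<^sup>3\<close>.\<close>

theorem eisenstein_weight_2:
  "9 * (z 0)\<^sup>2 = 3 * z 1 + 1 / 4 + 3 * (\<Sum>\<^sub>\<infinity>k. if k = 0 then 0 else f k * f (- k))"
proof -
  let ?D = "\<Sum>\<^sub>\<infinity>k. if k = 0 then 0 else f k * f (- k)"
  note cc = laurent_conv_has_sum[of 0]
  have D: "laurent_conv 0 = 1 / 36 + ?D"
  proof -
    have "((\<lambda>k. if k = 0 then 1 / 36 else 0) has_sum (1 / 36 :: complex)) (UNIV :: int set)"
      by (rule has_sum_finite_neutralI[of "{0}"]) auto
    from has_sum_minus_complex[OF cc this]
    have "((\<lambda>k. c k * c (0 - k) - (if k = 0 then 1 / 36 else 0)) has_sum laurent_conv 0 - 1 / 36) UNIV" .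
    also have "(\<lambda>k. c k * c (0 - k) - (if k = 0 then 1 / 36 else 0)) = (\<lambda>k. if k = 0 then 0 else f k * f (- k))"
      using x0 by (auto simp: fun_eq_iff laurent_coeff_def power_int_minus field_simps)
    finally show ?thesis by (simp add: has_sum_iff)
  qed
  \<comment> \<open>\<open>A\<close> and \<open>P\<close> sum \<open>c\<^sub>k\<close> and \<open>c\<^sub>k\<^sup>2\<close> over \<open>k \<noteq> 0\<close>; both drop out when the equations \<open>X\<close> and \<open>Y\<close> are combined.\<close>
  define A where "A = z 0 - 1 / 6"
  define c' where "c' n = (if n = 0 then 0 else c n)" for n
  have A: "(c' has_sum A) UNIV"
  proof -
    have "((\<lambda>k. if k = 0 then 1 / 6 else 0) has_sum (1 / 6 :: complex)) (UNIV :: int set)"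
      by (rule has_sum_finite_neutralI[of "{0}"]) auto
    from has_sum_minus_complex[OF laurent_coeff_has_sum this] show ?thesis
      unfolding A_def
      by (rule has_sum_cong[THEN iffD1, rotated]) (auto simp: c'_def laurent_coeff_def)
  qed
  have "((\<lambda>k. (c' k)\<^sup>2) has_sum infsum (\<lambda>k. (c' k)\<^sup>2) UNIV) UNIV"
  proof -
    have "(\<lambda>(p, q). c' p * c' q) summable_on UNIV"
      using has_sum_product_UNIV[OF A A] by (rule has_sum_imp_summable)
    from summable_on_comp_inj[OF this, of "\<lambda>k. (k, k)"] show ?thesis
      by (simp add: inj_on_def power2_eq_square)
  qed
  then obtain P where P: "((\<lambda>k. (c' k)\<^sup>2) has_sum P) UNIV" by blast
  have P': "((\<lambda>k. (c' (- k))\<^sup>2) has_sum P) UNIV"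
    by (rule has_sum_reindex_inverse[OF _ _ P, of uminus]) auto
  have A': "((\<lambda>k. c' (- k)) has_sum A) UNIV"
    by (rule has_sum_reindex_inverse[OF _ _ A, of uminus]) auto
  have X: "(z 0)\<^sup>2 = z 1 - 2 / 3 * A - 2 * P + laurent_conv 0"
  proof -
    have "((\<lambda>m. 1 * laurent_conv m) has_sum (z 0)\<^sup>2) UNIV"
      using eisenstein_product_has_sum[of 0 0]
      by (intro has_sum_along_sum) (simp add: case_prod_unfold power2_eq_square)
    moreover have "((\<lambda>k. (of_int k ^ 1 * c k + (-2 / 3) * c' k + (-2) * (c' (- k))\<^sup>2) + (if k = 0 then laurent_conv 0 else 0))
       has_sum (z 1 + (-2 / 3) * A + (-2) * P) + laurent_conv 0) UNIV"
      by (intro has_sum_add has_sum_cmult_right eisenstein_has_sum A P' has_sum_finite_neutralI[of "{0}"]) auto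
    moreover have "(of_int k ^ 1 * c k + (-2 / 3) * c' k + (-2) * (c' (- k))\<^sup>2) + (if k = 0 then laurent_conv 0 else 0)
        = 1 * laurent_conv k" for k
      by (cases "k = 0") (auto simp: c'_def laurent_conv laurent_coeff_neg_square algebra_simps)
    ultimately have "(z 0)\<^sup>2 = (z 1 + (-2 / 3) * A + (-2) * P) + laurent_conv 0"
      using has_sum_unique by (metis (no_types, lifting) has_sum_cong)
    then show ?thesis by simp
  qed
  have Y: "3 * (z 0)\<^sup>2 = A + 3 * P + 1 / 12"
  proof -
    have "((\<lambda>(m, n). three_term m n) has_sum z 0 * z 0 + z 0 * z 0 + z 0 * z 0) UNIV"
    proof -
      note prod = eisenstein_product_has_sum[of 0 0]
      have 2: "((\<lambda>(m, n). c (m - n) * c (- n)) has_sum z 0 * z 0) UNIV"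
        using has_sum_reindex_inverse[OF _ _ prod, of "\<lambda>(p, q). (p - q, - q)" "\<lambda>(m, n). (m - n, - n)"]
        by (simp add: case_prod_unfold)
      have 3: "((\<lambda>(m, n). c (n - m) * c (- m)) has_sum z 0 * z 0) UNIV"
        using has_sum_reindex_inverse[OF _ _ prod, of "\<lambda>(p, q). (- q, p - q)" "\<lambda>(m, n). (n - m, - m)"]
        by (simp add: case_prod_unfold)
      show ?thesis using has_sum_add[OF has_sum_add[OF prod 2] 3]
        by (simp add: case_prod_unfold three_term_def)
    qed
    then have 1: "((\<lambda>(m, n). three_term m n) has_sum 3 * (z 0)\<^sup>2) UNIV"
      by (simp add: power2_eq_square)
    \<comment> \<open>The three lines on which \<open>three_term\<close> may be nonzero, without the origin.\<close>
    define L1 L2 L3 where "L1 = (\<lambda>m::int. (m, 0::int)) ` (- {0})" and "L2 = (\<lambda>m::int. (0::int, m)) ` (- {0})"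
      and "L3 = (\<lambda>m::int. (m, m)) ` (- {0})"
    have drop0: "(g has_sum S) (- {0})" if "((\<lambda>k. if k = 0 then 0 else g k) has_sum S) UNIV" for g :: "int \<Rightarrow> complex" and S
      using that by (rule has_sum_cong_neutral[THEN iffD1, rotated -1]) auto
    have sq: "((\<lambda>k. c' k / 3 + (c' (- k))\<^sup>2) has_sum A / 3 + P) UNIV"
      by (intro has_sum_add has_sum_divide_const A P')
    have sq': "((\<lambda>k. c' (- k) / 3 + (c' k)\<^sup>2) has_sum A / 3 + P) UNIV"
      by (intro has_sum_add has_sum_divide_const A' P)
    have l1: "((\<lambda>(m, n). three_term m n) has_sum A / 3 + P) L1"
      unfolding L1_def 
    proof (subst has_sum_reindex)
      show "((\<lambda>(m, n). three_term m n) \<circ> (\<lambda>m. (m, 0)) has_sum A / 3 + P) (- {0})"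
        using sq by (intro drop0, elim has_sum_cong[THEN iffD1, rotated])
           (auto simp: c'_def three_term_on_axis)
    qed (auto simp: inj_on_def)
    have l2: "((\<lambda>(m, n). three_term m n) has_sum A / 3 + P) L2"
      unfolding L2_def 
    proof (subst has_sum_reindex)
      show "((\<lambda>(m, n). three_term m n) \<circ> (\<lambda>m. (0, m)) has_sum A / 3 + P) (- {0})"
        using sq by (intro drop0, elim has_sum_cong[THEN iffD1, rotated])
           (auto simp: c'_def three_term_def power2_eq_square laurent_coeff_def[of _ 0])
    qed (auto simp: inj_on_def)
    have l3: "((\<lambda>(m, n). three_term m n) has_sum A / 3 + P) L3"
      unfolding L3_def 
    proof (subst has_sum_reindex)
      show "((\<lambda>(m, n). three_term m n) \<circ> (\<lambda>m. (m, m)) has_sum A / 3 + P) (- {0})"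
        using sq' by (intro drop0, elim has_sum_cong[THEN iffD1, rotated])
           (auto simp: c'_def three_term_def power2_eq_square laurent_coeff_def[of _ 0])
    qed (auto simp: inj_on_def)
    have "((\<lambda>(m, n). three_term m n) has_sum (((A / 3 + P) + (A / 3 + P)) + (A / 3 + P)) + 1 / 12) (((L1 \<union> L2) \<union> L3) \<union> {(0, 0)})"
      by (intro has_sum_Un_disjoint l1 l2 l3 has_sum_finiteI)
         (auto simp: L1_def L2_def L3_def three_term_def laurent_coeff_def)
    also have "?this \<longleftrightarrow> ((\<lambda>(m, n). three_term m n) has_sum (((A / 3 + P) + (A / 3 + P)) + (A / 3 + P)) + 1 / 12) UNIV"
    proof (rule has_sum_cong_neutral)
      fix p :: "int \<times> int" assume p: "p \<in> UNIV - (((L1 \<union> L2) \<union> L3) \<union> {(0, 0)})"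
      obtain m n where mn: "p = (m, n)" by fastforce
      have "m \<noteq> 0" "n \<noteq> 0" "m \<noteq> n" using p mn by (auto simp: L1_def L2_def L3_def)
      then show "(case p of (m, n) \<Rightarrow> three_term m n) = 0" by (simp add: mn three_term_eq_0)
    qed auto
    finally show ?thesis using has_sum_unique[OF 1] by (simp add: algebra_simps)
  qed
  have "3 * (z 0)\<^sup>2 = 3 * z 1 - 2 * A - 6 * P + 3 * (1 / 36 + ?D)"
    unfolding X D by (simp add: algebra_simps)
  moreover have "9 * (z 0)\<^sup>2 = 3 * (z 0)\<^sup>2 + 2 * (3 * (z 0)\<^sup>2)" by simp
  ultimately have "9 * (z 0)\<^sup>2 = 3 * z 1 - 2 * A - 6 * P + 3 * (1 / 36 + ?D) + 2 * (A + 3 * P + 1 / 12)"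
    by (simp only: Y)
  then show ?thesis by (simp add: algebra_simps)
qed

end

section \<open>Eisenstein series as Lambert series\<close>

text \<open>The character modulo 3 with the parity of \<open>j + 1\<close>: it is trivial for odd \<open>j\<close> and quadratic for even \<open>j\<close>.\<close>

definition chi :: "nat \<Rightarrow> nat \<Rightarrow> complex" where
  "chi j m = (if m mod 3 = 0 then 0 else if m mod 3 = 1 then 1 else (- 1) ^ Suc j)"

definition divisor_sum_fps :: "nat \<Rightarrow> complex fps" where
  "divisor_sum_fps j = graded_series (\<lambda>(d, m). d * m) (\<lambda>(d, m). of_nat d ^ j * chi j m) ({1..} \<times> {1..})"

definition eisenstein_fps :: "nat \<Rightarrow> complex fps" where
  "eisenstein_fps j = fps_const (if j = 0 then 1 / 6 else 0) + divisor_sum_fps j"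

lemma norm_chi_le: "norm (chi j m) \<le> 1"
  by (simp add: chi_def norm_power)

lemma chi_has_sum:
  assumes y: "norm y < 1"
  shows "((\<lambda>m. chi j m * y ^ m) has_sum (y + (- 1) ^ Suc j * y\<^sup>2) / (1 - y ^ 3)) {1..}"
proof -
  have y3: "norm (y ^ 3) < 1" using y by (simp add: norm_power power_less_one_iff)
  have "((\<lambda>n. (y ^ 3) ^ n) has_sum 1 / (1 - y ^ 3)) UNIV"
    using y3 by (intro norm_summable_imp_has_sum geometric_sums) (auto simp: norm_power intro!: summable_geometric)
  then have geo: "((\<lambda>n. w * (y ^ 3) ^ n) has_sum w * (1 / (1 - y ^ 3))) UNIV" for w
    by (rule has_sum_cmult_right)
  have sub: "((\<lambda>m. chi j m * y ^ m) has_sum chi j r * y ^ r * (1 / (1 - y ^ 3))) (range (\<lambda>n. 3 * n + r))" for r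
  proof (subst has_sum_reindex)
    have "chi j (3 * n + r) * y ^ (3 * n + r) = chi j r * y ^ r * (y ^ 3) ^ n" for n
      by (simp add: chi_def power_add mult_ac flip: power_mult)
    then show "((\<lambda>m. chi j m * y ^ m) \<circ> (\<lambda>n. 3 * n + r) has_sum chi j r * y ^ r * (1 / (1 - y ^ 3))) UNIV"
      using geo[of "chi j r * y ^ r"] by (simp add: o_def)
  qed (auto simp: inj_on_def)
  have "range (\<lambda>n::nat. 3 * n + 1) \<inter> range (\<lambda>n. 3 * n + 2) = {}"
  proof -
    have "3 * a + 1 \<noteq> 3 * b + (2::nat)" for a b by presburger
    then show ?thesis by blast
  qed
  from has_sum_Un_disjoint[OF sub[of 1] sub[of 2] this]
  have "((\<lambda>m. chi j m * y ^ m) has_sum chi j 1 * y ^ 1 * (1 / (1 - y ^ 3)) + chi j 2 * y ^ 2 * (1 / (1 - y ^ 3)))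
      (range (\<lambda>n. 3 * n + 1) \<union> range (\<lambda>n. 3 * n + 2))" .
  also have "?this \<longleftrightarrow> ((\<lambda>m. chi j m * y ^ m) has_sum chi j 1 * y ^ 1 * (1 / (1 - y ^ 3)) + chi j 2 * y ^ 2 * (1 / (1 - y ^ 3))) {1..}"
  proof (rule has_sum_cong_neutral)
    fix m :: nat assume m: "m \<in> {1..} - (range (\<lambda>n. 3 * n + 1) \<union> range (\<lambda>n. 3 * n + 2))"
    have "m = 3 * (m div 3) + m mod 3" by simp
    moreover have "m mod 3 \<noteq> 1" "m mod 3 \<noteq> 2" using m calculation by (metis Diff_iff UnI1 rangeI, metis Diff_iff UnI2 rangeI)
    ultimately have "m mod 3 = 0" by linarith
    then show "chi j m * y ^ m = 0" by (simp add: chi_def)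
  qed auto
  finally have "((\<lambda>m. chi j m * y ^ m) has_sum (chi j 1 * y ^ 1 * (1 / (1 - y ^ 3)) + chi j 2 * y ^ 2 * (1 / (1 - y ^ 3)))) {1..}" .
  moreover have "chi j 1 = 1" "chi j 2 = (- 1) ^ Suc j" by (simp_all add: chi_def)
  ultimately show ?thesis by (simp add: add_divide_distrib diff_divide_distrib)
qed

lemma divisor_sum_fps_summable:
  assumes x: "norm x < 1"
  shows "(\<lambda>p. (case p of (d, m) \<Rightarrow> of_nat d ^ j * chi j m) * x ^ (case p of (d, m) \<Rightarrow> d * m)) summable_on ({1..} \<times> {1..})"
proof -
  define s where "s = max (norm x) (1 / 2)"
  have s: "0 < s" "s < 1" "norm x \<le> s" using x by (auto simp: s_def)
  have 1: "(\<lambda>d::nat. of_nat d ^ j * of_real s ^ d :: complex) summable_on UNIV"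
  proof (rule norm_summable_imp_summable_on)
    show "summable (\<lambda>d. norm (of_nat d ^ j * of_real s ^ d :: complex))"
      using summable_nat_power_times_geometric[of s j] s by (simp add: norm_mult norm_power)
  qed
  have 2: "(\<lambda>m::nat. of_real s ^ m / of_real s :: complex) summable_on UNIV"
    using s by (intro norm_summable_imp_summable_on) (auto simp: norm_divide norm_power intro!: summable_divide summable_geometric)
  have "(\<lambda>(d, m). of_nat d ^ j * of_real s ^ d * (of_real s ^ m / of_real s) :: complex) summable_on UNIV"
    using has_sum_product_UNIV[OF has_sum_infsum[OF 1] has_sum_infsum[OF 2]] by (rule has_sum_imp_summable)
  then have "(\<lambda>(d, m). of_nat d ^ j * of_real s ^ d * (of_real s ^ m / of_real s) :: complex) summable_on ({1..} \<times> {1..})"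
    by (rule summable_on_subset) simp
  then have bound: "(\<lambda>p. norm ((\<lambda>(d, m). of_nat d ^ j * of_real s ^ d * (of_real s ^ m / of_real s) :: complex) p)) summable_on ({1..} \<times> {1..})"
    by (simp add: summable_on_iff_abs_summable_on_complex)
  have "(\<lambda>p. norm ((case p of (d, m) \<Rightarrow> of_nat d ^ j * chi j m) * x ^ (case p of (d, m) \<Rightarrow> d * m))) summable_on ({1..} \<times> {1..})"
  proof (rule Infinite_Sum.abs_summable_on_comparison_test'[OF bound])
    fix p :: "nat \<times> nat" assume "p \<in> {1..} \<times> {1..}"
    then obtain d m where p: "p = (d, m)" "d \<ge> 1" "m \<ge> 1" by auto
    \<comment> \<open>\<open>dm \<ge> d + m - 1\<close> bounds the double series by a product of two series.\<close>
    obtain d' m' where dm: "d = Suc d'" "m = Suc m'" using p(2,3) by (metis Suc_le_D One_nat_def)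
    have "norm x ^ (d * m) \<le> s ^ (d * m)" using s by (intro power_mono) auto
    also have "\<dots> \<le> s ^ (d + m')" using s by (intro power_decreasing) (auto simp: dm)
    also have "\<dots> = s ^ d * (s ^ m / s)" using s by (simp add: dm power_add)
    finally have le: "norm x ^ (d * m) \<le> s ^ d * (s ^ m / s)" .
    have "real d ^ j * (norm (chi j m) * norm x ^ (d * m)) \<le> real d ^ j * (1 * (s ^ d * (s ^ m / s)))"
      by (intro mult_left_mono mult_mono le norm_chi_le) auto
    then show "norm ((case p of (d, m) \<Rightarrow> of_nat d ^ j * chi j m) * x ^ (case p of (d, m) \<Rightarrow> d * m))
       \<le> norm ((\<lambda>(d, m). of_nat d ^ j * of_real s ^ d * (of_real s ^ m / of_real s) :: complex) p)"
      using s by (simp add: p norm_mult norm_power norm_divide mult_ac)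
  qed
  then show ?thesis by (simp add: summable_on_iff_abs_summable_on_complex)
qed

lemma divisor_sum_fps_fibre: "finite {p \<in> {1..} \<times> {1..}. (\<lambda>(d, m). d * m) p = (N :: nat)}"
proof (rule finite_subset)
  show "{p \<in> {1..} \<times> {1..}. (\<lambda>(d, m). d * m) p = N} \<subseteq> {..N} \<times> {..N}" by auto
qed simp

lemma divisor_sum_fps_radius: "fps_conv_radius (divisor_sum_fps j) \<ge> 1"
  unfolding divisor_sum_fps_def by (intro graded_series(1) divisor_sum_fps_fibre divisor_sum_fps_summable)

lemma eisenstein_fps_radius: "fps_conv_radius (eisenstein_fps j) \<ge> 1"
  using fps_conv_radius_add[of "fps_const (if j = 0 then 1 / 6 else 0)" "divisor_sum_fps j"] divisor_sum_fps_radius[of j]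
  by (simp add: eisenstein_fps_def min_def)

lemma eisenstein_fps_nth:
  assumes "N > 0"
  shows "fps_nth (eisenstein_fps j) N = (\<Sum>d | d dvd N. of_nat d ^ j * chi j (N div d))"
proof -
  have "fps_nth (eisenstein_fps j) N = (\<Sum>p \<in> {p \<in> {1..} \<times> {1..}. (\<lambda>(d, m). d * m) p = N}. (\<lambda>(d, m). of_nat d ^ j * chi j m) p)"
    using assms by (simp add: eisenstein_fps_def divisor_sum_fps_def graded_series_def)
  also have "\<dots> = (\<Sum>d | d dvd N. of_nat d ^ j * chi j (N div d))"
    by (rule sum.reindex_bij_witness[where j = fst and i = "\<lambda>d. (d, N div d)"])
       (use assms in \<open>auto simp: Suc_le_eq elim!: dvdE\<close>)
  finally show ?thesis .
qed

lemma eisenstein_fps_nth_0: "fps_nth (eisenstein_fps j) 0 = (if j = 0 then 1 / 6 else 0)"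
proof -
  have "{p \<in> {1..} \<times> {1..}. (\<lambda>(d, m). d * m) p = (0::nat)} = {}" by auto
  then show ?thesis
    by (simp only: eisenstein_fps_def divisor_sum_fps_def graded_series_def fps_add_nth fps_nth_Abs_fps sum.empty) simp
qed

text \<open>Expanding the geometric series in \<open>c\<^sub>d\<close> and \<open>c\<^sub>-\<^sub>d\<close> yields the exponents \<open>dm\<close> with \<open>m \<equiv> 1\<close> and \<open>m \<equiv> 2\<close> modulo 3,
respectively; their relative sign is \<open>- (- 1)\<^sup>j\<close>.\<close>

lemma (in punctured_disc) eval_eisenstein_fps: "eval_fps (eisenstein_fps j) x = eisenstein j x"
proof -
  have xr: "ereal (norm x) < fps_conv_radius (divisor_sum_fps j)"
    using divisor_sum_fps_radius[of j] x1 by (metis ereal_less(3) less_le_trans one_ereal_def less_ereal.simps(1))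
  have L: "((\<lambda>(d, m). of_nat d ^ j * chi j m * x ^ (d * m)) has_sum eval_fps (divisor_sum_fps j) x) (Sigma {1..} (\<lambda>_. {1..}))"
    using graded_series(2)[OF divisor_sum_fps_fibre divisor_sum_fps_summable x1] unfolding divisor_sum_fps_def
    by (simp add: case_prod_unfold)
  have "((\<lambda>d. of_nat d ^ j * (laurent_coeff x (int d) + (- 1) ^ j * laurent_coeff x (- int d))) has_sum eval_fps (divisor_sum_fps j) x) {1..}"
  proof (rule has_sum_SigmaD[OF L])
    fix d :: nat assume d: "d \<in> {1..}"
    have xd: "norm (x ^ d) < 1" using d x1 by (simp add: norm_power power_less_one_iff)
    have n1: "(x ^ d) ^ 3 \<noteq> 1" using powi_3_neq_1[of "int d", unfolded powi_3] d by simp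
    define X where "X = x ^ d"
    have X: "X \<noteq> 0" "X ^ 3 \<noteq> 1" using n1 x0 by (auto simp: X_def)
    have "laurent_coeff x (int d) = X / (1 - X ^ 3)"
      using d by (simp add: laurent_coeff_def geometric_factor_def powi_3 X_def)
    moreover have "laurent_coeff x (- int d) = - X\<^sup>2 / (1 - X ^ 3)"
    proof -
      have "laurent_coeff x (- int d) = inverse X * (1 / (1 - inverse X ^ 3))"
        using d by (simp add: laurent_coeff_def geometric_factor_def powi_3 power_int_minus X_def power_inverse)
      also have "\<dots> = - X\<^sup>2 / (1 - X ^ 3)"
        using X by (simp add: divide_simps) (simp add: eval_nat_numeral algebra_simps)
      finally show ?thesis .
    qed
    ultimately have "laurent_coeff x (int d) + (- 1) ^ j * laurent_coeff x (- int d) = (x ^ d + (- 1) ^ Suc j * (x ^ d)\<^sup>2) / (1 - (x ^ d) ^ 3)"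
      by (simp add: X_def add_divide_distrib diff_divide_distrib)
    moreover have "((\<lambda>m. of_nat d ^ j * (chi j m * (x ^ d) ^ m)) has_sum
       of_nat d ^ j * ((x ^ d + (- 1) ^ Suc j * (x ^ d)\<^sup>2) / (1 - (x ^ d) ^ 3))) {1..}"
      by (intro has_sum_cmult_right chi_has_sum xd)
    ultimately show "((\<lambda>m. case (d, m) of (d, m) \<Rightarrow> of_nat d ^ j * chi j m * x ^ (d * m)) has_sum
       of_nat d ^ j * (laurent_coeff x (int d) + (- 1) ^ j * laurent_coeff x (- int d))) {1..}"
      by (simp add: power_mult mult_ac)
  qed
  moreover have "((\<lambda>d. of_nat d ^ j * (laurent_coeff x (int d) + (- 1) ^ j * laurent_coeff x (- int d))) has_sum
       eisenstein j x - (if j = 0 then 1 / 6 else 0)) {1..}"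
  proof -
    define g where "g n = of_int n ^ j * laurent_coeff x n" for n
    define g0 :: complex where "g0 = (if j = 0 then 1 / 6 else 0)"
    have g: "(g has_sum eisenstein j x) UNIV" unfolding g_def by (rule eisenstein_has_sum)
    have pos: "g summable_on int ` {1..}" and neg: "g summable_on (\<lambda>n. - int n) ` {1..}"
      using has_sum_imp_summable[OF g] summable_on_subset by blast+
    obtain P where P: "(g has_sum P) (int ` {1..})" using pos has_sum_infsum by blast
    obtain M where M: "(g has_sum M) ((\<lambda>n. - int n) ` {1..})" using neg has_sum_infsum by blast
    have PM: "(g has_sum P + M) (int ` {1..} \<union> (\<lambda>n. - int n) ` {1..})"
      by (intro has_sum_Un_disjoint P M) auto
    have G0: "(g has_sum g0) {0}"
      by (rule has_sum_finiteI) (auto simp: g_def g0_def laurent_coeff_def)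
    have "(g has_sum P + M + g0) (int ` {1..} \<union> (\<lambda>n. - int n) ` {1..} \<union> {0})"
      by (rule has_sum_Un_disjoint[OF PM G0]) auto
    also have "int ` {1..} \<union> (\<lambda>n. - int n) ` {1..} \<union> {0} = UNIV"
    proof (intro equalityI subsetI UNIV_I)
      fix n :: int
      show "n \<in> int ` {1..} \<union> (\<lambda>n. - int n) ` {1..} \<union> {0}"
        by (cases n rule: int_cases3) auto
    qed
    finally have "eisenstein j x = P + M + g0" using g has_sum_unique by blast
    moreover have "((\<lambda>d. g (int d) + g (- int d)) has_sum P + M) {1..}"
      using P M by (intro has_sum_add) (simp_all add: has_sum_reindex inj_on_def o_def)
    moreover have "g (int d) + g (- int d) = of_nat d ^ j * (laurent_coeff x (int d) + (- 1) ^ j * laurent_coeff x (- int d))" for d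
      by (simp add: g_def algebra_simps power_minus[of "of_nat d"])
    ultimately show ?thesis by (simp add: g0_def)
  qed
  ultimately have "eval_fps (divisor_sum_fps j) x = eisenstein j x - (if j = 0 then 1 / 6 else 0)"
    using has_sum_unique by blast
  then show ?thesis using xr by (simp add: eisenstein_fps_def eval_fps_add)
qed

section \<open>Substituting the cube of the variable\<close>

text \<open>The substitution \<open>F(x) \<mapsto> F(x\<^sup>3)\<close>, a ring endomorphism of the power series.\<close>

definition cube_arg :: "complex fps \<Rightarrow> complex fps" where
  "cube_arg F = fps_compose F (fps_X ^ 3)"

lemma cube_arg_nth: "fps_nth (cube_arg F) n = (if 3 dvd n then fps_nth F (n div 3) else 0)"
  by (simp add: cube_arg_def fps_nth_compose_X_power)

lemma cube_arg_add: "cube_arg (F + G) = cube_arg F + cube_arg G"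
  by (simp add: cube_arg_def fps_compose_add_distrib)
lemma cube_arg_mult: "cube_arg (F * G) = cube_arg F * cube_arg G"
  by (simp add: cube_arg_def fps_compose_mult_distrib)
lemma cube_arg_power: "cube_arg (F ^ n) = cube_arg F ^ n"
  by (simp add: cube_arg_def fps_compose_power)
lemma cube_arg_numeral: "cube_arg (numeral k) = numeral k"
  by (simp add: cube_arg_def flip: numeral_fps_const)
lemma cube_arg_X: "cube_arg fps_X = fps_X ^ 3"
  by (simp add: cube_arg_def)

lemmas cube_arg_simps = cube_arg_add cube_arg_mult cube_arg_power cube_arg_numeral cube_arg_X

lemma cube_arg_parts_nth:
  "fps_nth (cube_arg U + fps_X * cube_arg V + fps_X ^ 2 * cube_arg W) (3 * n) = fps_nth U n"
  "fps_nth (cube_arg U + fps_X * cube_arg V + fps_X ^ 2 * cube_arg W) (3 * n + 1) = fps_nth V n"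
  "fps_nth (cube_arg U + fps_X * cube_arg V + fps_X ^ 2 * cube_arg W) (3 * n + 2) = fps_nth W n"
proof -
  have m: "Suc (Suc (3 * k)) mod 3 = 2" for k by presburger
  show "fps_nth (cube_arg U + fps_X * cube_arg V + fps_X ^ 2 * cube_arg W) (3 * n) = fps_nth U n"
    using m by (cases n) (simp_all add: cube_arg_nth fps_X_power_mult_nth dvd_eq_mod_eq_0)
  show "fps_nth (cube_arg U + fps_X * cube_arg V + fps_X ^ 2 * cube_arg W) (3 * n + 1) = fps_nth V n"
    using m by (cases n) (simp_all add: cube_arg_nth fps_X_power_mult_nth dvd_eq_mod_eq_0)
  show "fps_nth (cube_arg U + fps_X * cube_arg V + fps_X ^ 2 * cube_arg W) (3 * n + 2) = fps_nth W n"
    using m by (cases n) (simp_all add: cube_arg_nth fps_X_power_mult_nth dvd_eq_mod_eq_0)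
qed

definition residue_part :: "nat \<Rightarrow> complex fps \<Rightarrow> complex fps" where
  "residue_part r F = Abs_fps (\<lambda>n. fps_nth F (3 * n + r))"

lemma residue_parts: "F = cube_arg (residue_part 0 F) + fps_X * cube_arg (residue_part 1 F) + fps_X ^ 2 * cube_arg (residue_part 2 F)"
proof (rule fps_ext)
  fix N :: nat
  let ?R = "cube_arg (residue_part 0 F) + fps_X * cube_arg (residue_part 1 F) + fps_X ^ 2 * cube_arg (residue_part 2 F)"
  define n where "n = N div 3"
  have "N mod 3 < 3" by simp
  then have "N mod 3 = 0 \<or> N mod 3 = 1 \<or> N mod 3 = 2" by linarith
  moreover have "N = 3 * n + N mod 3" by (simp add: n_def)
  ultimately consider "N = 3 * n" | "N = 3 * n + 1" | "N = 3 * n + 2" by auto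
  then show "fps_nth F N = fps_nth ?R N"
    by cases (simp_all only: cube_arg_parts_nth, simp_all add: residue_part_def)
qed

lemma residue_part_0_eqI: "F = cube_arg U + fps_X * cube_arg V + fps_X ^ 2 * cube_arg W \<Longrightarrow> residue_part 0 F = U"
  by (auto simp: residue_part_def cube_arg_parts_nth intro!: fps_ext simp del: fps_add_nth)

text \<open>Identities of functions on the disc are transferred to power series, where one can cancel factors, and back;
this predicate is closed under all the operations involved.\<close>

definition unit_radius :: "complex fps \<Rightarrow> bool" where
  "unit_radius F \<longleftrightarrow> fps_conv_radius F \<ge> 1"

lemma unit_radius_norm_less:
  assumes "unit_radius F" "norm x < 1"
  shows "ereal (norm x) < fps_conv_radius F"
proof -
  have "ereal (norm x) < 1" using assms(2) by (simp add: one_ereal_def)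
  then show ?thesis using assms(1) unfolding unit_radius_def by (rule less_le_trans)
qed

lemma unit_radius_add: "unit_radius F \<Longrightarrow> unit_radius G \<Longrightarrow> unit_radius (F + G)"
  and unit_radius_diff: "unit_radius F \<Longrightarrow> unit_radius G \<Longrightarrow> unit_radius (F - G)"
  and unit_radius_mult: "unit_radius F \<Longrightarrow> unit_radius G \<Longrightarrow> unit_radius (F * G)"
  unfolding unit_radius_def
  by (meson fps_conv_radius_add fps_conv_radius_diff fps_conv_radius_mult min.boundedI order_trans)+

lemma unit_radius_power: "unit_radius F \<Longrightarrow> unit_radius (F ^ n)"
  unfolding unit_radius_def using fps_conv_radius_power order_trans by blast

lemma unit_radius_atoms: "unit_radius fps_X" "unit_radius (numeral k)"
  by (simp_all add: unit_radius_def)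

lemmas unit_radius_intros = unit_radius_add unit_radius_diff unit_radius_mult unit_radius_power unit_radius_atoms

lemma eval_fps_unit_radius:
  assumes "norm x < 1"
  shows "unit_radius F \<Longrightarrow> unit_radius G \<Longrightarrow> eval_fps (F + G) x = eval_fps F x + eval_fps G x"
  "unit_radius F \<Longrightarrow> unit_radius G \<Longrightarrow> eval_fps (F - G) x = eval_fps F x - eval_fps G x"
  "unit_radius F \<Longrightarrow> unit_radius G \<Longrightarrow> eval_fps (F * G) x = eval_fps F x * eval_fps G x"
  "unit_radius F \<Longrightarrow> eval_fps (F ^ n) x = eval_fps F x ^ n"
  using assms by (simp_all add: eval_fps_add eval_fps_diff eval_fps_mult eval_fps_power unit_radius_norm_less)

lemma cube_arg_sums:
  assumes F: "unit_radius F" and x: "norm x < 1"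
  shows "(\<lambda>n. fps_nth (cube_arg F) n * x ^ n) sums eval_fps F (x ^ 3)"
proof -
  have x3: "norm (x ^ 3) < 1" using x by (simp add: norm_power power_less_one_iff)
  have "(\<lambda>n. fps_nth F n * (x ^ 3) ^ n) sums eval_fps F (x ^ 3)"
    by (intro sums_eval_fps unit_radius_norm_less F x3)
  then have "(\<lambda>n. fps_nth (cube_arg F) (3 * n) * x ^ (3 * n)) sums eval_fps F (x ^ 3)"
    by (simp add: cube_arg_nth power_mult)
  also have "?this \<longleftrightarrow> ?thesis"
    by (rule sums_mono_reindex) (auto simp: cube_arg_nth strict_mono_def elim!: dvdE)
  finally show ?thesis .
qed

lemma unit_radius_cube_arg: "unit_radius F \<Longrightarrow> unit_radius (cube_arg F)"
  unfolding unit_radius_def[of "cube_arg F"]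
  by (rule fps_conv_radius_ge_1_if_summable) (metis sums_summable cube_arg_sums)

lemma eval_fps_cube_arg: "unit_radius F \<Longrightarrow> norm x < 1 \<Longrightarrow> eval_fps (cube_arg F) x = eval_fps F (x ^ 3)"
  using cube_arg_sums[of F x] by (simp add: eval_fps_def sums_iff)

lemma fps_eqI_unit_disc:
  assumes "unit_radius F" "unit_radius G" "fps_nth F 0 = fps_nth G 0"
    and eq: "\<And>x. x \<noteq> 0 \<Longrightarrow> norm x < 1 \<Longrightarrow> eval_fps F x = eval_fps G x"
  shows "F = G"
proof (rule eval_fps_eqD)
  show "fps_conv_radius F > 0" "fps_conv_radius G > 0"
    using assms(1,2) by (auto simp: unit_radius_def intro: less_le_trans[of 0 1])
  have "eventually (\<lambda>x::complex. x \<in> ball 0 1) (nhds 0)"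
    by (intro eventually_nhds_in_open) auto
  then show "eventually (\<lambda>x. eval_fps F x = eval_fps G x) (nhds 0)"
  proof eventually_elim
    case (elim x)
    then show ?case using eq[of x] assms(3) by (cases "x = 0") (auto simp: eval_fps_at_0)
  qed
qed

text \<open>Sorting exponents by their residue modulo 3, let \<open>A\<^sub>0, A\<^sub>1, A\<^sub>2\<close> be the parts of \<open>z\<^sub>2\<close>. The part 0 of
\<open>z\<^sub>3 = L z\<^sub>2\<close>, \<open>z\<^sub>4 = L\<^sup>2 z\<^sub>2\<close> and \<open>z\<^sub>5 = L\<^sup>3 z\<^sub>2 + 12 z\<^sub>2\<^sup>2\<close> is known both from the product
and from the action \<open>3\<^sup>j\<close> of extracting every third coefficient. The first two equations are linear and make \<open>A\<^sub>1\<close> and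
\<open>A\<^sub>2\<close> multiples of \<open>A\<^sub>0\<close>; with \<open>Q = X C\<^sup>3\<close>, the last one then becomes \<open>A\<^sub>0 (Q - L\<^sup>3) (Q - 3 A\<^sub>0) = 0\<close>.\<close>

lemma cubic_hecke_relations:
  fixes L C z2 z3 z4 z5 :: "complex fps"
  defines "A0 \<equiv> residue_part 0 z2" and "A1 \<equiv> residue_part 1 z2" and "A2 \<equiv> residue_part 2 z2"
  assumes L: "L = cube_arg L + 2 * fps_X * cube_arg C"
    and z3: "z3 = L * z2" and z4: "z4 = L * z3" and z5: "z5 = L * z4 + 12 * z2\<^sup>2"
    and h2: "residue_part 0 z2 = 9 * z2" and h3: "residue_part 0 z3 = 27 * z3" and h4: "residue_part 0 z4 = 81 * z4"
    and h5: "residue_part 0 z5 = 243 * z5"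
    and nz: "z2 \<noteq> 0" "C \<noteq> 0" "fps_nth L 0 \<noteq> 0"
  shows "27 * z2 = fps_X * C ^ 3" and "3 * A1 = L\<^sup>2 * C" and "3 * A2 = L * C\<^sup>2"
proof -
  define X :: "complex fps" where "X = fps_X"
  have z2: "z2 = cube_arg A0 + X * cube_arg A1 + X ^ 2 * cube_arg A2" unfolding A0_def A1_def A2_def X_def by (rule residue_parts)
  have tX: "cube_arg X = X ^ 3" by (simp add: X_def cube_arg_X)
  note ts = cube_arg_add cube_arg_mult cube_arg_power cube_arg_numeral tX
  have L': "L = cube_arg L + 2 * X * cube_arg C" using L by (simp add: X_def)
  define t tc t0 t1 t2 where "t = cube_arg L" and "tc = cube_arg C" and "t0 = cube_arg A0" and "t1 = cube_arg A1" and "t2 = cube_arg A2"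
  note tdefs = t_def[symmetric] tc_def[symmetric] t0_def[symmetric] t1_def[symmetric] t2_def[symmetric]
  have Lt: "L = t + 2 * X * tc" using L' by (simp add: tdefs)
  have zt: "z2 = t0 + X * t1 + X\<^sup>2 * t2" using z2 by (simp add: tdefs)
  have p3: "27 * z3 = L * A0 + 2 * X * C * A2"
  proof -
    have "z3 = cube_arg (L * A0 + 2 * X * C * A2) + X * cube_arg (L * A1 + 2 * C * A0) + X ^ 2 * cube_arg (L * A2 + 2 * C * A1)"
      unfolding ts tdefs unfolding z3 unfolding Lt zt by (simp add: eval_nat_numeral algebra_simps)
    from residue_part_0_eqI[OF this[unfolded X_def]] show ?thesis using h3 by (simp add: X_def)
  qed
  have p4: "81 * z4 = L\<^sup>2 * A0 + 4 * X * L * C * A2 + 4 * X * C\<^sup>2 * A1"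
  proof -
    have "z4 = cube_arg (L\<^sup>2 * A0 + 4 * X * L * C * A2 + 4 * X * C\<^sup>2 * A1)
       + X * cube_arg (L\<^sup>2 * A1 + 4 * L * C * A0 + 4 * X * C\<^sup>2 * A2)
       + X ^ 2 * cube_arg (L\<^sup>2 * A2 + 4 * L * C * A1 + 4 * C\<^sup>2 * A0)"
      unfolding ts tdefs unfolding z4 z3 unfolding Lt zt by (simp add: eval_nat_numeral algebra_simps)
    from residue_part_0_eqI[OF this[unfolded X_def]] show ?thesis using h4 by (simp add: X_def)
  qed
  have p5: "243 * z5 = (L ^ 3 + 8 * X * C ^ 3) * A0 + 6 * X * L\<^sup>2 * C * A2 + 12 * X * L * C\<^sup>2 * A1
       + 12 * (A0\<^sup>2 + 2 * X * A1 * A2)"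
  proof -
    have "z5 = cube_arg ((L ^ 3 + 8 * X * C ^ 3) * A0 + 6 * X * L\<^sup>2 * C * A2 + 12 * X * L * C\<^sup>2 * A1
       + 12 * (A0\<^sup>2 + 2 * X * A1 * A2))
       + X * cube_arg ((L ^ 3 + 8 * X * C ^ 3) * A1 + 6 * L\<^sup>2 * C * A0 + 12 * X * L * C\<^sup>2 * A2
       + 12 * (2 * A0 * A1 + X * A2\<^sup>2))
       + X ^ 2 * cube_arg ((L ^ 3 + 8 * X * C ^ 3) * A2 + 6 * L\<^sup>2 * C * A1 + 12 * L * C\<^sup>2 * A0
       + 12 * (A1\<^sup>2 + 2 * A0 * A2))"
      unfolding ts tdefs unfolding z5 z4 z3 unfolding Lt zt by (simp add: eval_nat_numeral algebra_simps)
    from residue_part_0_eqI[OF this[unfolded X_def]] show ?thesis using h5 by (simp add: X_def)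
  qed
  have A0: "A0 = 9 * z2" using h2 by (simp add: A0_def)
  have "X \<noteq> 0" by (simp add: X_def)
  have "L \<noteq> 0" using nz(3) by auto
  have e2: "X * C * A2 = L * A0"
  proof -
    have "2 * (X * C * A2) = 2 * (L * A0)" using p3 by (simp add: z3 A0 algebra_simps)
    then show ?thesis by simp
  qed
  have e1: "X * C\<^sup>2 * A1 = L\<^sup>2 * A0"
  proof -
    have "81 * z4 = 9 * (L\<^sup>2 * A0)" by (simp add: z3 z4 A0 power2_eq_square)
    moreover have "4 * X * L * C * A2 = 4 * (L\<^sup>2 * A0)"
      using arg_cong[OF e2, of "\<lambda>u. 4 * L * u"] by (simp add: power2_eq_square mult_ac)
    moreover have "4 * (X * C\<^sup>2 * A1) = 81 * z4 - L\<^sup>2 * A0 - 4 * X * L * C * A2"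
      using p4 by (simp add: mult.assoc)
    ultimately have "4 * (X * C\<^sup>2 * A1) = 9 * (L\<^sup>2 * A0) - L\<^sup>2 * A0 - 4 * (L\<^sup>2 * A0)" by (simp only:)
    also have "\<dots> = 4 * (L\<^sup>2 * A0)" by simp
    finally have "4 * (X * C\<^sup>2 * A1) = 4 * (L\<^sup>2 * A0)" .
    then show ?thesis by simp
  qed
  \<comment> \<open>\<open>Q = c\<^sup>3\<close> in terms of the theta function \<open>c\<close> that \<open>C\<close> will turn out to be.\<close>
  define Q where "Q = X * C ^ 3"
  have q1: "6 * X * L\<^sup>2 * C * A2 = 6 * L ^ 3 * A0"
    using arg_cong[OF e2, of "\<lambda>u. 6 * L\<^sup>2 * u"] by (simp add: power2_eq_square power3_eq_cube mult_ac)
  have q2: "12 * X * L * C\<^sup>2 * A1 = 12 * L ^ 3 * A0"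
    using arg_cong[OF e1, of "\<lambda>u. 12 * L * u"] by (simp add: power2_eq_square power3_eq_cube mult_ac)
  have q3: "Q * (X * A1 * A2) = L ^ 3 * A0\<^sup>2"
  proof -
    have "Q * (X * A1 * A2) = (X * C\<^sup>2 * A1) * (X * C * A2)"
      by (simp add: Q_def power2_eq_square power3_eq_cube mult_ac)
    then show ?thesis unfolding e1 e2 by (simp add: power2_eq_square power3_eq_cube mult_ac)
  qed
  have h: "27 * L ^ 3 * A0 + 36 * A0\<^sup>2 = (L ^ 3 + 8 * Q) * A0 + 6 * L ^ 3 * A0 + 12 * L ^ 3 * A0
       + 12 * (A0\<^sup>2 + 2 * X * A1 * A2)"
  proof -
    have "243 * z5 = 27 * L ^ 3 * A0 + 36 * A0\<^sup>2"
      by (simp add: z5 z4 z3 A0 power2_eq_square power3_eq_cube algebra_simps)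
    then show ?thesis using p5 q1 q2 by (simp add: Q_def mult.assoc)
  qed
  have "A0 * (8 * ((Q - L ^ 3) * (Q - 3 * A0))) = 0"
  proof -
    have "Q * (27 * L ^ 3 * A0 + 36 * A0\<^sup>2) = Q * ((L ^ 3 + 8 * Q) * A0 + 6 * L ^ 3 * A0 + 12 * L ^ 3 * A0
       + 12 * A0\<^sup>2) + 24 * (Q * (X * A1 * A2))"
      unfolding h by (simp add: algebra_simps)
    then show ?thesis unfolding q3 by (simp add: power2_eq_square algebra_simps)
  qed
  moreover have "A0 \<noteq> 0" using nz A0 by simp
  moreover have "Q - L ^ 3 \<noteq> 0"
  proof
    assume "Q - L ^ 3 = 0"
    then have "fps_nth (Q - L ^ 3) 0 = 0" by simp
    then show False using nz by (simp add: Q_def X_def)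
  qed
  ultimately have QA: "Q = 3 * A0" by simp
  then show "27 * z2 = fps_X * C ^ 3" by (simp add: A0 Q_def X_def)
  have "X * C\<^sup>2 * (3 * A1) = X * C\<^sup>2 * (L\<^sup>2 * C)"
  proof -
    have "X * C\<^sup>2 * (3 * A1) = L\<^sup>2 * (3 * A0)" using e1 by (simp add: algebra_simps)
    then show ?thesis unfolding QA[symmetric] Q_def by (simp add: power2_eq_square power3_eq_cube mult_ac)
  qed
  then show "3 * A1 = L\<^sup>2 * C" using nz \<open>X \<noteq> 0\<close> by simp
  have "X * C * (3 * A2) = X * C * (L * C\<^sup>2)"
  proof -
    have "X * C * (3 * A2) = L * (3 * A0)" using e2 by (simp add: algebra_simps)
    then show ?thesis unfolding QA[symmetric] Q_def by (simp add: power2_eq_square power3_eq_cube mult_ac)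
  qed
  then show "3 * A2 = L * C\<^sup>2" using nz \<open>X \<noteq> 0\<close> by simp
qed

definition agree :: "nat \<Rightarrow> complex fps \<Rightarrow> complex fps \<Rightarrow> bool" where
  "agree n F G \<longleftrightarrow> (\<forall>i\<le>n. fps_nth F i = fps_nth G i)"

lemma agree_intros:
  "agree n F F"
  "agree n F G \<Longrightarrow> agree n F' G' \<Longrightarrow> agree n (F + F') (G + G')"
  "agree n F G \<Longrightarrow> agree n F' G' \<Longrightarrow> agree n (F * F') (G * G')"
  by (auto simp: agree_def fps_mult_nth intro!: sum.cong)

lemma agree_cube_arg: "n > 0 \<Longrightarrow> (\<And>i. i < n \<Longrightarrow> fps_nth F i = fps_nth G i) \<Longrightarrow> agree n (cube_arg F) (cube_arg G)"
  by (auto simp: agree_def cube_arg_nth)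

text \<open>The right-hand sides contain the unknowns at the argument \<open>x\<^sup>3\<close> only, so for \<open>n > 0\<close> their coefficients up to \<open>n\<close> depend on
coefficients with smaller index. On the left, the coefficient \<open>C\<^sub>n\<close> enters \<open>C\<^sup>3\<close> with the factor
\<open>3 C\<^sub>0\<^sup>2 = 27\<close>.\<close>

lemma cubic_system_unique:
  fixes a C a' C' :: "complex fps"
  assumes a: "a = cube_arg a + 2 * fps_X * cube_arg C" "a' = cube_arg a' + 2 * fps_X * cube_arg C'"
    and C: "C ^ 3 = 9 * cube_arg C * (cube_arg a * cube_arg a + fps_X * cube_arg a * cube_arg C + fps_X * fps_X * cube_arg C * cube_arg C)"
       "C' ^ 3 = 9 * cube_arg C' * (cube_arg a' * cube_arg a' + fps_X * cube_arg a' * cube_arg C' + fps_X * fps_X * cube_arg C' * cube_arg C')"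
    and 0: "fps_nth a 0 = 1" "fps_nth a' 0 = 1" "fps_nth C 0 = 3" "fps_nth C' 0 = 3"
  shows "a = a' \<and> C = C'"
proof -
  have "fps_nth a n = fps_nth a' n \<and> fps_nth C n = fps_nth C' n" for n
  proof (induction n rule: less_induct)
    case (less n)
    show ?case
    proof (cases "n = 0")
      case False
      have t: "agree n (cube_arg a) (cube_arg a')" "agree n (cube_arg C) (cube_arg C')"
        using False less by (auto intro!: agree_cube_arg)
      have "agree n a a'" by (subst a(1), subst a(2)) (intro agree_intros t)
      then have an: "fps_nth a n = fps_nth a' n" by (simp add: agree_def)
      have "agree n (C ^ 3) (C' ^ 3)" unfolding C by (intro agree_intros t)
      then have "fps_nth (C ^ 3 - C' ^ 3) n = 0" by (simp add: agree_def)
      also have "C ^ 3 - C' ^ 3 = (C - C') * (C * C + C * C' + C' * C')"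
        by (simp add: power3_eq_cube algebra_simps)
      also have "fps_nth \<dots> n = (\<Sum>i=0..n. fps_nth (C - C') i * fps_nth (C * C + C * C' + C' * C') (n - i))"
        by (rule fps_mult_nth)
      also have "\<dots> = (\<Sum>i\<in>{n}. fps_nth (C - C') i * fps_nth (C * C + C * C' + C' * C') (n - i))"
        using less by (intro sum.mono_neutral_right) auto
      also have "\<dots> = (fps_nth C n - fps_nth C' n) * 27" using 0 by simp
      finally show ?thesis using an by simp
    qed (use 0 in auto)
  qed
  then show ?thesis by (auto simp: fps_eq_iff)
qed

section \<open>Lambert series equal theta series\<close>

lemma chi_values: "3 dvd m \<Longrightarrow> chi j m = 0" "m mod 3 = 1 \<Longrightarrow> chi j m = 1" "m mod 3 = 2 \<Longrightarrow> chi j m = (- 1) ^ Suc j"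
  by (auto simp: chi_def dvd_eq_mod_eq_0)

text \<open>A divisor \<open>d\<close> of \<open>3N\<close> contributes only if \<open>3N/d\<close> is prime to 3, and then \<open>d\<close> is three times a divisor of \<open>N\<close>.\<close>

lemma eisenstein_fps_nth_3: "fps_nth (eisenstein_fps j) (3 * N) = 3 ^ j * fps_nth (eisenstein_fps j) N"
proof (cases "N = 0")
  case False
  have "fps_nth (eisenstein_fps j) (3 * N) = (\<Sum>d | d dvd 3 * N. of_nat d ^ j * chi j (3 * N div d))"
    using False by (simp add: eisenstein_fps_nth)
  also have "\<dots> = (\<Sum>d \<in> (\<lambda>d. 3 * d) ` {d. d dvd N}. of_nat d ^ j * chi j (3 * N div d))"
  proof (rule sum.mono_neutral_right)
    show "\<forall>d \<in> {d. d dvd 3 * N} - (\<lambda>d. 3 * d) ` {d. d dvd N}. of_nat d ^ j * chi j (3 * N div d) = 0"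
    proof
      fix d assume d: "d \<in> {d. d dvd 3 * N} - (\<lambda>d. 3 * d) ` {d. d dvd N}"
      then obtain e where e: "3 * N = d * e" by (auto elim: dvdE)
      have "d > 0" using e False by (intro Nat.gr0I) auto
      have "3 dvd e"
      proof (rule ccontr)
        assume "\<not> 3 dvd e"
        moreover have "prime (3::nat)" by simp
        ultimately have "3 dvd d" using e by (metis dvd_triv_left prime_dvd_mult_iff)
        then obtain d' where "d = 3 * d'" by (auto elim: dvdE)
        then show False using d e by auto
      qed
      then show "of_nat d ^ j * chi j (3 * N div d) = 0"
        using e \<open>d > 0\<close> by (simp add: chi_values)
    qed
  qed (use False in auto)
  also have "\<dots> = (\<Sum>d | d dvd N. of_nat (3 * d) ^ j * chi j (3 * N div (3 * d)))"
    by (subst sum.reindex) (auto simp: inj_on_def)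
  also have "\<dots> = 3 ^ j * fps_nth (eisenstein_fps j) N"
    using False by (simp add: eisenstein_fps_nth sum_distrib_left power_mult_distrib mult_ac)
  finally show ?thesis .
qed (simp add: eisenstein_fps_nth_0)

lemma residue_part_0_eisenstein_fps: "residue_part 0 (eisenstein_fps j) = 3 ^ j * eisenstein_fps j"
  by (rule fps_ext) (simp add: residue_part_def eisenstein_fps_nth_3 numeral_fps_const)

lemma mult_mod_3_eq_2:
  assumes "(d * e) mod 3 = (2::nat)"
  shows "d mod 3 = 1 \<and> e mod 3 = 2 \<or> d mod 3 = 2 \<and> e mod 3 = 1"
proof -
  have "(d mod 3) * (e mod 3) mod 3 = 2" using assms by (simp add: mod_mult_eq)
  moreover have "d mod 3 \<in> {0, 1, 2}" "e mod 3 \<in> {0, 1, 2}" by auto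
  ultimately show ?thesis by auto
qed

text \<open>If \<open>N \<equiv> 2\<close> modulo 3, the two members of a pair of complementary divisors have opposite quadratic characters.\<close>

lemma residue_part_2_eisenstein_fps_0: "residue_part 2 (eisenstein_fps 0) = 0"
proof (rule fps_ext)
  fix n :: nat
  define N where "N = 3 * n + 2"
  have N: "N > 0" "N mod 3 = 2" unfolding N_def by presburger+
  have "(\<Sum>d | d dvd N. chi 0 (N div d)) = (\<Sum>d | d dvd N. chi 0 d)"
    by (rule sum.reindex_bij_witness[of _ "\<lambda>d. N div d" "\<lambda>d. N div d"])
       (use N in \<open>auto elim!: dvdE\<close>)
  also have "\<dots> = (\<Sum>d | d dvd N. - chi 0 (N div d))"
  proof (rule sum.cong)
    fix d assume "d \<in> {d. d dvd N}"
    then obtain e where e: "N = d * e" by (auto elim: dvdE)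
    then show "chi 0 d = - chi 0 (N div d)"
      using mult_mod_3_eq_2[of d e] N by (auto simp: chi_values)
  qed simp
  finally have "(\<Sum>d | d dvd N. chi 0 (N div d)) = 0" by (simp add: sum_negf)
  moreover have "fps_nth (residue_part 2 (eisenstein_fps 0)) n = fps_nth (eisenstein_fps 0) N" by (simp add: residue_part_def N_def)
  ultimately show "fps_nth (residue_part 2 (eisenstein_fps 0)) n = fps_nth 0 n" using N by (simp add: eisenstein_fps_nth)
qed

lemma eisenstein_fps_nth_1: "fps_nth (eisenstein_fps j) 1 = 1"
  by (simp add: eisenstein_fps_nth chi_values)

lemma unit_radius_eisenstein_fps: "unit_radius (eisenstein_fps j)"
  using eisenstein_fps_radius by (simp add: unit_radius_def)

lemma unit_radius_theta: "unit_radius theta_a" "unit_radius theta_c"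
  using theta_a_radius theta_c_radius by (simp_all add: unit_radius_def)

lemma eisenstein_fps_recurrences:
  "eisenstein_fps 3 = 6 * eisenstein_fps 0 * eisenstein_fps 2" "eisenstein_fps 4 = 6 * eisenstein_fps 0 * eisenstein_fps 3" "eisenstein_fps 5 = 6 * eisenstein_fps 0 * eisenstein_fps 4 + 12 * (eisenstein_fps 2)\<^sup>2"
proof -
  note ev = eval_fps_unit_radius unit_radius_intros unit_radius_eisenstein_fps
  show "eisenstein_fps 3 = 6 * eisenstein_fps 0 * eisenstein_fps 2"
  proof (rule fps_eqI_unit_disc)
    fix x :: complex assume "x \<noteq> 0" "norm x < 1"
    then interpret punctured_disc x by unfold_locales
    show "eval_fps (eisenstein_fps 3) x = eval_fps (6 * eisenstein_fps 0 * eisenstein_fps 2) x"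
      using eisenstein_recurrence[of 1] by (simp add: ev x1 eval_eisenstein_fps numeral_eq_Suc)
  qed (auto intro!: ev simp: eisenstein_fps_nth_0)
  show "eisenstein_fps 4 = 6 * eisenstein_fps 0 * eisenstein_fps 3"
  proof (rule fps_eqI_unit_disc)
    fix x :: complex assume "x \<noteq> 0" "norm x < 1"
    then interpret punctured_disc x by unfold_locales
    have "{1..<2} = {1::nat}" by auto
    then show "eval_fps (eisenstein_fps 4) x = eval_fps (6 * eisenstein_fps 0 * eisenstein_fps 3) x"
      using eisenstein_recurrence[of 2] by (simp add: ev x1 eval_eisenstein_fps)
  qed (auto intro!: ev simp: eisenstein_fps_nth_0)
  show "eisenstein_fps 5 = 6 * eisenstein_fps 0 * eisenstein_fps 4 + 12 * (eisenstein_fps 2)\<^sup>2"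
  proof (rule fps_eqI_unit_disc)
    fix x :: complex assume "x \<noteq> 0" "norm x < 1"
    then interpret punctured_disc x by unfold_locales
    have "{1..<3} = {1, 2::nat}" by auto
    moreover have "3 choose 2 = (3::nat)" by (simp add: numeral_eq_Suc)
    ultimately show "eval_fps (eisenstein_fps 5) x = eval_fps (6 * eisenstein_fps 0 * eisenstein_fps 4 + 12 * (eisenstein_fps 2)\<^sup>2) x"
      using eisenstein_recurrence[of 3] by (simp add: ev x1 eval_eisenstein_fps power2_eq_square)
  qed (auto intro!: ev simp: eisenstein_fps_nth_0)
qed

lemma theta_trisection_fps: "theta_a = cube_arg theta_a + 2 * fps_X * cube_arg theta_c"
  and theta_cubes_fps: "theta_a ^ 3 = (cube_arg theta_a - fps_X * cube_arg theta_c) ^ 3 + fps_X * theta_c ^ 3"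
proof -
  note ev = eval_fps_unit_radius unit_radius_intros unit_radius_theta unit_radius_cube_arg eval_fps_cube_arg
  have 0: "fps_nth (cube_arg F) 0 = fps_nth F 0" for F by (simp add: cube_arg_nth)
  show "theta_a = cube_arg theta_a + 2 * fps_X * cube_arg theta_c"
    by (rule fps_eqI_unit_disc) (auto intro!: ev simp: ev theta_a_cubes(1) 0)
  show "theta_a ^ 3 = (cube_arg theta_a - fps_X * cube_arg theta_c) ^ 3 + fps_X * theta_c ^ 3"
    by (rule fps_eqI_unit_disc) (auto intro!: ev simp: ev theta_a_cubes(2) 0 fps_nth_power_0)
qed

lemma theta_nth_0: "fps_nth theta_a 0 = 1" "fps_nth theta_c 0 = 3"
proof -
  have "{p \<in> UNIV. (\<lambda>(m, n). nat (norm_form m n)) p = 0} = {(0, 0)}"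
  proof -
    have "m = 0 \<and> n = 0" if "nat (norm_form m n) = 0" for m n
    proof -
      have "2 * norm_form m n = (m + n)^2 + m^2 + n^2" by (simp add: norm_form_def power2_eq_square algebra_simps)
      moreover have "norm_form m n = 0" using that norm_form_nonneg[of m n] by simp
      moreover have "(m + n)^2 \<ge> 0" "m^2 \<ge> 0" "n^2 \<ge> 0" by simp_all
      ultimately have "m^2 = 0" "n^2 = 0" by linarith+
      then show ?thesis by simp
    qed
    then show ?thesis by (auto simp: norm_form_def)
  qed
  then show "fps_nth theta_a 0 = 1" by (simp add: theta_a_def graded_series_def)
  have "{p \<in> UNIV. (\<lambda>(m, n). nat (shifted_norm_form m n)) p = 0} = {(0, 0), (0, -1), (-1, 0)}"
  proof -
    have *: "m = 0 \<or> m = -1" if "m * (m + 1) = 0" for m :: int using that by auto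
    have "(m, n) \<in> {(0, 0), (0, -1), (-1, 0)}" if "nat (shifted_norm_form m n) = 0" for m n
    proof -
      have "2 * shifted_norm_form m n = (m + n) * (m + n + 1) + m * (m + 1) + n * (n + 1)"
        by (simp add: shifted_norm_form_def power2_eq_square algebra_simps)
      moreover have "shifted_norm_form m n = 0" using that shifted_norm_form_nonneg[of m n] by simp
      ultimately have "m * (m + 1) = 0" "n * (n + 1) = 0" "(m + n) * (m + n + 1) = 0"
        using consecutive_product_nonneg[of m] consecutive_product_nonneg[of n] consecutive_product_nonneg[of "m + n"]
        by linarith+
      then show ?thesis using *[of m] *[of n] *[of "m + n"] by auto
    qed
    then have "{p \<in> UNIV. (\<lambda>(m, n). nat (shifted_norm_form m n)) p = 0} \<subseteq> {(0, 0), (0, -1), (-1, 0)}" by fastforce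
    moreover have "{(0, 0), (0, -1), (-1, 0)} \<subseteq> {p \<in> UNIV. (\<lambda>(m, n). nat (shifted_norm_form m n)) p = 0}"
      by (simp add: shifted_norm_form_def)
    ultimately show ?thesis by (rule equalityI)
  qed
  then show "fps_nth theta_c 0 = 3" by (simp add: theta_c_def graded_series_def)
qed

text \<open>With \<open>L = 6 E\<^sub>0\<close> and \<open>C\<close> half of its part in residue class 1, the pair \<open>(L, C)\<close> solves the same cubic system as the pair of
theta series.\<close>

theorem lambert_series_eq_theta:
  "6 * eisenstein_fps 0 = theta_a" "27 * eisenstein_fps 2 = fps_X * theta_c ^ 3"
proof -
  define L where "L = 6 * eisenstein_fps 0"
  define C where "C = fps_const (1 / 2) * residue_part 1 L"
  have half: "2 * (fps_const (1 / 2) * F) = F" for F :: "complex fps"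
    by (rule fps_ext) (simp flip: numeral_fps_const)
  have p: "residue_part r (6 * F) = 6 * residue_part r F" for r F
    by (rule fps_ext) (simp add: residue_part_def flip: numeral_fps_const)
  have L: "L = cube_arg L + 2 * fps_X * cube_arg C"
  proof -
    have "residue_part 0 L = L" "residue_part 2 L = 0" by (simp_all add: L_def p residue_part_0_eisenstein_fps residue_part_2_eisenstein_fps_0)
    then have "L = cube_arg L + fps_X * cube_arg (residue_part 1 L)" using residue_parts[of L] by (simp add: cube_arg_def)
    moreover have "residue_part 1 L = 2 * C" by (simp add: C_def half)
    ultimately show ?thesis by (simp add: cube_arg_simps mult_ac)
  qed
  have L0: "fps_nth L 0 = 1" by (simp add: L_def eisenstein_fps_nth_0 flip: numeral_fps_const)
  have C0: "fps_nth C 0 = 3"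
    using eisenstein_fps_nth_1[of 0] by (simp add: C_def L_def residue_part_def flip: numeral_fps_const)
  have r: "eisenstein_fps 3 = L * eisenstein_fps 2" "eisenstein_fps 4 = L * eisenstein_fps 3" "eisenstein_fps 5 = L * eisenstein_fps 4 + 12 * (eisenstein_fps 2)\<^sup>2"
    by (simp_all only: eisenstein_fps_recurrences(1) eisenstein_fps_recurrences(2) eisenstein_fps_recurrences(3) L_def)
  have p0: "residue_part 0 (eisenstein_fps 2) = 9 * eisenstein_fps 2" "residue_part 0 (eisenstein_fps 3) = 27 * eisenstein_fps 3" "residue_part 0 (eisenstein_fps 4) = 81 * eisenstein_fps 4" "residue_part 0 (eisenstein_fps 5) = 243 * eisenstein_fps 5"
    by (simp_all add: residue_part_0_eisenstein_fps)
  have nz: "eisenstein_fps 2 \<noteq> 0" "C \<noteq> 0" "fps_nth L 0 \<noteq> 0"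
    using eisenstein_fps_nth_1[of 2] C0 L0 by auto
  note h = cubic_hecke_relations[OF L r p0 nz]
  have "27 * eisenstein_fps 2 = 27 * (cube_arg (9 * eisenstein_fps 2) + fps_X * cube_arg (residue_part 1 (eisenstein_fps 2)) + fps_X ^ 2 * cube_arg (residue_part 2 (eisenstein_fps 2)))"
    using arg_cong[OF residue_parts[of "eisenstein_fps 2", unfolded p0(1)], of "\<lambda>u. 27 * u"] .
  also have "\<dots> = 9 * cube_arg (27 * eisenstein_fps 2) + 9 * fps_X * cube_arg (3 * residue_part 1 (eisenstein_fps 2)) + 9 * fps_X ^ 2 * cube_arg (3 * residue_part 2 (eisenstein_fps 2))"
    by (simp add: cube_arg_simps algebra_simps)
  finally have "27 * eisenstein_fps 2 = 9 * cube_arg (27 * eisenstein_fps 2) + 9 * fps_X * cube_arg (3 * residue_part 1 (eisenstein_fps 2)) + 9 * fps_X ^ 2 * cube_arg (3 * residue_part 2 (eisenstein_fps 2))" .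
  then have "fps_X * C ^ 3 = 9 * cube_arg (fps_X * C ^ 3) + 9 * fps_X * cube_arg (L\<^sup>2 * C) + 9 * fps_X ^ 2 * cube_arg (L * C\<^sup>2)"
    by (simp only: h)
  also have "\<dots> = fps_X * (9 * cube_arg C * (cube_arg L * cube_arg L + fps_X * cube_arg L * cube_arg C + fps_X * fps_X * cube_arg C * cube_arg C))"
    by (simp add: cube_arg_simps eval_nat_numeral algebra_simps)
  finally have C3: "C ^ 3 = 9 * cube_arg C * (cube_arg L * cube_arg L + fps_X * cube_arg L * cube_arg C + fps_X * fps_X * cube_arg C * cube_arg C)"
    by simp
  have "fps_X * theta_c ^ 3 = theta_a ^ 3 - (cube_arg theta_a - fps_X * cube_arg theta_c) ^ 3"
    by (simp add: theta_cubes_fps)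
  also have "\<dots> = (cube_arg theta_a + 2 * fps_X * cube_arg theta_c) ^ 3 - (cube_arg theta_a - fps_X * cube_arg theta_c) ^ 3"
    using theta_trisection_fps by simp
  also have "\<dots> = fps_X * (9 * cube_arg theta_c * (cube_arg theta_a * cube_arg theta_a + fps_X * cube_arg theta_a * cube_arg theta_c + fps_X * fps_X * cube_arg theta_c * cube_arg theta_c))"
    by (simp add: eval_nat_numeral algebra_simps)
  finally have "theta_c ^ 3 = 9 * cube_arg theta_c * (cube_arg theta_a * cube_arg theta_a + fps_X * cube_arg theta_a * cube_arg theta_c + fps_X * fps_X * cube_arg theta_c * cube_arg theta_c)"
    by simp
  from cubic_system_unique[OF L theta_trisection_fps C3 this L0 theta_nth_0(1) C0 theta_nth_0(2)]
  have "L = theta_a" "C = theta_c" by auto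
  then show "6 * eisenstein_fps 0 = theta_a" "27 * eisenstein_fps 2 = fps_X * theta_c ^ 3" using h(1) by (simp_all add: L_def)
qed

context punctured_disc
begin

lemma eisenstein_0_2_eq_theta:
  defines "A \<equiv> eval_fps theta_a (x ^ 3)" and "B \<equiv> x * eval_fps theta_c (x ^ 3)"
  shows "eisenstein 0 x = (A + 2 * B) / 6" "eisenstein 2 x = (A\<^sup>2 * B + A * B\<^sup>2 + B ^ 3) / 3"
proof -
  note ev = eval_fps_unit_radius unit_radius_intros unit_radius_theta unit_radius_eisenstein_fps
  have "6 * eisenstein 0 x = eval_fps theta_a x"
    by (simp add: ev x1 eval_eisenstein_fps flip: lambert_series_eq_theta(1))
  also have a: "\<dots> = A + 2 * B" using theta_a_cubes(1)[OF x1] by (simp add: A_def B_def)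
  finally show "eisenstein 0 x = (A + 2 * B) / 6" by (simp add: field_simps)
  have "27 * eisenstein 2 x = eval_fps (27 * eisenstein_fps 2) x"
    by (simp add: ev x1 eval_eisenstein_fps)
  also have "\<dots> = x * eval_fps theta_c x ^ 3"
    by (simp add: ev x1 lambert_series_eq_theta(2))
  also have "\<dots> = (A + 2 * B) ^ 3 - (A - B) ^ 3"
    using theta_a_cubes(2)[OF x1] a by (simp add: A_def B_def)
  also have "\<dots> = 9 * (A\<^sup>2 * B + A * B\<^sup>2 + B ^ 3)"
    by (simp add: eval_nat_numeral algebra_simps)
  finally have "9 * (3 * eisenstein 2 x) = 9 * (A\<^sup>2 * B + A * B\<^sup>2 + B ^ 3)" by simp
  then have "3 * eisenstein 2 x = A\<^sup>2 * B + A * B\<^sup>2 + B ^ 3" by (simp only: mult_cancel_left) simp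
  then show "eisenstein 2 x = (A\<^sup>2 * B + A * B\<^sup>2 + B ^ 3) / 3" by (simp add: field_simps)
qed

end

section \<open>Rational binary forms\<close>

text \<open>Homogeneous polynomial functions of degree \<open>N\<close> in two variables with rational coefficients, generated
monomial by monomial.\<close>

inductive rat_form :: "nat \<Rightarrow> (complex \<Rightarrow> complex \<Rightarrow> complex) \<Rightarrow> bool" where
  zero: "rat_form N (\<lambda>u v. 0)"
| add_monomial: "i + j = N \<Longrightarrow> rat_form N g \<Longrightarrow> rat_form N (\<lambda>u v. of_rat q * u ^ i * v ^ j + g u v)"

lemma rat_form_monomial: "i + j = N \<Longrightarrow> rat_form N (\<lambda>u v. of_rat q * u ^ i * v ^ j)"
  using rat_form.add_monomial[OF _ rat_form.zero] by simp

lemma rat_form_add: "rat_form N g \<Longrightarrow> rat_form N h \<Longrightarrow> rat_form N (\<lambda>u v. g u v + h u v)"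
  by (induction rule: rat_form.induct) (auto simp: add.assoc intro: rat_form.add_monomial)

lemma rat_form_monomial_mult:
  assumes "rat_form N g"
  shows "rat_form (i + j + N) (\<lambda>u v. of_rat q * u ^ i * v ^ j * g u v)"
  using assms
proof (induction rule: rat_form.induct)
  case (zero N)
  then show ?case by (simp add: rat_form.zero)
next
  case (add_monomial i' j' N g r)
  have "rat_form (i + j + N) (\<lambda>u v. of_rat (q * r) * u ^ (i + i') * v ^ (j + j') + of_rat q * u ^ i * v ^ j * g u v)"
    using add_monomial by (intro rat_form.add_monomial) auto
  then show ?case by (simp add: of_rat_mult power_add algebra_simps)
qed

lemma rat_form_mult:
  assumes "rat_form N g" "rat_form M h"
  shows "rat_form (N + M) (\<lambda>u v. g u v * h u v)"
  using assms(1)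
proof (induction rule: rat_form.induct)
  case (zero N)
  then show ?case by (simp add: rat_form.zero)
next
  case (add_monomial i j N g q)
  show ?case
    using rat_form_add[OF rat_form_monomial_mult[OF assms(2), of i j q] ] add_monomial
    by (simp add: distrib_right)
qed

lemma rat_form_scale: "rat_form N g \<Longrightarrow> rat_form N (\<lambda>u v. of_rat q * g u v)"
  using rat_form_monomial_mult[of N g 0 0 q] by simp

lemma rat_form_power: "rat_form N g \<Longrightarrow> rat_form (k * N) (\<lambda>u v. g u v ^ k)"
proof (induction k)
  case 0
  then show ?case using rat_form_monomial[of 0 0 0 1] by simp
next
  case (Suc k)
  then show ?case using rat_form_mult[of N g "k * N" "\<lambda>u v. g u v ^ k"] by simp
qed

lemma rat_form_sum:
  assumes "finite I" "\<And>i. i \<in> I \<Longrightarrow> rat_form N (g i)"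
  shows "rat_form N (\<lambda>u v. \<Sum>i\<in>I. g i u v)"
  using assms by (induction I rule: finite_induct) (auto intro: rat_form.zero rat_form_add)

lemma eval2_add: "eval2 (P + Q) x y = eval2 P x y + eval2 Q x y"
proof -
  have 1: "map_poly of_rat (p + q) = (map_poly of_rat p + map_poly of_rat q :: complex poly)" for p q :: "rat poly"
    by (rule poly_eqI) (simp add: coeff_map_poly of_rat_add)
  have "map_poly (\<lambda>p. poly (map_poly of_rat p) x) (P + Q)
      = map_poly (\<lambda>p. poly (map_poly of_rat p) x) P + map_poly (\<lambda>p. poly (map_poly of_rat p) x) Q"
    by (rule poly_eqI) (simp add: coeff_map_poly 1)
  then show ?thesis by (simp add: eval2_def)
qed

lemma eval2_monomial: "eval2 (Polynomial.monom (Polynomial.monom q i) j) x y = of_rat q * x ^ i * y ^ j"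
  by (simp add: eval2_def map_poly_monom poly_monom)

lemma rat_form_imp_polynomial:
  assumes "rat_form N g"
  shows "\<exists>P. homogeneous2 N P \<and> (\<forall>u v. eval2 P u v = g u v)"
  using assms
proof (induction rule: rat_form.induct)
  case (zero N)
  have "homogeneous2 N 0 \<and> (\<forall>u v. eval2 0 u v = 0)" by (simp add: homogeneous2_def eval2_def)
  then show ?case by blast
next
  case (add_monomial i j N g q)
  then obtain P where "homogeneous2 N P" "\<forall>u v. eval2 P u v = g u v" by blast
  then have "homogeneous2 N (Polynomial.monom (Polynomial.monom q i) j + P) \<and>
      (\<forall>u v. eval2 (Polynomial.monom (Polynomial.monom q i) j + P) u v = of_rat q * u ^ i * v ^ j + g u v)"
    using add_monomial(1) by (auto simp: homogeneous2_def eval2_add eval2_monomial split: if_splits)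
  then show ?case by blast
qed

lemma omega_power_sum: "1 + omega ^ m + omega ^ (2 * m) = (if 3 dvd m then 3 else 0)"
proof -
  have red: "omega ^ (3 * n + r) = omega ^ r" for n r
    by (simp add: power_add power_mult omega_cube)
  define n where "n = m div 3"
  have "m mod 3 < 3" by simp
  then have "m mod 3 = 0 \<or> m mod 3 = 1 \<or> m mod 3 = 2" by linarith
  moreover have "m = 3 * n + m mod 3" by (simp add: n_def)
  ultimately consider "m = 3 * n" | "m = 3 * n + 1" | "m = 3 * n + 2" by auto
  then show ?thesis
  proof cases
    case 1
    then show ?thesis using red[of n 0] red[of "2 * n" 0] by (simp add: mult.assoc)
  next
    case 2
    have e: "2 * m = 3 * (2 * n) + 2" using 2 by simp
    have "\<not> 3 dvd m" using 2 by presburger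
    then show ?thesis unfolding e unfolding 2 red using omega_sum by simp
  next
    case 3
    have e: "2 * m = 3 * (2 * n + 1) + 1" using 3 by simp
    have "\<not> 3 dvd m" using 3 by presburger
    then show ?thesis unfolding e unfolding 3 red using omega_sum by (simp add: algebra_simps)
  qed
qed

text \<open>The discrete Fourier projection: applied to \<open>i \<mapsto> F(\<omega>\<^sup>i x)\<close> it selects the terms of \<open>F\<close> whose exponent is
\<open>r\<close> modulo 3. The exponent \<open>2ir\<close> of \<open>\<omega>\<close> stands for \<open>- ir\<close>.\<close>

definition residue_filter :: "nat \<Rightarrow> (nat \<Rightarrow> complex) \<Rightarrow> complex" where
  "residue_filter r F = (\<Sum>i<3. omega ^ (2 * i * r) * F i) / 3"

lemma residue_filter_power: "r < 3 \<Longrightarrow> residue_filter r (\<lambda>i. F * (omega ^ i * x) ^ N) = (if N mod 3 = r then F * x ^ N else 0)"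
proof -
  assume r: "r < 3"
  have "residue_filter r (\<lambda>i. F * (omega ^ i * x) ^ N) = F * x ^ N * (1 + omega ^ (2 * r + N) + omega ^ (2 * (2 * r + N))) / 3"
    by (simp add: residue_filter_def numeral_eq_Suc power_mult_distrib power_add algebra_simps flip: power_mult)
  also have "1 + omega ^ (2 * r + N) + omega ^ (2 * (2 * r + N)) = (if N mod 3 = r then 3 else 0)"
  proof -
    have "3 dvd (2 * r + N) \<longleftrightarrow> N mod 3 = r" using r by presburger
    then show ?thesis by (simp only: omega_power_sum)
  qed
  finally show ?thesis by (cases "N mod 3 = r") simp_all
qed

lemma residue_filter_sums:
  assumes F: "unit_radius F" and x: "norm x < 1" and r: "r < 3"
  shows "(\<lambda>n. fps_nth F (3 * n + r) * x ^ (3 * n + r)) sums residue_filter r (\<lambda>i. eval_fps F (omega ^ i * x))"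
proof -
  have x': "norm (omega ^ i * x) < 1" for i
    using x by (simp add: norm_mult norm_power norm_omega)
  have "(\<lambda>N. residue_filter r (\<lambda>i. fps_nth F N * (omega ^ i * x) ^ N)) sums residue_filter r (\<lambda>i. eval_fps F (omega ^ i * x))"
    unfolding residue_filter_def
    by (intro sums_divide sums_sum sums_mult sums_eval_fps unit_radius_norm_less F x')
  then have "(\<lambda>N. if N mod 3 = r then fps_nth F N * x ^ N else 0) sums residue_filter r (\<lambda>i. eval_fps F (omega ^ i * x))"
    by (simp only: residue_filter_power[OF r])
  also have "?this \<longleftrightarrow> (\<lambda>n. (\<lambda>N. if N mod 3 = r then fps_nth F N * x ^ N else 0) (3 * n + r)) sums residue_filter r (\<lambda>i. eval_fps F (omega ^ i * x))"
  proof (rule sums_mono_reindex[symmetric])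
    show "strict_mono (\<lambda>n. 3 * n + r)" by (simp add: strict_mono_def)
    fix N assume N: "N \<notin> range (\<lambda>n. 3 * n + r)"
    have "N = 3 * (N div 3) + N mod 3" by simp
    then have "N mod 3 \<noteq> r" using N by (metis rangeI)
    then show "(if N mod 3 = r then fps_nth F N * x ^ N else 0) = 0" by simp
  qed
  finally show ?thesis using r by simp
qed

text \<open>The projection keeps the monomials \<open>A\<^sup>i c\<^sup>j\<close> with \<open>j \<equiv> k = i + j\<close> modulo 3. Then \<open>3 | i\<close>, and \<open>A\<^sup>i\<close> is a power of
\<open>b\<^sup>3 + c\<^sup>3\<close>. In the result the first variable is \<open>c\<close> and the second is \<open>b\<close>.\<close>

lemma rat_form_residue_filter:
  assumes "rat_form k g"
  shows "\<exists>h. rat_form k h \<and> (\<forall>A b c. A ^ 3 = b ^ 3 + c ^ 3 \<longrightarrow>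
           residue_filter (k mod 3) (\<lambda>i. g A (omega ^ i * c)) = h c b)"
  using assms
proof (induction rule: rat_form.induct)
  case (zero N)
  then show ?case by (intro exI[of _ "\<lambda>u v. 0"]) (simp add: rat_form.zero residue_filter_def)
next
  case (add_monomial i j N g q)
  then obtain h where h: "rat_form N h" "\<And>A b c. A ^ 3 = b ^ 3 + c ^ 3 \<Longrightarrow>
           residue_filter (N mod 3) (\<lambda>i. g A (omega ^ i * c)) = h c b" by blast
  have s: "residue_filter (N mod 3) (\<lambda>l. of_rat q * A ^ i * (omega ^ l * c) ^ j + g A (omega ^ l * c))
      = (if j mod 3 = N mod 3 then of_rat q * A ^ i * c ^ j else 0) + residue_filter (N mod 3) (\<lambda>i. g A (omega ^ i * c))" for A c
    by (subst residue_filter_power[symmetric]) (simp_all add: residue_filter_def sum.distrib add_divide_distrib distrib_left)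
  show ?case
  proof (cases "j mod 3 = N mod 3")
    case False
    then show ?thesis using h s by (intro exI[of _ h]) simp
  next
    case True
    have "3 dvd i" using True add_monomial(1) by (metis add_diff_cancel_right' mod_eq_dvd_iff_nat le_add2)
    then obtain l where l: "i = 3 * l" by (auto elim: dvdE)
    have "rat_form (3 * 1) (\<lambda>u v. of_rat 1 * u ^ 0 * v ^ 3 + of_rat 1 * u ^ 3 * v ^ 0)"
      by (intro rat_form_add rat_form_monomial) auto
    then have "rat_form (0 + j + 3 * l) (\<lambda>u v. of_rat q * v ^ 0 * u ^ j * (v ^ 3 + u ^ 3) ^ l)"
      using rat_form_monomial_mult[OF rat_form_power[of 3 "\<lambda>u v. v ^ 3 + u ^ 3" l], of j 0 q] by (simp add: mult.commute)
    then have "rat_form N (\<lambda>u v. of_rat q * (v ^ 3 + u ^ 3) ^ l * u ^ j + h u v)"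
      using add_monomial(1) by (intro rat_form_add h(1)) (simp add: l mult_ac add.commute)
    moreover have "residue_filter (N mod 3) (\<lambda>l. of_rat q * A ^ i * (omega ^ l * c) ^ j + g A (omega ^ l * c))
       = of_rat q * (b ^ 3 + c ^ 3) ^ l * c ^ j + h c b" if "A ^ 3 = b ^ 3 + c ^ 3" for A b c
      using h(2)[OF that] that True unfolding s by (simp add: l power_mult)
    ultimately show ?thesis by blast
  qed
qed

section \<open>The divisor sums\<close>

lemma eisenstein_rat_form:
  assumes "j \<noteq> 1"
  shows "\<exists>g. rat_form (Suc j) g \<and> (\<forall>x. punctured_disc x \<longrightarrow>
     eisenstein j x = g (eval_fps theta_a (x ^ 3)) (x * eval_fps theta_c (x ^ 3)))"
  using assms
proof (induction j rule: less_induct)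
  case (less j)
  define A B where "A x = eval_fps theta_a (x ^ 3)" and "B x = x * eval_fps theta_c (x ^ 3)" for x :: complex
  define Rep where "Rep i g \<longleftrightarrow> rat_form (Suc i) g \<and> (\<forall>x. punctured_disc x \<longrightarrow> eisenstein i x = g (A x) (B x))" for i g
  have "\<exists>g. Rep i g" if "i < j" "i \<noteq> 1" for i
    using less.IH[OF that] by (simp add: Rep_def A_def B_def)
  then obtain G where G: "\<And>i. i < j \<Longrightarrow> i \<noteq> 1 \<Longrightarrow> Rep i (G i)" by metis
  consider "j = 0" | "j = 2" | "j \<ge> 3" using less.prems by linarith
  then have "\<exists>g. Rep j g"
  proof cases
    case 1
    have "rat_form (Suc 0) (\<lambda>u v. of_rat (1 / 6) * u ^ 1 * v ^ 0 + of_rat (1 / 3) * u ^ 0 * v ^ 1)"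
      by (intro rat_form_add rat_form_monomial) auto
    then have "Rep 0 (\<lambda>u v. of_rat (1 / 6) * u ^ 1 * v ^ 0 + of_rat (1 / 3) * u ^ 0 * v ^ 1)"
      by (auto simp: Rep_def A_def B_def punctured_disc.eisenstein_0_2_eq_theta of_rat_divide add_divide_distrib)
    then show ?thesis unfolding 1 by blast
  next
    case 2
    have "rat_form (Suc 2) (\<lambda>u v. of_rat (1 / 3) * u ^ 2 * v ^ 1 + of_rat (1 / 3) * u ^ 1 * v ^ 2
        + of_rat (1 / 3) * u ^ 0 * v ^ 3)"
      by (intro rat_form_add rat_form_monomial) auto
    then have "Rep 2 (\<lambda>u v. of_rat (1 / 3) * u ^ 2 * v ^ 1 + of_rat (1 / 3) * u ^ 1 * v ^ 2
        + of_rat (1 / 3) * u ^ 0 * v ^ 3)"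
      by (auto simp: Rep_def A_def B_def punctured_disc.eisenstein_0_2_eq_theta of_rat_divide add_divide_distrib)
    then show ?thesis unfolding 2 by blast
  next
    case 3
    define k where "k = j - 2"
    have k: "k \<ge> 1" "j = k + 2" using 3 by (auto simp: k_def)
    define q :: "nat \<Rightarrow> rat" where "q i = 2 * (1 + (- 1) ^ i) * of_nat (k choose i)" for i
    define g where "g = (\<lambda>u v. of_rat 6 * (G 0 u v * G (k + 1) u v)
       + (\<Sum>i=1..<k. of_rat (q i) * (if i = 1 then 0 else G i u v * G (k + 1 - i) u v)))"
    have "rat_form (Suc j) g"
      unfolding g_def
    proof (intro rat_form_add rat_form_sum rat_form_scale)
      show "rat_form (Suc j) (\<lambda>u v. G 0 u v * G (k + 1) u v)"
        using rat_form_mult[of "Suc 0" "G 0" "Suc (k + 1)" "G (k + 1)"] G[of 0] G[of "k + 1"] k by (simp add: Rep_def)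
      fix i assume i: "i \<in> {1..<k}"
      show "rat_form (Suc j) (\<lambda>u v. if i = 1 then 0 else G i u v * G (k + 1 - i) u v)"
      proof (cases "i = 1")
        case False
        have "Suc i + Suc (k + 1 - i) = Suc j" "k + 1 - i \<noteq> 1" using i k by auto
        then show ?thesis
          using False rat_form_mult[of "Suc i" "G i" "Suc (k + 1 - i)" "G (k + 1 - i)"] G[of i] G[of "k + 1 - i"] i k
          by (simp add: Rep_def)
      qed (simp add: rat_form.zero)
    qed simp
    moreover have "eisenstein j x = g (A x) (B x)" if "punctured_disc x" for x
    proof -
      interpret punctured_disc x by fact
      have G': "eisenstein i x = G i (A x) (B x)" if "i < j" "i \<noteq> 1" for i
        using G[OF that] punctured_disc_axioms by (simp add: Rep_def)
      have "eisenstein j x = 6 * eisenstein 0 x * eisenstein (k + 1) x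
          + (\<Sum>i = 1..<k. 2 * (1 + (- 1) ^ i) * of_nat (k choose i) * eisenstein i x * eisenstein (k + 1 - i) x)"
        unfolding k(2) by (rule eisenstein_recurrence[OF k(1)])
      also have "(\<Sum>i = 1..<k. 2 * (1 + (- 1) ^ i) * of_nat (k choose i) * eisenstein i x * eisenstein (k + 1 - i) x)
         = (\<Sum>i=1..<k. of_rat (q i) * (if i = 1 then 0 else G i (A x) (B x) * G (k + 1 - i) (A x) (B x)))"
      proof (rule sum.cong)
        fix i assume i: "i \<in> {1..<k}"
        have q: "of_rat (q i) = 2 * (1 + (- 1) ^ i) * (of_nat (k choose i) :: complex)"
          by (simp add: q_def of_rat_mult of_rat_add of_rat_power of_rat_minus)
        show "2 * (1 + (- 1) ^ i) * of_nat (k choose i) * eisenstein i x * eisenstein (k + 1 - i) x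
          = of_rat (q i) * (if i = 1 then 0 else G i (A x) (B x) * G (k + 1 - i) (A x) (B x))"
        proof (cases "i = 1")
          case False
          have idx: "k + 1 - i \<noteq> 1" "k + 1 - i < j" "i < j" using i k by auto
          have "eisenstein i x = G i (A x) (B x)" "eisenstein (k + 1 - i) x = G (k + 1 - i) (A x) (B x)"
            using G'[of i] G'[of "k + 1 - i"] idx False by auto
          then show ?thesis using False by (simp only: q mult.assoc if_False)
        qed simp
      qed simp
      finally show ?thesis using G'[of 0] G'[of "k + 1"] k by (simp add: g_def mult.assoc)
    qed
    ultimately show ?thesis by (auto simp: Rep_def)
  qed
  then show ?case by (simp add: Rep_def A_def B_def)
qed

lemma omega_power_cube: "(omega ^ i * x) ^ 3 = x ^ 3"
  by (metis mult.commute mult_1 omega_cube power_mult power_mult_distrib power_one)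

lemma punctured_disc_rotate: "punctured_disc x \<Longrightarrow> punctured_disc (omega ^ i * x)"
  by (simp add: punctured_disc_def norm_mult norm_power norm_omega omega_neq_0)

text \<open>For \<open>k = 2\<close>, the series \<open>E\<^sub>1\<close> agrees with the form \<open>3 E\<^sub>0\<^sup>2\<close> only up to a
function of \<open>x\<^sup>3\<close>, which the projection onto the exponents congruent to 2 annihilates.\<close>

lemma residue_filter_eisenstein_rat_form:
  assumes k: "k \<ge> 1"
  shows "\<exists>g. rat_form k g \<and> (\<forall>x. punctured_disc x \<longrightarrow> residue_filter (k mod 3) (\<lambda>i. eisenstein (k - 1) (omega ^ i * x))
     = residue_filter (k mod 3) (\<lambda>i. g (eval_fps theta_a (x ^ 3)) (omega ^ i * (x * eval_fps theta_c (x ^ 3)))))"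
proof (cases "k = 2")
  case False
  then have "k - 1 \<noteq> 1" "Suc (k - 1) = k" using k by auto
  then obtain g where g: "rat_form k g" "\<And>x. punctured_disc x \<Longrightarrow>
     eisenstein (k - 1) x = g (eval_fps theta_a (x ^ 3)) (x * eval_fps theta_c (x ^ 3))"
    using eisenstein_rat_form[of "k - 1"] by auto
  show ?thesis
  proof (intro exI[of _ g] conjI allI impI g(1))
    fix x :: complex assume x: "punctured_disc x"
    have "eisenstein (k - 1) (omega ^ i * x) = g (eval_fps theta_a (x ^ 3)) (omega ^ i * (x * eval_fps theta_c (x ^ 3)))" for i
      using g(2)[OF punctured_disc_rotate[OF x]] by (simp add: omega_power_cube mult.assoc)
    then show "residue_filter (k mod 3) (\<lambda>i. eisenstein (k - 1) (omega ^ i * x))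
     = residue_filter (k mod 3) (\<lambda>i. g (eval_fps theta_a (x ^ 3)) (omega ^ i * (x * eval_fps theta_c (x ^ 3))))" by simp
  qed
next
  case True
  have "rat_form 1 (\<lambda>u v. of_rat (1 / 6) * u ^ 1 * v ^ 0 + of_rat (1 / 3) * u ^ 0 * v ^ 1)"
    by (intro rat_form_add rat_form_monomial) auto
  from rat_form_scale[OF rat_form_power[OF this, of 2], of 3]
  have g: "rat_form 2 (\<lambda>u v. 3 * ((u + 2 * v) / 6)\<^sup>2)"
    by (simp add: of_rat_divide add_divide_distrib)
  show ?thesis unfolding True
  proof (intro exI[of _ "\<lambda>u v. 3 * ((u + 2 * v) / 6)\<^sup>2"] conjI allI impI g)
    fix x :: complex assume x: "punctured_disc x"
    define A B where "A = eval_fps theta_a (x ^ 3)" and "B = x * eval_fps theta_c (x ^ 3)"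
    \<comment> \<open>A function of \<open>x\<^sup>3\<close>, hence the same for \<open>x\<close>, \<open>\<omega>x\<close> and \<open>\<omega>\<^sup>2x\<close>.\<close>
    define D where "D = 1 / 12 + (\<Sum>\<^sub>\<infinity>k. if k = 0 then 0 else geometric_factor x k * geometric_factor x (- k))"
    have f: "geometric_factor (omega ^ i * x) n = geometric_factor x n" for i n
    proof -
      have "(omega ^ i * x) powi (3 * n) = ((omega ^ i * x) ^ 3) powi n" by (simp add: power_int_mult)
      also have "\<dots> = x powi (3 * n)" by (simp add: omega_power_cube power_int_mult)
      finally show ?thesis by (simp add: geometric_factor_def)
    qed
    have z1: "eisenstein 1 (omega ^ i * x) = 3 * ((A + 2 * (omega ^ i * B)) / 6)\<^sup>2 - D" for i
    proof -
      interpret punctured_disc "omega ^ i * x" by (rule punctured_disc_rotate[OF x])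
      have z0: "eisenstein 0 (omega ^ i * x) = (A + 2 * (omega ^ i * B)) / 6"
        using eisenstein_0_2_eq_theta(1) by (simp add: omega_power_cube A_def B_def mult.assoc)
      have "3 * (3 * (eisenstein 0 (omega ^ i * x))\<^sup>2) = 3 * (eisenstein 1 (omega ^ i * x) + D)"
        using eisenstein_weight_2 unfolding f by (simp add: D_def)
      then have "3 * (eisenstein 0 (omega ^ i * x))\<^sup>2 = eisenstein 1 (omega ^ i * x) + D"
        by (simp only: mult_cancel_left) simp
      then show ?thesis by (simp add: z0)
    qed
    have "residue_filter 2 (\<lambda>i. eisenstein (2 - 1) (omega ^ i * x)) = residue_filter 2 (\<lambda>i. 3 * ((A + 2 * (omega ^ i * B)) / 6)\<^sup>2)
         - residue_filter 2 (\<lambda>i. D * (omega ^ i * 1) ^ 0)"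
    proof -
      have e: "(\<lambda>i. eisenstein (2 - 1) (omega ^ i * x))
          = (\<lambda>i. 3 * ((A + 2 * (omega ^ i * B)) / 6)\<^sup>2 - D * (omega ^ i * 1) ^ 0)"
        using z1 by simp
      show ?thesis unfolding e
        by (simp add: residue_filter_def right_diff_distrib sum_subtractf diff_divide_distrib)
    qed
    then show "residue_filter (2 mod 3) (\<lambda>i. eisenstein (2 - 1) (omega ^ i * x))
     = residue_filter (2 mod 3) (\<lambda>i. 3 * ((eval_fps theta_a (x ^ 3) + 2 * (omega ^ i * (x * eval_fps theta_c (x ^ 3)))) / 6)\<^sup>2)"
      using residue_filter_power[of 2 D 1 0] by (simp add: A_def B_def)
  qed
qed

definition cube_root_q :: "complex \<Rightarrow> complex" where
  "cube_root_q \<tau> = exp (2 * of_real pi * \<i> * \<tau> / 3)"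

lemma norm_cube_root_q: "Im \<tau> > 0 \<Longrightarrow> norm (cube_root_q \<tau>) < 1"
  by (simp add: cube_root_q_def norm_exp_eq_Re)

lemma qpow_third: "qpow \<tau> (of_nat N / 3) = cube_root_q \<tau> ^ N"
  by (simp add: qpow_def cube_root_q_def of_rat_divide mult_ac flip: exp_of_nat_mult)

text \<open>The second equation is \<open>a\<^sup>3 = b\<^sup>3 + c\<^sup>3\<close> at the argument \<open>q = x\<^sup>3\<close>.\<close>

lemma borwein_eq_theta:
  assumes "Im \<tau> > 0"
  defines "x \<equiv> cube_root_q \<tau>"
  shows "borwein_c \<tau> = x * eval_fps theta_c (x ^ 3)"
    and "eval_fps theta_a (x ^ 3) ^ 3 = borwein_b \<tau> ^ 3 + borwein_c \<tau> ^ 3"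
proof -
  have x: "norm x < 1" using norm_cube_root_q[OF assms(1)] by (simp add: x_def)
  have x3: "norm (x ^ 3) < 1" using x by (simp add: norm_power power_less_one_iff)
  have c: "qpow \<tau> ((of_int n + 1/3)^2 + (of_int n + 1/3) * (of_int m + 1/3) + (of_int m + 1/3)^2)
     = x * (x ^ 3) ^ nat (shifted_norm_form m n)" for m n
  proof -
    define N where "N = 3 * nat (shifted_norm_form m n) + 1"
    have "(of_int n + 1/3)^2 + (of_int n + 1/3) * (of_int m + 1/3) + (of_int m + 1/3)^2 = of_int (3 * shifted_norm_form m n + 1) / (3 :: rat)"
      by (simp add: shifted_norm_form_def power2_eq_square field_simps)
    also have "3 * shifted_norm_form m n + 1 = int N" using shifted_norm_form_nonneg[of m n] by (simp add: N_def)
    finally have e: "(of_int n + 1/3)^2 + (of_int n + 1/3) * (of_int m + 1/3) + (of_int m + 1/3)^2 = of_nat N / (3 :: rat)" by simp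
    show ?thesis unfolding e qpow_third by (simp add: N_def x_def power_mult)
  qed
  show bc: "borwein_c \<tau> = x * eval_fps theta_c (x ^ 3)"
    unfolding borwein_c_def c
    using has_sum_cmult_right[OF has_sum_theta_c[OF x3], of x] by (simp add: has_sum_iff case_prod_unfold)
  have b: "qpow \<tau> (of_int (n^2 + n * m + m^2)) = (x ^ 3) ^ nat (norm_form n m)" for m n
  proof -
    define N where "N = 3 * nat (norm_form n m)"
    have "of_int (n^2 + n * m + m^2) = of_int (3 * norm_form n m) / (3 :: rat)" by (simp add: norm_form_def)
    also have "3 * norm_form n m = int N" using norm_form_nonneg[of n m] by (simp add: N_def)
    finally have "of_int (n^2 + n * m + m^2) = of_nat N / (3 :: rat)" by simp
    then show ?thesis by (simp only: qpow_third N_def x_def power_mult)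
  qed
  define q where "q = x ^ 3"
  have bb: "borwein_b \<tau> = eval_fps theta_a (q ^ 3) - q * eval_fps theta_c (q ^ 3)"
  proof -
    have "((\<lambda>(m, n). omega powi (n - m) * q ^ nat (norm_form n m)) has_sum
       eval_fps theta_a (q ^ 3) + (omega + omega\<^sup>2) * (q * eval_fps theta_c (q ^ 3))) UNIV"
      using has_sum_reindex_inverse[OF _ _ has_sum_theta_twisted[OF x3 omega_cube], of prod.swap prod.swap]
      by (simp add: case_prod_unfold q_def)
    moreover have "omega + omega\<^sup>2 = -1" using omega_sum by (simp add: eq_neg_iff_add_eq_0 algebra_simps)
    ultimately show ?thesis unfolding borwein_b_def b by (simp add: has_sum_iff q_def case_prod_unfold)
  qed
  show "eval_fps theta_a (x ^ 3) ^ 3 = borwein_b \<tau> ^ 3 + borwein_c \<tau> ^ 3"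
    using theta_a_cubes(2)[OF x3] unfolding bc bb by (simp add: q_def power_mult_distrib)
qed

theorem residue_filter_eisenstein_fps_polynomial:
  fixes c :: rat
  assumes k: "k \<ge> 1"
  shows "\<exists>P. homogeneous2 k P \<and> (\<forall>\<tau>. Im \<tau> > 0 \<longrightarrow>
     (\<lambda>n. of_rat c * fps_nth (eisenstein_fps (k - 1)) (3 * n + k mod 3) * qpow \<tau> (of_nat (3 * n + k mod 3) / 3))
       sums eval2 P (borwein_c \<tau>) (borwein_b \<tau>))"
proof -
  obtain g where g: "rat_form k g" "\<And>x. punctured_disc x \<Longrightarrow> residue_filter (k mod 3) (\<lambda>i. eisenstein (k - 1) (omega ^ i * x))
     = residue_filter (k mod 3) (\<lambda>i. g (eval_fps theta_a (x ^ 3)) (omega ^ i * (x * eval_fps theta_c (x ^ 3))))"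
    using residue_filter_eisenstein_rat_form[OF k] by blast
  obtain h where h: "rat_form k h" "\<And>A b c. A ^ 3 = b ^ 3 + c ^ 3 \<Longrightarrow> residue_filter (k mod 3) (\<lambda>i. g A (omega ^ i * c)) = h c b"
    using rat_form_residue_filter[OF g(1)] by blast
  obtain P where P: "homogeneous2 k P" "\<And>u v. eval2 P u v = of_rat c * h u v"
    using rat_form_imp_polynomial[OF rat_form_scale[OF h(1), of c]] by blast
  show ?thesis
  proof (intro exI[of _ P] conjI allI impI P(1))
    fix \<tau> :: complex assume \<tau>: "Im \<tau> > 0"
    define x where "x = cube_root_q \<tau>"
    have x: "norm x < 1" using norm_cube_root_q[OF \<tau>] by (simp add: x_def)
    have pd: "punctured_disc x" using x by unfold_locales (auto simp: x_def cube_root_q_def)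
    have "(\<lambda>n. fps_nth (eisenstein_fps (k - 1)) (3 * n + k mod 3) * x ^ (3 * n + k mod 3)) sums
       residue_filter (k mod 3) (\<lambda>i. eval_fps (eisenstein_fps (k - 1)) (omega ^ i * x))"
      by (intro residue_filter_sums unit_radius_eisenstein_fps x) simp
    also have "residue_filter (k mod 3) (\<lambda>i. eval_fps (eisenstein_fps (k - 1)) (omega ^ i * x)) = residue_filter (k mod 3) (\<lambda>i. eisenstein (k - 1) (omega ^ i * x))"
      by (simp add: punctured_disc.eval_eisenstein_fps[OF punctured_disc_rotate[OF pd]])
    also have "\<dots> = h (borwein_c \<tau>) (borwein_b \<tau>)"
      unfolding g(2)[OF pd] borwein_eq_theta(1)[OF \<tau>, folded x_def, symmetric]
      by (rule h(2)) (rule borwein_eq_theta(2)[OF \<tau>, folded x_def])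
    finally have "(\<lambda>n. of_rat c * (fps_nth (eisenstein_fps (k - 1)) (3 * n + k mod 3) * x ^ (3 * n + k mod 3))) sums (of_rat c * h (borwein_c \<tau>) (borwein_b \<tau>))"
      by (rule sums_mult)
    then show "(\<lambda>n. of_rat c * fps_nth (eisenstein_fps (k - 1)) (3 * n + k mod 3) * qpow \<tau> (of_nat (3 * n + k mod 3) / 3))
       sums eval2 P (borwein_c \<tau>) (borwein_b \<tau>)"
      by (simp only: P(2) qpow_third x_def mult.assoc)
  qed
qed

lemma least_pos_residue3_eq:
  assumes "k mod 3 \<noteq> 0"
  shows "least_pos_residue3 (int k) = k mod 3"
  unfolding least_pos_residue3_def
proof (rule Least_equality)
  show "0 < k mod 3 \<and> [int (k mod 3) = int k] (mod 3)"
    using assms by (simp add: cong_def zmod_int)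
  fix r assume "0 < r \<and> [int r = int k] (mod 3)"
  then have "int (r mod 3) = int (k mod 3)" by (simp add: cong_def zmod_int)
  then have "r mod 3 = k mod 3" by linarith
  then show "k mod 3 \<le> r" by (metis mod_less_eq_dividend)
qed

lemma Legendre_3: "of_int (Legendre (int d) 3) = chi 0 d"
proof -
  have sq: "y\<^sup>2 mod 3 \<noteq> 2" for y :: int
  proof -
    have "y mod 3 = 0 \<or> y mod 3 = 1 \<or> y mod 3 = 2" by presburger
    then have "(y mod 3)\<^sup>2 mod 3 \<noteq> 2" by auto
    then show ?thesis by (simp add: power_mod)
  qed
  have "d mod 3 < 3" by simp
  then consider "d mod 3 = 0" | "d mod 3 = 1" | "d mod 3 = 2" by linarith
  then show ?thesis
  proof cases
    case 1
    then have "int d mod 3 = 0" by presburger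
    then show ?thesis using 1 by (simp add: Legendre_def cong_def chi_def)
  next
    case 2
    then have d: "int d mod 3 = 1" by presburger
    then have "QuadRes 3 (int d)" unfolding QuadRes_def by (intro exI[of _ 1]) (simp add: cong_def)
    then show ?thesis using 2 d by (simp add: Legendre_def cong_def chi_def)
  next
    case 3
    then have d: "int d mod 3 = 2" by presburger
    then have "\<not> QuadRes 3 (int d)" using sq by (auto simp: QuadRes_def cong_def)
    then show ?thesis using 3 d by (simp add: Legendre_def cong_def chi_def)
  qed
qed

lemma divisor_sum_eq_eisenstein_fps:
  assumes N: "N mod 3 \<noteq> 0" and j: "odd j"
  shows "of_nat (\<Sum>d | d dvd N. d ^ j) = fps_nth (eisenstein_fps j) N"
proof -
  have "N > 0" using N by (intro Nat.gr0I) auto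
  have "chi j (N div d) = 1" if "d dvd N" for d
  proof -
    have "N div d mod 3 \<noteq> 0"
    proof
      assume "N div d mod 3 = 0"
      then have "3 dvd N div d" by (simp add: dvd_eq_mod_eq_0)
      then have "3 dvd d * (N div d)" by simp
      then show False using that N by (simp add: dvd_eq_mod_eq_0)
    qed
    then show ?thesis using j by (simp add: chi_def)
  qed
  then show ?thesis using \<open>N > 0\<close> by (simp add: eisenstein_fps_nth)
qed

lemma chi_0_mult: "chi 0 (d * e) = chi 0 d * chi 0 e"
proof -
  have de: "(d * e) mod 3 = (d mod 3) * (e mod 3) mod 3" by (simp add: mod_mult_eq)
  have "d mod 3 = 0 \<or> d mod 3 = 1 \<or> d mod 3 = 2" "e mod 3 = 0 \<or> e mod 3 = 1 \<or> e mod 3 = 2"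
    by presburger+
  then show ?thesis unfolding chi_def de by auto
qed

text \<open>In the theorem the quadratic character is evaluated at the divisor \<open>d\<close>, in \<open>E\<^sub>j\<close> at \<open>N/d\<close>; by multiplicativity the two
differ by its value at \<open>N\<close>, a sign that is constant on a residue class.\<close>

lemma twisted_divisor_sum_eq_eisenstein_fps:
  assumes N: "N mod 3 \<noteq> 0" and j: "even j"
  shows "of_int (\<Sum>d | d dvd N. Legendre (int d) 3 * int d ^ j) = chi 0 N * fps_nth (eisenstein_fps j) N"
proof -
  have "N > 0" using N by (intro Nat.gr0I) auto
  have c: "chi j m = chi 0 m" for m using j by (simp add: chi_def)
  have swap: "chi 0 d = chi 0 N * chi 0 (N div d)" if "d dvd N" for d
  proof -
    obtain e where e: "N = d * e" using \<open>d dvd N\<close> by (auto elim: dvdE)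
    have "d > 0" using e \<open>N > 0\<close> by (intro Nat.gr0I) auto
    have "\<not> 3 dvd e" using N e by (metis dvd_imp_mod_0 dvd_mult)
    then have "e mod 3 \<noteq> 0" by (metis mod_0_imp_dvd)
    then have "chi 0 e * chi 0 e = 1" by (simp add: chi_def)
    then show ?thesis using \<open>d > 0\<close> by (simp add: e chi_0_mult mult.assoc)
  qed
  have "of_int (\<Sum>d | d dvd N. Legendre (int d) 3 * int d ^ j)
      = (\<Sum>d | d dvd N. chi 0 d * of_nat d ^ j)"
    by (simp add: Legendre_3)
  also have "\<dots> = (\<Sum>d | d dvd N. chi 0 N * (of_nat d ^ j * chi j (N div d)))"
  proof (rule sum.cong)
    fix d assume "d \<in> {d. d dvd N}"
    then have "chi 0 d = chi 0 N * chi j (N div d)" unfolding c by (intro swap) simp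
    then show "chi 0 d * of_nat d ^ j = chi 0 N * (of_nat d ^ j * chi j (N div d))"
      by (simp only: mult_ac)
  qed simp
  finally show ?thesis using \<open>N > 0\<close> by (simp add: eisenstein_fps_nth sum_distrib_left)
qed

theorem lemma2p4:
  fixes n :: nat
  shows
    "(\<not> [n = 0] (mod 3) \<longrightarrow>
       (\<exists>N P. homogeneous2 N P \<and>
         (\<forall>\<tau>. Im \<tau> > 0 \<longrightarrow>
           (\<lambda>k. of_nat (\<Sum>d | d dvd 3 * k + least_pos_residue3 (2 * int n). d ^ (2 * n - 1))
                * qpow \<tau> (of_nat (3 * k + least_pos_residue3 (2 * int n)) / 3))
           sums eval2 P (borwein_c \<tau>) (borwein_b \<tau>))))
   \<and> (\<not> [n = 1] (mod 3) \<longrightarrow>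
       (\<exists>N P. homogeneous2 N P \<and>
         (\<forall>\<tau>. Im \<tau> > 0 \<longrightarrow>
           (\<lambda>k. of_int (\<Sum>d | d dvd 3 * k + least_pos_residue3 (2 * int n + 1).
                  Legendre (int d) 3 * int d ^ (2 * n))
                * qpow \<tau> (of_nat (3 * k + least_pos_residue3 (2 * int n + 1)) / 3))
           sums eval2 P (borwein_c \<tau>) (borwein_b \<tau>))))"
proof (intro conjI impI)
  assume "\<not> [n = 0] (mod 3)"
  then have "n mod 3 \<noteq> 0" by (simp add: cong_def)
  then have k: "2 * n mod 3 \<noteq> 0" "2 * n \<ge> 1" by presburger+
  have r: "least_pos_residue3 (2 * int n) = 2 * n mod 3"
    using least_pos_residue3_eq[OF k(1)] by simp
  have nz: "(3 * i + 2 * n mod 3) mod 3 \<noteq> 0" for i using k(1) by simp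
  have odd: "odd (2 * n - 1)" using k(2) by simp
  have eq: "of_nat (\<Sum>d | d dvd 3 * i + 2 * n mod 3. d ^ (2 * n - 1))
      = of_rat 1 * fps_nth (eisenstein_fps (2 * n - 1)) (3 * i + 2 * n mod 3)" for i
    by (simp only: divisor_sum_eq_eisenstein_fps[OF nz odd] of_rat_1 mult_1)
  obtain P where P: "homogeneous2 (2 * n) P"
    "\<And>\<tau>. Im \<tau> > 0 \<Longrightarrow>
      (\<lambda>i. of_rat 1 * fps_nth (eisenstein_fps (2 * n - 1)) (3 * i + 2 * n mod 3) * qpow \<tau> (of_nat (3 * i + 2 * n mod 3) / 3))
        sums eval2 P (borwein_c \<tau>) (borwein_b \<tau>)"
    using residue_filter_eisenstein_fps_polynomial[OF k(2), of 1] by blast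
  show "\<exists>N P. homogeneous2 N P \<and>
         (\<forall>\<tau>. Im \<tau> > 0 \<longrightarrow>
           (\<lambda>k. of_nat (\<Sum>d | d dvd 3 * k + least_pos_residue3 (2 * int n). d ^ (2 * n - 1))
                * qpow \<tau> (of_nat (3 * k + least_pos_residue3 (2 * int n)) / 3))
           sums eval2 P (borwein_c \<tau>) (borwein_b \<tau>))"
  proof (intro exI conjI allI impI)
    show "homogeneous2 (2 * n) P" by (rule P(1))
    fix \<tau> :: complex assume "Im \<tau> > 0"
    then show "(\<lambda>k. of_nat (\<Sum>d | d dvd 3 * k + least_pos_residue3 (2 * int n). d ^ (2 * n - 1))
                * qpow \<tau> (of_nat (3 * k + least_pos_residue3 (2 * int n)) / 3))
           sums eval2 P (borwein_c \<tau>) (borwein_b \<tau>)"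
      unfolding r eq by (rule P(2))
  qed
next
  assume "\<not> [n = 1] (mod 3)"
  then have "n mod 3 \<noteq> 1" by (simp add: cong_def)
  then have k: "(2 * n + 1) mod 3 \<noteq> 0" by presburger
  have k1: "2 * n + 1 \<ge> 1" "2 * n + 1 - 1 = 2 * n" by simp_all
  have r: "least_pos_residue3 (2 * int n + 1) = (2 * n + 1) mod 3"
    using least_pos_residue3_eq[OF k] by (simp add: algebra_simps)
  \<comment> \<open>The quadratic character on the residue class of the exponents.\<close>
  define c :: rat where "c = (if (2 * n + 1) mod 3 = 1 then 1 else - 1)"
  have c: "chi 0 (3 * i + (2 * n + 1) mod 3) = of_rat c" for i
    using k by (simp add: chi_def c_def of_rat_minus)
  have nz: "(3 * i + (2 * n + 1) mod 3) mod 3 \<noteq> 0" for i using k by simp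
  have even: "even (2 * n)" by simp
  have eq: "of_int (\<Sum>d | d dvd 3 * i + (2 * n + 1) mod 3. Legendre (int d) 3 * int d ^ (2 * n))
      = of_rat c * fps_nth (eisenstein_fps (2 * n)) (3 * i + (2 * n + 1) mod 3)" for i
    by (simp only: twisted_divisor_sum_eq_eisenstein_fps[OF nz even] c)
  obtain P where P: "homogeneous2 (2 * n + 1) P"
    "\<And>\<tau>. Im \<tau> > 0 \<Longrightarrow>
      (\<lambda>i. of_rat c * fps_nth (eisenstein_fps (2 * n)) (3 * i + (2 * n + 1) mod 3) * qpow \<tau> (of_nat (3 * i + (2 * n + 1) mod 3) / 3))
        sums eval2 P (borwein_c \<tau>) (borwein_b \<tau>)"
    using residue_filter_eisenstein_fps_polynomial[OF k1(1), of c] unfolding k1(2) by blast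
  show "\<exists>N P. homogeneous2 N P \<and>
         (\<forall>\<tau>. Im \<tau> > 0 \<longrightarrow>
           (\<lambda>k. of_int (\<Sum>d | d dvd 3 * k + least_pos_residue3 (2 * int n + 1).
                  Legendre (int d) 3 * int d ^ (2 * n))
                * qpow \<tau> (of_nat (3 * k + least_pos_residue3 (2 * int n + 1)) / 3))
           sums eval2 P (borwein_c \<tau>) (borwein_b \<tau>))"
  proof (intro exI conjI allI impI)
    show "homogeneous2 (2 * n + 1) P" by (rule P(1))
    fix \<tau> :: complex assume "Im \<tau> > 0"
    then show "(\<lambda>k. of_int (\<Sum>d | d dvd 3 * k + least_pos_residue3 (2 * int n + 1).
                  Legendre (int d) 3 * int d ^ (2 * n))
                * qpow \<tau> (of_nat (3 * k + least_pos_residue3 (2 * int n + 1)) / 3))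
           sums eval2 P (borwein_c \<tau>) (borwein_b \<tau>)"
      unfolding r eq by (rule P(2))
  qed
qed


end
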